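(* Let $k$ be a positive integer. The $\eta$-series satisfies the relation $$\eta_{\mu\boxtimes\nu}=\eta_\mu\ \boxed{\star}\ \eta_\nu,\qquad\forall\,\mu,\nu\in\mathcal{D}_{\mathrm{alg}}(k),$$ where $\boxtimes$ is free multiplicative convolution and $\boxed{\star}$ is boxed convolution on $\mathbb{C}_0\langle\langle z_1,\ldots,z_k\rangle\rangle$.
   Context: **Series.** $\mathbb{C}_0\langle\langle z_1,\ldots,z_k\rangle\rangle$ is the space of formal power series with complex coefficients and vanishing constant term in non-commuting indeterminates $z_1,\ldots,z_k$; $\mathrm{Cf}_{(i_1,\ldots,i_n)}(f)$ is the coefficient of $z_{i_1}\cdots z_{i_n}$ in $f$. For a partition $\pi$ of $\{1,\ldots,n\}$, $\mathrm{Cf}_{(i_1,\ldots,i_n);\pi}(f)$ is the product over the blocks $B=\{b_1<\cdots<b_m\}$ of $\pi$ of the coefficients $\mathrm{Cf}_{(i_{b_1},\ldots,i_{b_m})}(f)$. **Partitions.** $NC(n)$ is the set of non-crossing partitions of $\{1,\ldots,n\}$, partially ordered by $\pi\le\rho$ iff every block of $\rho$ is a union of blocks of $\pi$. For $\pi,\rho\in NC(n)$, $\pi^{\mathrm{(odd)}}\sqcup\rho^{\mathrm{(even)}}$ is the partition of $\{1,\ldots,2n\}$ with blocks $\{2a-1\mid a\in A\}$, $A$ a block of $\pi$, and $\{2b\mid b\in B\}$, $B$ a block of $\rho$. The Kreweras complement $K(\pi)$ is the largest $\rho\in NC(n)$ such that $\pi^{\mathrm{(odd)}}\sqcup\rho^{\mathrm{(even)}}\in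 NC(2n)$. **Distributions and transforms.** $\mathcal{D}_{\mathrm{alg}}(k)$ is the set of linear functionals $\mu:\mathbb{C}\langle X_1,\ldots,X_k\rangle\to\mathbb{C}$ (on non-commutative polynomials) with $\mu(1)=1$. A non-commutative probability space $(\mathcal{M},\varphi)$ is a unital algebra $\mathcal{M}$ over $\mathbb{C}$ with a linear functional $\varphi$, $\varphi(1_{\mathcal{M}})=1$; the joint distribution of $x_1,\ldots,x_k\in\mathcal{M}$ is the $\mu\in\mathcal{D}_{\mathrm{alg}}(k)$ with $\mu(X_{i_1}\cdots X_{i_n})=\varphi(x_{i_1}\cdots x_{i_n})$. The moment series $M_\mu$ has $\mathrm{Cf}_{(i_1,\ldots,i_n)}(M_\mu)=\mu(X_{i_1}\cdots X_{i_n})$. The $R$-transform $R_\mu$ is the unique series in $\mathbb{C}_0\langle\langle z_1,\ldots,z_k\rangle\rangle$ with $\mathrm{Cf}_{(i_1,\ldots,i_n)}(M_\mu)=\sum_{\pi\in NC(n)}\mathrm{Cf}_{(i_1,\ldots,i_n);\pi}(R_\mu)$ for all $n\ge1$ and $1\le i_1,\ldots,i_n\le k$. The $\eta$-series is $\eta_\mu=M_\mu(1+M_\mu)^{-1}$; equivalently, it is the unique series with $\mathrm{Cf}_{(i_1,\ldots,i_n)}(M_\mu)=\sum_{\pi}\mathrm{Cf}_{(i_1,\ldots,i_n);\pi}(\eta_\mu)$, the sum being over partitions $\pi$ of $\{1,\ldots,n\}$ all of whose blocks are intervals. **Free multiplicative convolution.** Given $\mu,\nu\in\mathcal{D}_{\mathrm{alg}}(k)$,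 one can find elements $x_1,\ldots,x_k,y_1,\ldots,y_k$ in a non-commutative probability space $(\mathcal{M},\varphi)$ such that $x_1,\ldots,x_k$ have joint distribution $\mu$, $y_1,\ldots,y_k$ have joint distribution $\nu$, and $\{x_1,\ldots,x_k\}$ is freely independent from $\{y_1,\ldots,y_k\}$ (i.e. the unital subalgebras $\mathcal{A}_1,\mathcal{A}_2$ they generate satisfy $\varphi(a_1\cdots a_n)=0$ whenever $a_j\in\mathcal{A}_{r_j}$, $\varphi(a_j)=0$ and $r_j\ne r_{j+1}$ for all $j$). The joint distribution of $x_1y_1,\ldots,x_ky_k$ depends only on $\mu$ and $\nu$, and $\mu\boxtimes\nu$ is defined to be this joint distribution. **Boxed convolution.** For $f,g\in\mathbb{C}_0\langle\langle z_1,\ldots,z_k\rangle\rangle$, $f\ \boxed{\star}\ g$ is the series with $$\mathrm{Cf}_{(i_1,\ldots,i_n)}(f\ \boxed{\star}\ g)=\sum_{\pi\in NC(n)}\mathrm{Cf}_{(i_1,\ldots,i_n);\pi}(f)\cdot\mathrm{Cf}_{(i_1,\ldots,i_n);K(\pi)}(g)$$ for all $n\ge1$ and $1\le i_1,\ldots,i_n\le k$. Equivalently (a known fact), it is the operation determined by $R_{\mu\boxtimes\nu}=R_\mu\ \boxed{\star}\ R_\nu$ for all $\mu,\nu\in\mathcal{D}_{\mathrm{alg}}(k)$. *)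

theory Defs
  imports Complex_Main "HOL-Library.Poly_Mapping" "HOL-Library.Disjoint_Sets"
begin

section \<open>Formal power series in non-commuting indeterminates\<close>

text \<open>The indeterminates are indexed by a type \<open>'k\<close>, and a series is given by its coefficients,
  one for each word in the indeterminates. Multiplication is the Cauchy product over all ways
  of cutting a word in two.\<close>

typedef 'k ncfps = "UNIV :: ('k list \<Rightarrow> complex) set"
  morphisms nccoeff Abs_ncfps ..

lemma nccoeff_Abs_ncfps [simp]: "nccoeff (Abs_ncfps f) = f"
  by (simp add: Abs_ncfps_inverse)

lemma ncfps_eqI: "(\<And>w. nccoeff f w = nccoeff g w) \<Longrightarrow> f = g"
  by (metis ext nccoeff_inject)

instantiation ncfps :: (type) ring_1
begin

definition zero_ncfps_def: "0 = Abs_ncfps (\<lambda>w. 0)"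
definition one_ncfps_def: "1 = Abs_ncfps (\<lambda>w. if w = [] then 1 else 0)"
definition plus_ncfps_def: "f + g = Abs_ncfps (\<lambda>w. nccoeff f w + nccoeff g w)"
definition minus_ncfps_def: "f - g = Abs_ncfps (\<lambda>w. nccoeff f w - nccoeff g w)"
definition uminus_ncfps_def: "- f = Abs_ncfps (\<lambda>w. - nccoeff f w)"
definition times_ncfps_def:
  "f * g = Abs_ncfps (\<lambda>w. \<Sum>i\<le>length w. nccoeff f (take i w) * nccoeff g (drop i w))"

instance
proof
  fix f g h :: "'a ncfps"
  show "f * g * h = f * (g * h)"
  proof (rule ncfps_eqI)
    fix w :: "'a list"
    let ?n = "length w"
    let ?t = "\<lambda>i j. nccoeff f (take i w) * nccoeff g (take j (drop i w)) * nccoeff h (drop (i + j) w)"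
    have "nccoeff (f * g * h) w =
      (\<Sum>i\<le>?n. \<Sum>j\<le>i. nccoeff f (take j w) * nccoeff g (drop j (take i w)) * nccoeff h (drop i w))"
      by (auto simp: times_ncfps_def sum_distrib_right min_absorb1 min_absorb2 intro!: sum.cong)
    also have "\<dots> = (\<Sum>i\<le>?n. \<Sum>j\<le>i. ?t j (i - j))"
      by (intro sum.cong refl) (auto simp: drop_take)
    also have "\<dots> = (\<Sum>(i, j)\<in>(SIGMA i:{..?n}. {..i}). ?t j (i - j))"
      by (subst sum.Sigma) auto
    also have "\<dots> = (\<Sum>(i, j)\<in>(SIGMA i:{..?n}. {..?n - i}). ?t i j)"
      by (rule sum.reindex_bij_witness[where i = "\<lambda>(i, j). (i + j, i)" and j = "\<lambda>(i, j). (j, i - j)"])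
        auto
    also have "\<dots> = (\<Sum>i\<le>?n. \<Sum>j\<le>?n - i. ?t i j)"
      by (subst sum.Sigma) auto
    also have "\<dots> = nccoeff (f * (g * h)) w"
      by (auto simp: times_ncfps_def sum_distrib_left mult.assoc add.commute intro!: sum.cong)
    finally show "nccoeff (f * g * h) w = nccoeff (f * (g * h)) w" .
  qed
  show "1 * f = f"
  proof (rule ncfps_eqI)
    fix w :: "'a list"
    have "nccoeff (1 * f) w = (\<Sum>i\<le>length w. if i = 0 then nccoeff f w else 0)"
      unfolding times_ncfps_def one_ncfps_def nccoeff_Abs_ncfps
      by (intro sum.cong refl) auto
    then show "nccoeff (1 * f) w = nccoeff f w" by simp
  qed
  show "f * 1 = f"
  proof (rule ncfps_eqI)
    fix w :: "'a list"
    have "nccoeff (f * 1) w = (\<Sum>i\<le>length w. if i = length w then nccoeff f w else 0)"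
      unfolding times_ncfps_def one_ncfps_def nccoeff_Abs_ncfps
      by (intro sum.cong refl) auto
    then show "nccoeff (f * 1) w = nccoeff f w" by simp
  qed
  show "(f + g) * h = f * h + g * h" "f * (g + h) = f * g + f * h"
    by (auto simp: times_ncfps_def plus_ncfps_def algebra_simps sum.distrib intro!: ncfps_eqI)
  have "nccoeff (0 :: 'a ncfps) [] \<noteq> nccoeff 1 []"
    by (simp add: zero_ncfps_def one_ncfps_def)
  then show "(0 :: 'a ncfps) \<noteq> 1" by auto
qed (auto simp: zero_ncfps_def plus_ncfps_def minus_ncfps_def uminus_ncfps_def
      algebra_simps intro!: ncfps_eqI)

end

lemma nccoeff_zero [simp]: "nccoeff 0 w = 0"
  and nccoeff_one: "nccoeff 1 w = (if w = [] then 1 else 0)"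
  and nccoeff_add [simp]: "nccoeff (f + g) w = nccoeff f w + nccoeff g w"
  and nccoeff_diff [simp]: "nccoeff (f - g) w = nccoeff f w - nccoeff g w"
  and nccoeff_uminus [simp]: "nccoeff (- f) w = - nccoeff f w"
  and nccoeff_mult: "nccoeff (f * g) w =
        (\<Sum>i\<le>length w. nccoeff f (take i w) * nccoeff g (drop i w))"
  by (simp_all add: zero_ncfps_def one_ncfps_def plus_ncfps_def minus_ncfps_def
      uminus_ncfps_def times_ncfps_def)

definition ncfps0 :: "'k ncfps set" where
  "ncfps0 = {f. nccoeff f [] = 0}"

definition ncfps_inverse :: "'k ncfps \<Rightarrow> 'k ncfps" where
  "ncfps_inverse f = (THE g. f * g = 1 \<and> g * f = 1)"

function ncfps_rinv :: "('k list \<Rightarrow> complex) \<Rightarrow> 'k list \<Rightarrow> complex" where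
  "ncfps_rinv a w = (if w = [] then 1 / a []
     else - (\<Sum>i\<in>{1..length w}. a (take i w) * ncfps_rinv a (drop i w)) / a [])"
  by auto
termination
  by (relation "measure (\<lambda>(a, w). length w)") auto

function ncfps_linv :: "('k list \<Rightarrow> complex) \<Rightarrow> 'k list \<Rightarrow> complex" where
  "ncfps_linv a w = (if w = [] then 1 / a []
     else - (\<Sum>i\<in>{..<length w}. ncfps_linv a (take i w) * a (drop i w)) / a [])"
  by auto
termination
  by (relation "measure (\<lambda>(a, w). length w)") auto

declare ncfps_rinv.simps [simp del] ncfps_linv.simps [simp del]

lemma ncfps_inverse:
  assumes "nccoeff f [] \<noteq> 0"
  shows "f * ncfps_inverse f = 1" and "ncfps_inverse f * f = 1"
proof -
  define r where "r = Abs_ncfps (ncfps_rinv (nccoeff f))"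
  define l where "l = Abs_ncfps (ncfps_linv (nccoeff f))"
  have r: "f * r = 1"
  proof (rule ncfps_eqI)
    fix w
    have "nccoeff (f * r) w = nccoeff f [] * ncfps_rinv (nccoeff f) w +
       (\<Sum>i\<in>{1..length w}. nccoeff f (take i w) * ncfps_rinv (nccoeff f) (drop i w))"
      by (simp add: nccoeff_mult r_def atMost_atLeast0 sum.atLeast_Suc_atMost)
    also have "\<dots> = nccoeff 1 w"
      using assms by (subst ncfps_rinv.simps) (auto simp: nccoeff_one)
    finally show "nccoeff (f * r) w = nccoeff 1 w" .
  qed
  have l: "l * f = 1"
  proof (rule ncfps_eqI)
    fix w
    have "nccoeff (l * f) w = ncfps_linv (nccoeff f) w * nccoeff f [] +
       (\<Sum>i\<in>{..<length w}. ncfps_linv (nccoeff f) (take i w) * nccoeff f (drop i w))"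
      by (simp add: nccoeff_mult l_def flip: lessThan_Suc_atMost)
    also have "\<dots> = nccoeff 1 w"
      using assms by (subst ncfps_linv.simps) (auto simp: nccoeff_one)
    finally show "nccoeff (l * f) w = nccoeff 1 w" .
  qed
  have unique: "g = r" if "g * f = 1" for g
    by (metis that r mult.assoc mult_1_left mult_1_right)
  have "\<exists>!g. f * g = 1 \<and> g * f = 1"
    using r l unique by metis
  from theI'[OF this] show "f * ncfps_inverse f = 1" "ncfps_inverse f * f = 1"
    by (auto simp: ncfps_inverse_def)
qed


section \<open>Non-crossing partitions\<close>

definition part_le :: "nat set set \<Rightarrow> nat set set \<Rightarrow> bool" where
  "part_le \<pi> \<rho> \<longleftrightarrow> (\<forall>B\<in>\<rho>. \<exists>\<C>\<subseteq>\<pi>. B = \<Union>\<C>)"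

definition noncrossing :: "nat set set \<Rightarrow> bool" where
  "noncrossing \<pi> \<longleftrightarrow>
     (\<forall>A\<in>\<pi>. \<forall>B\<in>\<pi>. \<forall>a b c d. a < b \<and> b < c \<and> c < d \<and> a \<in> A \<and> c \<in> A \<and> b \<in> B \<and> d \<in> B
        \<longrightarrow> A = B)"

definition NC :: "nat \<Rightarrow> nat set set set" where
  "NC n = {\<pi>. partition_on {1..n} \<pi> \<and> noncrossing \<pi>}"

definition odd_even_union :: "nat set set \<Rightarrow> nat set set \<Rightarrow> nat set set" where
  "odd_even_union \<pi> \<rho> = (\<lambda>A. (\<lambda>a. 2 * a - 1) ` A) ` \<pi> \<union> (\<lambda>B. (\<lambda>b. 2 * b) ` B) ` \<rho>"

definition kreweras :: "nat \<Rightarrow> nat set set \<Rightarrow> nat set set" where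
  "kreweras n \<pi> = (THE \<rho>. \<rho> \<in> NC n \<and> odd_even_union \<pi> \<rho> \<in> NC (2 * n) \<and>
     (\<forall>\<sigma>\<in>NC n. odd_even_union \<pi> \<sigma> \<in> NC (2 * n) \<longrightarrow> part_le \<sigma> \<rho>))"

lemma part_le_iff_refines:
  assumes "partition_on A \<pi>" "partition_on A \<rho>"
  shows "part_le \<pi> \<rho> \<longleftrightarrow> refines A \<pi> \<rho>"
proof
  assume le: "part_le \<pi> \<rho>"
  have "\<exists>B\<in>\<rho>. C \<subseteq> B" if "C \<in> \<pi>" for C
  proof -
    obtain x where x: "x \<in> C" "x \<in> A"
      using assms(1) \<open>C \<in> \<pi>\<close> by (metis UnionI ex_in_conv partition_on_def)
    then obtain B where B: "B \<in> \<rho>" "x \<in> B"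
      using assms(2) by (auto simp: partition_on_def)
    then obtain \<C> where \<C>: "\<C> \<subseteq> \<pi>" "B = \<Union>\<C>"
      using le by (auto simp: part_le_def)
    then obtain C' where C': "C' \<in> \<C>" "x \<in> C'"
      using B by auto
    then have "C' = C"
      using assms(1) x \<open>C \<in> \<pi>\<close> \<C>
      by (metis (no_types, lifting) disjnt_iff pairwiseD partition_on_def subsetD)
    then show ?thesis using B \<C> C' by auto
  qed
  then show "refines A \<pi> \<rho>" using assms by (auto simp: refines_def)
next
  assume ref: "refines A \<pi> \<rho>"
  show "part_le \<pi> \<rho>"
    unfolding part_le_def
  proof
    fix B assume "B \<in> \<rho>"
    have "B = \<Union>{C\<in>\<pi>. C \<subseteq> B}"
    proof
      show "B \<subseteq> \<Union>{C\<in>\<pi>. C \<subseteq> B}"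
      proof
        fix x assume "x \<in> B"
        then obtain C where C: "C \<in> \<pi>" "x \<in> C"
          using assms \<open>B \<in> \<rho>\<close> by (auto simp: partition_on_def)
        then obtain B' where "B' \<in> \<rho>" "C \<subseteq> B'"
          using ref by (auto simp: refines_def)
        moreover have "B' = B"
          using assms(2) \<open>x \<in> B\<close> \<open>B \<in> \<rho>\<close> C calculation
          by (metis (no_types, lifting) disjnt_iff pairwiseD partition_on_def subsetD)
        ultimately show "x \<in> \<Union>{C\<in>\<pi>. C \<subseteq> B}" using C by auto
      qed
    qed auto
    then show "\<exists>\<C>\<subseteq>\<pi>. B = \<Union>\<C>" by (metis (no_types, lifting) mem_Collect_eq subsetI)
  qed
qed

lemma finite_NC: "finite (NC n)"
  by (rule finite_subset[of _ "Pow (Pow {1..n})"]) (auto simp: NC_def partition_on_def)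

text \<open>Partitions live on \<open>{1..n}\<close>, whereas list positions start at \<open>0\<close>.\<close>

definition subword :: "'k list \<Rightarrow> nat set \<Rightarrow> 'k list" where
  "subword w B = map (\<lambda>b. w ! (b - 1)) (sorted_list_of_set B)"

definition nccoeff_part :: "'k ncfps \<Rightarrow> 'k list \<Rightarrow> nat set set \<Rightarrow> complex" where
  "nccoeff_part f w \<pi> = (\<Prod>B\<in>\<pi>. nccoeff f (subword w B))"

definition boxed_conv :: "'k ncfps \<Rightarrow> 'k ncfps \<Rightarrow> 'k ncfps" where
  "boxed_conv f g = Abs_ncfps (\<lambda>w. if w = [] then 0 else
     (\<Sum>\<pi>\<in>NC (length w). nccoeff_part f w \<pi> * nccoeff_part g w (kreweras (length w) \<pi>)))"

lemma boxed_conv_in_ncfps0: "boxed_conv f g \<in> ncfps0"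
  by (simp add: boxed_conv_def ncfps0_def)


section \<open>Non-commutative polynomials\<close>

text \<open>Words form a monoid under concatenation; the non-commutative polynomials are its monoid
  algebra, whose ring structure is that of \<^type>\<open>poly_mapping\<close>.\<close>

instantiation list :: (type) monoid_add
begin
definition zero_list_def: "0 = []"
definition plus_list_def: "xs + ys = xs @ ys"
instance by standard (simp_all add: zero_list_def plus_list_def)
end

type_synonym 'k ncpoly = "'k list \<Rightarrow>\<^sub>0 complex"

definition ncscale :: "complex \<Rightarrow> 'k ncpoly \<Rightarrow> 'k ncpoly" where
  "ncscale c p = Poly_Mapping.map ((*) c) p"

definition ncX :: "'k \<Rightarrow> 'k ncpoly" where
  "ncX i = Poly_Mapping.single [i] 1"

lemma prod_list_ncX: "prod_list (map ncX w) = Poly_Mapping.single w 1"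
proof (induction w)
  case Nil
  show ?case by (metis list.simps(8) prod_list.Nil single_one zero_list_def)
next
  case (Cons i w)
  then show ?case by (simp add: ncX_def mult_single plus_list_def)
qed


section \<open>Non-commutative probability spaces\<close>

locale complex_algebra = vector_space scale
  for scale :: "complex \<Rightarrow> 'm::ring_1 \<Rightarrow> 'm" +
  assumes scale_mult_left: "scale c (a * b) = scale c a * b"
    and scale_mult_right: "scale c (a * b) = a * scale c b"

locale nc_prob_space = complex_algebra scale
  for scale :: "complex \<Rightarrow> 'm::ring_1 \<Rightarrow> 'm" +
  fixes \<phi> :: "'m \<Rightarrow> complex"
  assumes linear_phi: "Vector_Spaces.linear scale (*) \<phi>"
    and phi_one: "\<phi> 1 = 1"

lemma ncscale_conv_mult: "ncscale c p = Poly_Mapping.single 0 c * p"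
  unfolding ncscale_def by (rule mult_map_scale_conv_mult)

lemma lookup_ncscale [simp]: "Poly_Mapping.lookup (ncscale c p) w = c * Poly_Mapping.lookup p w"
  unfolding ncscale_def by (simp add: Poly_Mapping.map.rep_eq when_def)

lemma ncscale_single: "ncscale c (Poly_Mapping.single w d) = Poly_Mapping.single w (c * d)"
  by (simp add: ncscale_conv_mult mult_single)

lemma ncpoly_induct [case_names zero add]:
  assumes "P 0" and "\<And>p w c. P p \<Longrightarrow> P (p + Poly_Mapping.single w c)"
  shows "P (p :: 'a \<Rightarrow>\<^sub>0 'b::comm_monoid_add)"
proof (induction p rule: update_induct)
  case const
  then show ?case using assms(1) by simp
next
  case (update f w c)
  have "Poly_Mapping.update w c f = f + Poly_Mapping.single w c"
    using update by (intro poly_mapping_eqI)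
      (auto simp: lookup_update lookup_add lookup_single when_def in_keys_iff)
  then show ?case using assms(2) update by simp
qed

interpretation ncpoly: complex_algebra "ncscale :: complex \<Rightarrow> 'k ncpoly \<Rightarrow> 'k ncpoly"
proof
  fix c d :: complex and p q :: "'k ncpoly"
  show "ncscale c (p + q) = ncscale c p + ncscale c q"
    "ncscale (c + d) p = ncscale c p + ncscale d p"
    "ncscale c (ncscale d p) = ncscale (c * d) p"
    "ncscale 1 p = p"
    by (auto intro!: poly_mapping_eqI simp: lookup_add algebra_simps)
  show "ncscale c (p * q) = ncscale c p * q"
    by (simp add: ncscale_conv_mult mult.assoc)
  have comm: "Poly_Mapping.single 0 c * p = p * Poly_Mapping.single 0 c"
    by (induction p rule: ncpoly_induct) (simp_all add: algebra_simps mult_single)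
  then show "ncscale c (p * q) = p * ncscale c q"
    by (metis ncscale_conv_mult mult.assoc)
qed

definition D_alg :: "('k ncpoly \<Rightarrow> complex) set" where
  "D_alg = {\<mu>. Vector_Spaces.linear ncscale (*) \<mu> \<and> \<mu> 1 = 1}"

definition joint_distribution ::
    "('m::ring_1 \<Rightarrow> complex) \<Rightarrow> ('k \<Rightarrow> 'm) \<Rightarrow> ('k ncpoly \<Rightarrow> complex) \<Rightarrow> bool" where
  "joint_distribution \<phi> x \<mu> \<longleftrightarrow>
     \<mu> \<in> D_alg \<and> (\<forall>w. \<mu> (prod_list (map ncX w)) = \<phi> (prod_list (map x w)))"

definition unital_subalgebra :: "(complex \<Rightarrow> 'm::ring_1 \<Rightarrow> 'm) \<Rightarrow> 'm set \<Rightarrow> bool" where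
  "unital_subalgebra scale A \<longleftrightarrow> 1 \<in> A \<and> (\<forall>a\<in>A. \<forall>b\<in>A. a + b \<in> A) \<and>
     (\<forall>a\<in>A. \<forall>b\<in>A. a * b \<in> A) \<and> (\<forall>c. \<forall>a\<in>A. scale c a \<in> A)"

definition generated_algebra :: "(complex \<Rightarrow> 'm::ring_1 \<Rightarrow> 'm) \<Rightarrow> 'm set \<Rightarrow> 'm set" where
  "generated_algebra scale S = unital_subalgebra scale hull S"

definition freely_independent ::
    "(complex \<Rightarrow> 'm::ring_1 \<Rightarrow> 'm) \<Rightarrow> ('m \<Rightarrow> complex) \<Rightarrow> 'm set \<Rightarrow> 'm set \<Rightarrow> bool" where
  "freely_independent scale \<phi> S1 S2 \<longleftrightarrow>
     (\<forall>as rs. as \<noteq> [] \<and> distinct_adj rs \<and>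
        list_all2 (\<lambda>a r. a \<in> generated_algebra scale (if r then S1 else S2) \<and> \<phi> a = 0) as rs
        \<longrightarrow> \<phi> (prod_list as) = 0)"


section \<open>Free multiplicative convolution\<close>

definition realizes_free_mult_conv ::
    "(complex \<Rightarrow> 'm::ring_1 \<Rightarrow> 'm) \<Rightarrow> ('m \<Rightarrow> complex) \<Rightarrow> ('k \<Rightarrow> 'm) \<Rightarrow> ('k \<Rightarrow> 'm) \<Rightarrow>
     ('k ncpoly \<Rightarrow> complex) \<Rightarrow> ('k ncpoly \<Rightarrow> complex) \<Rightarrow> ('k ncpoly \<Rightarrow> complex) \<Rightarrow> bool" where
  "realizes_free_mult_conv scale \<phi> x y \<mu> \<nu> \<rho> \<longleftrightarrow>
     nc_prob_space scale \<phi> \<and> joint_distribution \<phi> x \<mu> \<and> joint_distribution \<phi> y \<nu> \<and>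
     freely_independent scale \<phi> (range x) (range y) \<and>
     joint_distribution \<phi> (\<lambda>i. x i * y i) \<rho>"

text \<open>A definition cannot quantify over all algebras, so the realizing elements are taken in the
  algebra of non-commutative polynomials in \<open>2k\<close> indeterminates, equipped with an arbitrary
  functional. No generality is lost: by \<open>realizes_free_mult_conv_ncpoly\<close> below, whatever can be
  realized in some non-commutative probability space can be realized there.\<close>

definition free_mult_conv ::
    "('k ncpoly \<Rightarrow> complex) \<Rightarrow> ('k ncpoly \<Rightarrow> complex) \<Rightarrow> ('k ncpoly \<Rightarrow> complex)"
    (infixl \<open>\<boxtimes>\<close> 70) where
  "\<mu> \<boxtimes> \<nu> = (THE \<rho>. \<exists>\<phi> x y.
     realizes_free_mult_conv (ncscale :: complex \<Rightarrow> ('k + 'k) ncpoly \<Rightarrow> _) \<phi> x y \<mu> \<nu> \<rho>)"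

definition nceval :: "(complex \<Rightarrow> 'm::ring_1 \<Rightarrow> 'm) \<Rightarrow> ('l \<Rightarrow> 'm) \<Rightarrow> 'l ncpoly \<Rightarrow> 'm" where
  "nceval scale x p = (\<Sum>w\<in>Poly_Mapping.keys p. scale (Poly_Mapping.lookup p w) (prod_list (map x w)))"

context complex_algebra
begin

lemma nceval_superset:
  assumes "finite A" "Poly_Mapping.keys p \<subseteq> A"
  shows "nceval scale x p = (\<Sum>w\<in>A. scale (Poly_Mapping.lookup p w) (prod_list (map x w)))"
  unfolding nceval_def using assms
  by (intro sum.mono_neutral_left) (auto simp: in_keys_iff)

lemma nceval_add: "nceval scale x (p + q) = nceval scale x p + nceval scale x q"
proof -
  let ?A = "Poly_Mapping.keys p \<union> Poly_Mapping.keys q"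
  have "Poly_Mapping.keys (p + q) \<subseteq> ?A" by (rule Poly_Mapping.keys_add)
  then show ?thesis
    by (simp add: nceval_superset[of ?A] lookup_add scale_left_distrib sum.distrib)
qed

lemma nceval_single: "nceval scale x (Poly_Mapping.single w c) = scale c (prod_list (map x w))"
  by (subst nceval_superset[of "{w}"]) auto

lemma nceval_zero [simp]: "nceval scale x 0 = 0"
  by (simp add: nceval_def)

lemma nceval_scale: "nceval scale x (ncscale c p) = scale c (nceval scale x p)"
  by (subst nceval_superset[of "Poly_Mapping.keys p"]) (auto simp: in_keys_iff nceval_def scale_sum_right)

lemma nceval_mult: "nceval scale x (p * q) = nceval scale x p * nceval scale x q"
proof (induction p rule: ncpoly_induct)
  case (add p w c)
  have "nceval scale x (Poly_Mapping.single w c * q) =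
      nceval scale x (Poly_Mapping.single w c) * nceval scale x q"
  proof (induction q rule: ncpoly_induct)
    case (add q v d)
    have "scale (c * d) (a * b) = scale c a * scale d b" for a b
      by (metis scale_scale scale_mult_left scale_mult_right)
    then show ?case
      using add.IH by (simp add: distrib_left nceval_add mult_single nceval_single plus_list_def)
  qed simp
  then show ?case using add.IH by (simp add: distrib_right nceval_add)
qed simp

lemma nceval_one: "nceval scale x 1 = 1"
  using nceval_single[of x 0 1] unfolding single_one by (simp add: zero_list_def)

lemma nceval_X: "nceval scale x (ncX i) = x i"
  by (simp add: ncX_def nceval_single)

lemma nceval_prod_list: "nceval scale x (prod_list ps) = prod_list (map (nceval scale x) ps)"
  by (induction ps) (auto simp: nceval_one nceval_mult)

lemma nceval_generated:
  assumes "p \<in> generated_algebra ncscale S" "nceval scale x ` S \<subseteq> T"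
  shows "nceval scale x p \<in> generated_algebra scale T"
proof -
  have "nceval scale x p \<in> A" if A: "unital_subalgebra scale A" "T \<subseteq> A" for A
  proof -
    have "unital_subalgebra ncscale {p. nceval scale x p \<in> A}"
      using A by (auto simp: unital_subalgebra_def nceval_one nceval_add nceval_mult nceval_scale)
    moreover have "S \<subseteq> {p. nceval scale x p \<in> A}" using A assms by auto
    ultimately show ?thesis
      using assms(1) unfolding generated_algebra_def hull_def by blast
  qed
  then show ?thesis by (auto simp: generated_algebra_def hull_def)
qed

end

theorem realizes_free_mult_conv_ncpoly:
  fixes x y :: "'k \<Rightarrow> 'm::ring_1"
  assumes "realizes_free_mult_conv scale \<phi> x y \<mu> \<nu> \<rho>"
  shows "\<exists>\<phi>' x' y'.
    realizes_free_mult_conv (ncscale :: complex \<Rightarrow> ('k + 'k) ncpoly \<Rightarrow> _) \<phi>' x' y' \<mu> \<nu> \<rho>"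
proof -
  interpret nc_prob_space scale \<phi>
    using assms by (simp add: realizes_free_mult_conv_def)
  define ev where "ev = nceval scale (case_sum x y)"
  define x' where "x' = (\<lambda>i. ncX (Inl i :: 'k + 'k))"
  define y' where "y' = (\<lambda>i. ncX (Inr i :: 'k + 'k))"
  have ev [simp]: "ev (x' i) = x i" "ev (y' i) = y i" "ev (p * q) = ev p * ev q"
    "ev (prod_list ps) = prod_list (map ev ps)" for i p q ps
    by (simp_all add: ev_def x'_def y'_def nceval_X nceval_mult nceval_prod_list)
  interpret phi: Vector_Spaces.linear scale "(*)" \<phi> by (rule linear_phi)
  have "Vector_Spaces.linear ncscale (*) (\<phi> \<circ> ev)"
    unfolding Vector_Spaces.linear_def module_hom_def module_hom_axioms_def
    by (auto simp: ncpoly.vector_space_axioms ncpoly.module_axioms phi.vs2.vector_space_axioms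
        phi.vs2.module_axioms ev_def nceval_add nceval_scale phi.add phi.scale)
  then have space: "nc_prob_space ncscale (\<phi> \<circ> ev)"
    by (intro nc_prob_space.intro nc_prob_space_axioms.intro ncpoly.complex_algebra_axioms)
      (auto simp: ev_def nceval_one phi_one)
  have free: "freely_independent scale \<phi> (range x) (range y)"
    using assms by (simp add: realizes_free_mult_conv_def)
  have "freely_independent ncscale (\<phi> \<circ> ev) (range x') (range y')"
    unfolding freely_independent_def
  proof (intro allI impI, elim conjE)
    fix as :: "('k + 'k) ncpoly list" and rs
    assume as: "as \<noteq> []" "distinct_adj rs"
      "list_all2 (\<lambda>a r. a \<in> generated_algebra ncscale (if r then range x' else range y') \<and>
         (\<phi> \<circ> ev) a = 0) as rs"
    have "ev a \<in> generated_algebra scale (if r then range x else range y)"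
      if "a \<in> generated_algebra ncscale (if r then range x' else range y')" for a r
      unfolding ev_def
    proof (rule nceval_generated[OF that])
      have "ev ` range x' = range x" "ev ` range y' = range y"
        by (simp_all add: image_image)
      then show "nceval scale (case_sum x y) ` (if r then range x' else range y')
          \<subseteq> (if r then range x else range y)"
        by (simp add: ev_def)
    qed
    then have "list_all2 (\<lambda>a r. a \<in> generated_algebra scale (if r then range x else range y) \<and>
         \<phi> a = 0) (map ev as) rs"
      using as(3) unfolding list.rel_map by (elim list_all2_mono) auto
    then show "(\<phi> \<circ> ev) (prod_list as) = 0"
      using as(1,2) free[unfolded freely_independent_def, rule_format, of "map ev as" rs]
      by simp
  qed
  moreover have "map ev (map x' w) = map x w" "map ev (map y' w) = map y w"
    "map ev (map (\<lambda>i. x' i * y' i) w) = map (\<lambda>i. x i * y i) w" for w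
    by simp_all
  ultimately have "realizes_free_mult_conv ncscale (\<phi> \<circ> ev) x' y' \<mu> \<nu> \<rho>"
    using assms space by (simp add: realizes_free_mult_conv_def joint_distribution_def comp_def)
  then show ?thesis by blast
qed


section \<open>The eta-series\<close>

definition moment_series :: "('k ncpoly \<Rightarrow> complex) \<Rightarrow> 'k ncfps" where
  "moment_series \<mu> = Abs_ncfps (\<lambda>w. if w = [] then 0 else \<mu> (prod_list (map ncX w)))"

definition eta_series :: "('k ncpoly \<Rightarrow> complex) \<Rightarrow> 'k ncfps" where
  "eta_series \<mu> = moment_series \<mu> * ncfps_inverse (1 + moment_series \<mu>)"

lemma eta_series_in_ncfps0: "eta_series \<mu> \<in> ncfps0"
  by (simp add: eta_series_def ncfps0_def nccoeff_mult moment_series_def)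

end

theory Submission
  imports Defs
begin

text \<open>The proof works with Boolean cumulants throughout and never uses the \<open>R\<close>-transform. In the free
  product of two functionals, the moment of a word in letters of two colours is the sum, over all
  non-crossing partitions whose blocks are monochromatic and in which directly nested blocks have
  different colours, of the products of the Boolean cumulants (eta-coefficients) of the blocks.
  For such a functional the left derivative of its series along a word of one colour is
  a multiple of the series itself plus an error term, and the error term vanishes on alternating
  products of centred elements; this is freeness. Conversely a word differs from an alternating
  product of centred elements by shorter words, so free functionals are unique.
  On an alternating word \<open>x y x y \<dots> x y\<close> the Boolean cumulant is a sum over two nested
  families of blocks, one for each colour. Since \<open>b < b'\<close> lie in the same block of the Kreweras
  complement of \<open>\<pi>\<close> exactly when \<open>{b+1..b'}\<close> is a union of blocks of \<open>\<pi>\<close>, the pairs \<open>(\<pi>, K \<pi>)\<close>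
  decompose in the same recursive way, and the sum is the coefficient of the boxed convolution.\<close>


section \<open>Words in two families of letters\<close>

text \<open>Boolean cumulants fit because alternating words leave them no freedom: a block of one
  colour ends with a letter of that colour, so the next letter has the other colour, and a gap,
  which admits outer blocks of a single colour only, must be filled by exactly one block. This
  forced filling is what the maximality of the Kreweras complement looks like on words. The price is
  that freeness is not visible in the formula, since a derivative along a word may stop in the
  middle of a block. The prefix \<open>p\<close> stores the unfinished block; it makes the family of
  chain series closed under derivatives and confines the damage to a term that begins with
  \<open>nest_series e {\<not> c}\<close>. The same prefix returns on the side of partitions as the
  part of a block to the left of a marked point, so that words and partitions obey literally the
  same recursion. The weights \<open>e\<close> stay arbitrary until moments are compared;
  eta-coefficients enter because they make \<open>nest\<close> on words of one colour equal to the
  given moments.\<close>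

definition letter_index :: "'k + 'k \<Rightarrow> 'k" where
  "letter_index = case_sum id id"

definition monochrome :: "bool \<Rightarrow> ('k + 'k) list \<Rightarrow> bool" where
  "monochrome c u \<longleftrightarrow> (\<forall>l\<in>set u. isl l = c)"

text \<open>\<open>chain e c p w\<close> sums over the partitions of \<open>w\<close> in which the first and the last letter lie in
  a common block of colour \<open>c\<close>, of which the indices \<open>p\<close> have already been read; each gap in that
  block is filled by \<open>nest e {\<not> c}\<close>. \<open>nest e S\<close> allows arbitrary outer blocks with colours in \<open>S\<close>.
  The colour \<open>True\<close> belongs to the letters \<open>Inl\<close>.\<close>

function chain :: "(bool \<Rightarrow> 'k list \<Rightarrow> complex) \<Rightarrow> bool \<Rightarrow> 'k list \<Rightarrow> ('k + 'k) list \<Rightarrow> complex"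
  and nest :: "(bool \<Rightarrow> 'k list \<Rightarrow> complex) \<Rightarrow> bool set \<Rightarrow> ('k + 'k) list \<Rightarrow> complex" where
  "chain e c p [] = 0"
| "chain e c p (l # v) =
     (if isl l \<noteq> c then 0
      else if v = [] then e c (p @ [letter_index l])
      else \<Sum>i<length v. nest e {\<not> c} (take i v) * chain e c (p @ [letter_index l]) (drop i v))"
| "nest e S w =
     (if w = [] then 1
      else \<Sum>i\<in>{1..length w}. (\<Sum>c\<in>S. chain e c [] (take i w)) * nest e S (drop i w))"
  by pat_completeness auto
termination
  \<comment> \<open>For \<open>i = length w\<close> the function \<open>nest\<close> calls
    \<open>chain\<close> on the same word; the extra 1 makes this call decrease.\<close>
  by (relation "measure (\<lambda>x. case x of Inl (e, c, p, w) \<Rightarrow> 2 * length w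
                                     | Inr (e, S, w) \<Rightarrow> 2 * length w + 1)") auto

declare chain.simps(2) [simp del] nest.simps [simp del]

lemma nest_Nil [simp]: "nest e S [] = 1"
  by (simp add: nest.simps)

text \<open>A chain ends by reading a letter of its own block, and under \<open>nest e {c}\<close>
  every outer block has colour \<open>c\<close>, so a last letter of the other colour leaves no
  partition.\<close>

lemma chain_nest_last_colour:
  "w \<noteq> [] \<Longrightarrow> isl (last w) \<noteq> c \<Longrightarrow> chain e c p w = 0"
  "w \<noteq> [] \<Longrightarrow> isl (last w) \<noteq> c \<Longrightarrow> nest e {c} w = 0"
proof -
  have "w \<noteq> [] \<longrightarrow> isl (last w) \<noteq> c \<longrightarrow> (\<forall>p. chain e c p w = 0) \<and> nest e {c} w = 0"
  proof (induction w rule: length_induct)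
    case (1 w)
    show ?case
    proof (intro impI)
      assume w: "w \<noteq> []" "isl (last w) \<noteq> c"
      have chain: "chain e c p w = 0" for p
      proof (cases w)
        case (Cons l v)
        then show ?thesis using w 1 by (auto simp: chain.simps(2) intro!: sum.neutral)
      qed (use w in auto)
      \<comment> \<open>The last letter belongs to the chain if \<open>i = length w\<close>, and to
        the remainder otherwise.\<close>
      moreover have "chain e c [] (take i w) * nest e {c} (drop i w) = 0"
        if "i \<in> {1..length w}" for i
        using that w chain 1 by (cases "i = length w") auto
      ultimately show "(\<forall>p. chain e c p w = 0) \<and> nest e {c} w = 0"
        using w by (subst nest.simps) (auto intro!: sum.neutral)
    qed
  qed
  then show "w \<noteq> [] \<Longrightarrow> isl (last w) \<noteq> c \<Longrightarrow> chain e c p w = 0"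
    "w \<noteq> [] \<Longrightarrow> isl (last w) \<noteq> c \<Longrightarrow> nest e {c} w = 0"
    by auto
qed

lemma chain_hd_colour: "w \<noteq> [] \<Longrightarrow> isl (hd w) \<noteq> c \<Longrightarrow> chain e c p w = 0"
  by (cases w) (auto simp: chain.simps(2))

lemma nest_hd_colour: "w \<noteq> [] \<Longrightarrow> isl (hd w) \<notin> S \<Longrightarrow> nest e S w = 0"
  by (subst nest.simps) (auto simp: hd_take intro!: sum.neutral chain_hd_colour)

text \<open>A nonempty gap would have to start with a letter of the other colour, so only the
  partition into one block survives.\<close>

lemma chain_monochrome:
  assumes "monochrome c u" "u \<noteq> []"
  shows "chain e c p u = e c (p @ map letter_index u)"
  using assms
proof (induction u arbitrary: p)
  case (Cons l v)
  show ?case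
  proof (cases "v = []")
    case False
    have "nest e {\<not> c} (take i v) = 0" if "i \<in> {..<length v} - {0}" for i
      using Cons.prems that False by (intro nest_hd_colour) (auto simp: monochrome_def hd_take)
    then have "(\<Sum>i<length v. nest e {\<not> c} (take i v) * chain e c (p @ [letter_index l]) (drop i v))
      = (\<Sum>i\<in>{0}. nest e {\<not> c} (take i v) * chain e c (p @ [letter_index l]) (drop i v))"
      using False by (intro sum.mono_neutral_right) auto
    then show ?thesis using Cons False by (simp add: chain.simps(2) monochrome_def)
  qed (use Cons in \<open>auto simp: chain.simps(2) monochrome_def\<close>)
qed simp


section \<open>Left derivatives of series\<close>

definition nccst :: "complex \<Rightarrow> 'l ncfps" where
  "nccst k = Abs_ncfps (\<lambda>w. if w = [] then k else 0)"

definition lshift :: "'l list \<Rightarrow> 'l ncfps \<Rightarrow> 'l ncfps" where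
  "lshift u f = Abs_ncfps (\<lambda>w. nccoeff f (u @ w))"

lemma nccoeff_lshift [simp]: "nccoeff (lshift u f) w = nccoeff f (u @ w)"
  by (simp add: lshift_def)

lemma nccoeff_nccst_mult [simp]: "nccoeff (nccst k * f) w = k * nccoeff f w"
proof -
  have "nccoeff (nccst k * f) w = (\<Sum>i\<le>length w. if i = 0 then k * nccoeff f w else 0)"
    unfolding nccoeff_mult nccst_def by (intro sum.cong refl) auto
  then show ?thesis by simp
qed

lemma nccoeff_mult_nccst [simp]: "nccoeff (f * nccst k) w = k * nccoeff f w"
proof -
  have "nccoeff (f * nccst k) w = (\<Sum>i\<le>length w. if i = length w then k * nccoeff f w else 0)"
    unfolding nccoeff_mult nccst_def by (intro sum.cong refl) auto
  then show ?thesis by simp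
qed

lemma nccst_commute: "f * nccst k = nccst k * f"
  by (rule ncfps_eqI) simp

lemma nccst_left_commute: "f * (nccst k * g) = nccst k * (f * g)"
  by (metis mult.assoc nccst_commute)

lemma nccst_add: "nccst (j + k) = nccst j + nccst k"
  and nccst_mult: "nccst (j * k) = nccst j * nccst k"
  and nccst_1: "nccst 1 = 1"
  and nccst_0: "nccst 0 = 0"
  by (auto intro!: ncfps_eqI simp: nccst_def nccoeff_one)
    (simp_all add: nccoeff_nccst_mult[unfolded nccst_def])

lemma nccoeff_sum: "nccoeff (\<Sum>i\<in>A. f i) w = (\<Sum>i\<in>A. nccoeff (f i) w)"
  by (induction A rule: infinite_finite_induct) auto

lemma lshift_Nil [simp]: "lshift [] f = f"
  and lshift_Cons: "lshift (l # v) f = lshift v (lshift [l] f)"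
  and lshift_add: "lshift u (f + g) = lshift u f + lshift u g"
  and lshift_nccst: "lshift u (nccst k * f) = nccst k * lshift u f"
  and lshift_zero [simp]: "lshift u 0 = 0"
  by (auto intro!: ncfps_eqI)

lemma lshift_sum: "lshift u (\<Sum>i\<in>A. f i) = (\<Sum>i\<in>A. lshift u (f i))"
  by (rule ncfps_eqI) (simp add: nccoeff_sum)

text \<open>A cut of \<open>u @ w\<close> falls either at or after the end of \<open>u\<close>,
  which gives the first term, or before it, which gives one term of the sum.\<close>

lemma lshift_mult:
  "lshift u (f * g) =
     lshift u f * g + (\<Sum>i<length u. nccst (nccoeff f (take i u)) * lshift (drop i u) g)"
proof (rule ncfps_eqI)
  fix w
  let ?t = "\<lambda>i. nccoeff f (take i (u @ w)) * nccoeff g (drop i (u @ w))"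
  have "nccoeff (lshift u (f * g)) w = sum ?t ({..<length u} \<union> {length u..length u + length w})"
    by (simp add: nccoeff_mult ivl_disj_un)
  also have "\<dots> = sum ?t {..<length u} + sum ?t {length u..length u + length w}"
    by (rule sum.union_disjoint) auto
  also have "sum ?t {length u..length u + length w} = sum (\<lambda>i. ?t (length u + i)) {..length w}"
    by (rule sum.reindex_bij_witness[where i = "\<lambda>i. length u + i" and j = "\<lambda>i. i - length u"]) auto
  finally show "nccoeff (lshift u (f * g)) w =
    nccoeff (lshift u f * g + (\<Sum>i<length u. nccst (nccoeff f (take i u)) * lshift (drop i u) g)) w"
    by (simp add: nccoeff_mult[of "lshift u f"] nccoeff_sum)
qed

lemma lshift_mult_letter:
  "lshift [l] (f * g) = lshift [l] f * g + nccst (nccoeff f []) * lshift [l] g"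
  by (simp add: lshift_mult)


section \<open>The functional of a free family\<close>

definition chain_series ::
    "(bool \<Rightarrow> 'k list \<Rightarrow> complex) \<Rightarrow> bool \<Rightarrow> 'k list \<Rightarrow> ('k + 'k) ncfps" where
  "chain_series e c p = Abs_ncfps (chain e c p)"

definition nest_series :: "(bool \<Rightarrow> 'k list \<Rightarrow> complex) \<Rightarrow> bool set \<Rightarrow> ('k + 'k) ncfps" where
  "nest_series e S = Abs_ncfps (nest e S)"

lemma nccoeff_chain_series [simp]: "nccoeff (chain_series e c p) w = chain e c p w"
  and nccoeff_nest_series [simp]: "nccoeff (nest_series e S) w = nest e S w"
  by (simp_all add: chain_series_def nest_series_def)

text \<open>A geometric series: with \<open>C\<close> the sum of the chain series, this is
  \<open>(1 - C) * nest_series e S = 1\<close>, the analogue of the relation between moments and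
  eta-series.\<close>

lemma nest_series_eq:
  "nest_series e S = 1 + (\<Sum>c\<in>S. chain_series e c []) * nest_series e S"
proof (rule ncfps_eqI)
  fix w
  show "nccoeff (nest_series e S) w =
    nccoeff (1 + (\<Sum>c\<in>S. chain_series e c []) * nest_series e S) w"
    by (subst nccoeff_nest_series, subst nest.simps)
      (simp add: nccoeff_one nccoeff_mult nccoeff_sum atMost_atLeast0 sum.atLeast_Suc_atMost)
qed

text \<open>Reading a letter of the block either finishes the block, which gives the constant, or
  opens a gap, after which the same block continues with a longer prefix.\<close>

lemma lshift_chain_series:
  "lshift [l] (chain_series e c p) =
     (if isl l = c then nccst (e c (p @ [letter_index l])) +
        nest_series e {\<not> c} * chain_series e c (p @ [letter_index l]) else 0)"
proof (rule ncfps_eqI)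
  fix w
  show "nccoeff (lshift [l] (chain_series e c p)) w =
    nccoeff (if isl l = c then nccst (e c (p @ [letter_index l])) +
        nest_series e {\<not> c} * chain_series e c (p @ [letter_index l]) else 0) w"
    by (simp add: chain.simps(2) nccst_def nccoeff_mult flip: lessThan_Suc_atMost)
qed

lemma lshift_nest_series:
  assumes "isl l \<in> S"
  shows "lshift [l] (nest_series e S) =
     nccst (e (isl l) [letter_index l]) * nest_series e S +
     nest_series e {\<not> isl l} * (chain_series e (isl l) [letter_index l] * nest_series e S)"
proof -
  let ?C = "\<Sum>c\<in>S. chain_series e c []"
  have fin: "finite S" by (rule finite)
  have "lshift [l] 1 = 0"
    by (rule ncfps_eqI) (simp add: nccoeff_one)
  \<comment> \<open>Without a constant term in \<open>?C\<close>, the product rule leaves only the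
    derivative of the first factor.\<close>
  moreover have "nccoeff ?C [] = 0"
    by (simp add: nccoeff_sum)
  moreover have "lshift [l] ?C = nccst (e (isl l) [letter_index l]) +
      nest_series e {\<not> isl l} * chain_series e (isl l) [letter_index l]"
    using assms fin by (simp add: lshift_sum lshift_chain_series)
  ultimately show ?thesis
    by (subst nest_series_eq)
      (simp add: lshift_add lshift_mult_letter nccst_0 distrib_right mult.assoc)
qed

lemma lshift_nest_series_other: "isl l \<notin> S \<Longrightarrow> lshift [l] (nest_series e S) = 0"
  by (rule ncfps_eqI) (simp add: nest_hd_colour)

text \<open>These are the error terms: \<open>nest_series e {\<not> c} * g\<close> vanishes on alternating
  products of centred elements that begin with colour \<open>\<not> c\<close>.\<close>

definition starts_with :: "bool \<Rightarrow> ('k + 'k) ncfps \<Rightarrow> bool" where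
  "starts_with c g \<longleftrightarrow> (\<forall>w. w = [] \<or> isl (hd w) \<noteq> c \<longrightarrow> nccoeff g w = 0)"

lemma starts_with_zero: "starts_with c 0"
  and starts_with_add: "starts_with c f \<Longrightarrow> starts_with c g \<Longrightarrow> starts_with c (f + g)"
  and starts_with_nccst: "starts_with c f \<Longrightarrow> starts_with c (nccst k * f)"
  by (auto simp: starts_with_def)

lemma starts_with_chain_series: "starts_with c (chain_series e c p * f)"
proof -
  have "chain e c p (take i w) = 0" if "w = [] \<or> isl (hd w) \<noteq> c" for i w
    using that by (cases "i = 0 \<or> w = []") (auto simp: chain_hd_colour hd_take)
  then show ?thesis
    unfolding starts_with_def nccoeff_mult by (intro allI impI sum.neutral) simp
qed

text \<open>While the letters of \<open>u\<close> are read, a partition is either between two outer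
  blocks or inside an outer block of colour \<open>c\<close> with prefix \<open>p\<close>. A further
  letter leads from either state to a combination of both, hence the joint induction. The scalar
  \<open>k\<close> is quantified before \<open>S\<close>, so that it can later be computed from
  \<open>S = {c}\<close> alone.\<close>

lemma lshift_nest_monochrome_aux:
  assumes "monochrome c u"
  shows "(\<exists>k. \<forall>S. c \<in> S \<longrightarrow> (\<exists>g. starts_with c g \<and>
            lshift u (nest_series e S) = nccst k * nest_series e S + nest_series e {\<not> c} * g)) \<and>
         (\<forall>p. \<exists>k. \<forall>S. c \<in> S \<longrightarrow> (\<exists>g. starts_with c g \<and>
            lshift u (nest_series e {\<not> c} * (chain_series e c p * nest_series e S)) =
              nccst k * nest_series e S + nest_series e {\<not> c} * g))"
  using assms
proof (induction u)
  case Nil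
  show ?case
  proof (intro conjI allI)
    show "\<exists>k. \<forall>S. c \<in> S \<longrightarrow> (\<exists>g. starts_with c g \<and>
            lshift [] (nest_series e S) = nccst k * nest_series e S + nest_series e {\<not> c} * g)"
      by (intro exI[of _ 1] exI[of _ 0] allI impI) (simp add: starts_with_zero nccst_1)
    show "\<exists>k. \<forall>S. c \<in> S \<longrightarrow> (\<exists>g. starts_with c g \<and>
            lshift [] (nest_series e {\<not> c} * (chain_series e c p * nest_series e S)) =
              nccst k * nest_series e S + nest_series e {\<not> c} * g)" for p
      by (intro exI[of _ 0] allI impI exI[of _ "chain_series e c p * nest_series e S" for S])
        (simp add: nccst_0 starts_with_chain_series)
  qed
next
  case (Cons l u)
  then have l: "isl l = c" and u: "monochrome c u"
    by (auto simp: monochrome_def)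
  obtain k where k: "\<And>S. c \<in> S \<Longrightarrow> \<exists>g. starts_with c g \<and>
      lshift u (nest_series e S) = nccst k * nest_series e S + nest_series e {\<not> c} * g"
    using Cons.IH[OF u] by blast
  \<comment> \<open>The derivatives of both states by \<open>l\<close> have this shape; they differ
    in the constant \<open>a\<close> and the prefix \<open>p\<close>.\<close>
  have "\<exists>k. \<forall>S. c \<in> S \<longrightarrow> (\<exists>g. starts_with c g \<and>
     lshift u (nccst a * nest_series e S + nest_series e {\<not> c} * (chain_series e c p * nest_series e S)) =
     nccst k * nest_series e S + nest_series e {\<not> c} * g)" for a p
  proof -
    obtain k' where k': "\<And>S. c \<in> S \<Longrightarrow> \<exists>g. starts_with c g \<and>
        lshift u (nest_series e {\<not> c} * (chain_series e c p * nest_series e S)) =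
          nccst k' * nest_series e S + nest_series e {\<not> c} * g"
      using Cons.IH[OF u] by blast
    show ?thesis
    proof (intro exI[of _ "a * k + k'"] allI impI)
      fix S assume S: "c \<in> S"
      obtain g g' where g: "starts_with c g"
          "lshift u (nest_series e S) = nccst k * nest_series e S + nest_series e {\<not> c} * g"
        and g': "starts_with c g'"
          "lshift u (nest_series e {\<not> c} * (chain_series e c p * nest_series e S)) =
            nccst k' * nest_series e S + nest_series e {\<not> c} * g'"
        using k[OF S] k'[OF S] by blast
      show "\<exists>g. starts_with c g \<and>
          lshift u (nccst a * nest_series e S +
             nest_series e {\<not> c} * (chain_series e c p * nest_series e S)) =
          nccst (a * k + k') * nest_series e S + nest_series e {\<not> c} * g"
      proof (intro exI[of _ "nccst a * g + g'"] conjI)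
        show "starts_with c (nccst a * g + g')"
          using g g' by (intro starts_with_add starts_with_nccst)
      qed (simp add: lshift_add lshift_nccst g g' nccst_add nccst_mult distrib_left distrib_right
            nccst_left_commute[of "nest_series e {\<not> c}"] mult.assoc add.assoc add.left_commute)
    qed
  qed
  note combine = this
  have "lshift [l] (nest_series e S) =
     nccst (e c [letter_index l]) * nest_series e S +
     nest_series e {\<not> c} * (chain_series e c [letter_index l] * nest_series e S)" if "c \<in> S" for S
    using lshift_nest_series[of l S e] l that by simp
  \<comment> \<open>The factor \<open>nest_series e {\<not> c}\<close> admits no word beginning with
    \<open>l\<close>, so it contributes only through its constant coefficient 1.\<close>
  moreover have "lshift [l] (nest_series e {\<not> c} * (chain_series e c p * nest_series e S)) =
     nccst (e c (p @ [letter_index l])) * nest_series e S +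
     nest_series e {\<not> c} * (chain_series e c (p @ [letter_index l]) * nest_series e S)" for p S
    using l by (simp add: lshift_mult_letter lshift_nest_series_other nccst_1 nccst_0
        lshift_chain_series distrib_right mult.assoc)
  ultimately show ?case
    unfolding lshift_Cons[of l u] using combine by auto
qed

text \<open>Evaluating the case \<open>S = {c}\<close> at the empty word identifies the scalar,
  because a series satisfying \<open>starts_with\<close> has no constant term.\<close>

lemma lshift_nest_monochrome:
  assumes "monochrome c u" "c \<in> S"
  obtains g where "starts_with c g"
    "lshift u (nest_series e S) = nccst (nest e {c} u) * nest_series e S + nest_series e {\<not> c} * g"
proof -
  obtain k where k: "\<And>S. c \<in> S \<Longrightarrow> \<exists>g. starts_with c g \<and>
      lshift u (nest_series e S) = nccst k * nest_series e S + nest_series e {\<not> c} * g"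
    using lshift_nest_monochrome_aux[OF assms(1)] by blast
  obtain g where g: "starts_with c g"
    "lshift u (nest_series e {c}) = nccst k * nest_series e {c} + nest_series e {\<not> c} * g"
    using k[of "{c}"] by auto
  have "nest e {c} u = nccoeff (lshift u (nest_series e {c})) []"
    by simp
  also have "\<dots> = k"
    using g by (simp add: nccoeff_mult[of "nest_series e {\<not> c}"] starts_with_def)
  finally show ?thesis using k[OF assms(2)] that by auto
qed

text \<open>The scalar in the preceding relation does not depend on \<open>S\<close>, and at the
  empty word it is all that remains.\<close>

lemma nest_monochrome:
  assumes "monochrome c u" "c \<in> S"
  shows "nest e S u = nest e {c} u"
proof -
  obtain g where g: "starts_with c g"
    "lshift u (nest_series e S) = nccst (nest e {c} u) * nest_series e S + nest_series e {\<not> c} * g"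
    using lshift_nest_monochrome[OF assms] .
  have "nest e S u = nccoeff (lshift u (nest_series e S)) []"
    by simp
  also have "\<dots> = nest e {c} u"
    using g by (simp add: nccoeff_mult[of "nest_series e {\<not> c}"] starts_with_def)
  finally show ?thesis .
qed


section \<open>Pairing series with polynomials\<close>

lemma single_Nil_1: "Poly_Mapping.single [] 1 = (1 :: 'l ncpoly)"
  by (metis single_one zero_list_def)

definition ncpair :: "'l ncfps \<Rightarrow> 'l ncpoly \<Rightarrow> complex" where
  "ncpair f p = (\<Sum>w\<in>Poly_Mapping.keys p. Poly_Mapping.lookup p w * nccoeff f w)"

lemma ncpair_superset:
  assumes "finite A" "Poly_Mapping.keys p \<subseteq> A"
  shows "ncpair f p = (\<Sum>w\<in>A. Poly_Mapping.lookup p w * nccoeff f w)"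
  unfolding ncpair_def using assms
  by (intro sum.mono_neutral_left) (auto simp: in_keys_iff)

lemma ncpair_add: "ncpair f (p + q) = ncpair f p + ncpair f q"
proof -
  let ?A = "Poly_Mapping.keys p \<union> Poly_Mapping.keys q"
  have "Poly_Mapping.keys (p + q) \<subseteq> ?A" by (rule Poly_Mapping.keys_add)
  then show ?thesis
    by (simp add: ncpair_superset[of ?A] lookup_add distrib_right sum.distrib)
qed

lemma ncpair_zero [simp]: "ncpair f 0 = 0"
  by (simp add: ncpair_def)

lemma ncpair_single [simp]: "ncpair f (Poly_Mapping.single w c) = c * nccoeff f w"
  by (subst ncpair_superset[of "{w}"]) auto

lemma ncpair_one [simp]: "ncpair f 1 = nccoeff f []"
  by (metis ncpair_single mult_1 single_Nil_1)

lemma ncpair_scale: "ncpair f (ncscale c p) = c * ncpair f p"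
  by (subst ncpair_superset[of "Poly_Mapping.keys p"])
    (auto simp: in_keys_iff ncpair_def sum_distrib_left mult.assoc)

lemma ncpair_minus: "ncpair f (p - q) = ncpair f p - ncpair f q"
  by (metis add_diff_cancel diff_add_cancel ncpair_add)

lemma ncpair_sum: "ncpair f (\<Sum>i\<in>A. p i) = (\<Sum>i\<in>A. ncpair f (p i))"
  by (induction A rule: infinite_finite_induct) (auto simp: ncpair_add)

lemma ncpair_add_series: "ncpair (f + g) p = ncpair f p + ncpair g p"
  and ncpair_nccst: "ncpair (nccst k * f) p = k * ncpair f p"
  by (simp_all add: ncpair_def distrib_left sum.distrib sum_distrib_left mult.left_commute)

lemma ncpair_sum_series: "ncpair (\<Sum>i\<in>A. f i) p = (\<Sum>i\<in>A. ncpair (f i) p)"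
  by (induction A rule: infinite_finite_induct) (auto simp: ncpair_add_series, auto simp: ncpair_def)

lemma ncpair_cong:
  "(\<And>w. w \<in> Poly_Mapping.keys p \<Longrightarrow> nccoeff f w = nccoeff g w) \<Longrightarrow> ncpair f p = ncpair g p"
  by (simp add: ncpair_def)

lemma ncpoly_sum_single:
  "(p :: 'l ncpoly) = (\<Sum>w\<in>Poly_Mapping.keys p. Poly_Mapping.single w (Poly_Mapping.lookup p w))"
  by (rule poly_mapping_eqI) (auto simp: lookup_sum lookup_single when_def in_keys_iff)

lemma ncpair_single_mult: "ncpair f (Poly_Mapping.single u c * q) = c * ncpair (lshift u f) q"
  by (induction q rule: ncpoly_induct)
    (simp_all add: distrib_left ncpair_add mult_single plus_list_def)

lemma ncpair_mult:
  "ncpair f (p * q) =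
     (\<Sum>u\<in>Poly_Mapping.keys p. Poly_Mapping.lookup p u * ncpair (lshift u f) q)"
  by (subst ncpoly_sum_single) (simp add: sum_distrib_right ncpair_sum ncpair_single_mult)

lemma linear_ncpair: "Vector_Spaces.linear ncscale (*) (ncpair f)"
  by unfold_locales (simp_all add: ncpair_add ncpair_scale algebra_simps)

text \<open>The linear extension of \<open>lshift\<close> from words to polynomials: the left
  derivative of \<open>f\<close> along \<open>q\<close>.\<close>

definition pshift :: "'l ncpoly \<Rightarrow> 'l ncfps \<Rightarrow> 'l ncfps" where
  "pshift q f = Abs_ncfps (\<lambda>w. ncpair f (q * Poly_Mapping.single w 1))"

lemma pshift_one [simp]: "pshift 1 f = f"
  by (rule ncfps_eqI) (simp add: pshift_def)

lemma pshift_mult: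
  "pshift (q * b) f =
     (\<Sum>u\<in>Poly_Mapping.keys b. nccst (Poly_Mapping.lookup b u) * lshift u (pshift q f))"
proof (rule ncfps_eqI)
  fix w
  have "q * b * Poly_Mapping.single w 1 =
    (\<Sum>u\<in>Poly_Mapping.keys b.
       ncscale (Poly_Mapping.lookup b u) (q * Poly_Mapping.single (u @ w) 1))"
    by (subst ncpoly_sum_single[of b])
      (simp add: sum_distrib_left sum_distrib_right mult.assoc mult_single plus_list_def
        ncpoly.scale_mult_right ncscale_single)
  then show "nccoeff (pshift (q * b) f) w = nccoeff (\<Sum>u\<in>Poly_Mapping.keys b.
      nccst (Poly_Mapping.lookup b u) * lshift u (pshift q f)) w"
    by (simp add: pshift_def nccoeff_sum ncpair_sum ncpair_scale)
qed

text \<open>Moves one factor from the polynomial side into the left series. Each extra term of the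
  product rule for \<open>lshift\<close> contains one of the two factors assumed to vanish, so
  \<open>b\<close> acts on \<open>pshift q f\<close> alone.\<close>

lemma ncpair_mult_step:
  assumes "\<And>u i. u \<in> Poly_Mapping.keys b \<Longrightarrow> i < length u \<Longrightarrow>
     nccoeff (pshift q f) (take i u) = 0 \<or> lshift (drop i u) g = 0"
  shows "ncpair (pshift q f * g) (b * v) = ncpair (pshift (q * b) f * g) v"
proof -
  have "lshift u (pshift q f * g) = lshift u (pshift q f) * g" if "u \<in> Poly_Mapping.keys b" for u
  proof -
    have "nccst (nccoeff (pshift q f) (take i u)) * lshift (drop i u) g = 0" if "i < length u" for i
      using assms[OF \<open>u \<in> _\<close> that] by (auto simp: nccst_0)
    then show ?thesis by (simp add: lshift_mult)
  qed
  then show ?thesis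
    by (simp add: ncpair_mult pshift_mult sum_distrib_right mult.assoc ncpair_sum_series ncpair_nccst)
qed


section \<open>Freeness of the functional\<close>

definition colour_poly :: "bool \<Rightarrow> ('k + 'k) ncpoly \<Rightarrow> bool" where
  "colour_poly c p \<longleftrightarrow> (\<forall>w\<in>Poly_Mapping.keys p. monochrome c w)"

text \<open>The factors are absorbed into \<open>nest_series e {c}\<close> one at a time. A factor
  of colour \<open>c\<close> cannot act on \<open>g\<close>, which starts with the other colour. For
  a factor of colour \<open>\<not> c\<close>, a cut inside a word makes the left series end in a
  letter of that colour, where it vanishes, and a cut in front of the word leaves a pairing that is
  0 by \<open>zero\<close>.\<close>

lemma ncpair_nest_mult_starts_with:
  assumes g: "starts_with (\<not> c) g"
    and as: "list_all2 (\<lambda>a r. colour_poly r a) as rs" "as \<noteq> [] \<Longrightarrow> hd rs = c"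
    and zero: "\<And>j. 0 < j \<Longrightarrow> j \<le> length as \<Longrightarrow>
       ncpair (nest_series e {c}) (prod_list (take j as)) = 0"
  shows "ncpair (nest_series e {c} * g) (prod_list as) = 0"
proof -
  let ?f = "nest_series e {c}"
  have "ncpair (?f * g) (prod_list as) =
    ncpair (pshift (prod_list (take j as)) ?f * g) (prod_list (drop j as))" if "j \<le> length as" for j
    using that
  proof (induction j)
    case (Suc j)
    define q where "q = prod_list (take j as)"
    define b where "b = as ! j"
    have j: "j < length as" using Suc by simp
    have drop: "drop j as = b # drop (Suc j) as"
      using j by (simp add: Cons_nth_drop_Suc b_def)
    have take: "prod_list (take (Suc j) as) = q * b"
      using j by (simp add: take_Suc_conv_app_nth q_def b_def)
    have b: "colour_poly (rs ! j) b"
      using as(1) j by (auto simp: list_all2_conv_all_nth b_def)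
    have "nccoeff (pshift q ?f) (take i u) = 0 \<or> lshift (drop i u) g = 0"
      if u: "u \<in> Poly_Mapping.keys b" and i: "i < length u" for u i
    proof (cases "rs ! j = c")
      case True
      then have "monochrome c u" using b u by (auto simp: colour_poly_def)
      then have "isl (hd (drop i u)) = c"
        using i by (simp add: monochrome_def hd_drop_conv_nth)
      then have "lshift (drop i u) g = 0"
        using i g by (intro ncfps_eqI) (auto simp: starts_with_def)
      then show ?thesis ..
    next
      case False
      then have u: "monochrome (\<not> c) u" using b u by (auto simp: colour_poly_def)
      \<comment> \<open>The first factor has colour \<open>c\<close>, so some factor precedes this
        one and \<open>zero\<close> applies to \<open>q\<close>.\<close>
      have "j \<noteq> 0"
        using False as j by (cases as; cases rs; cases j) auto
      then have q: "ncpair ?f q = 0" using zero j by (simp add: q_def)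
      have "nccoeff (pshift q ?f) (take i u) = 0"
      proof (cases "i = 0")
        case True
        then show ?thesis using q
          by (simp add: pshift_def single_Nil_1)
      next
        case False
        have ne: "take i u \<noteq> []" using False i by auto
        then have "last (take i u) \<in> set u"
          using last_in_set set_take_subset by (metis subsetD)
        then have "isl (last (take i u)) = (\<not> c)"
          using u by (simp add: monochrome_def)
        then have "nest e {c} (w @ take i u) = 0" for w
          using ne by (intro chain_nest_last_colour) (auto simp only: last_appendR append_is_Nil_conv)
        then show ?thesis
          by (simp add: pshift_def ncpair_mult)
      qed
      then show ?thesis ..
    qed
    then have step: "ncpair (pshift q ?f * g) (b * prod_list (drop (Suc j) as)) =
      ncpair (pshift (q * b) ?f * g) (prod_list (drop (Suc j) as))"
      by (rule ncpair_mult_step)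
    have "ncpair (?f * g) (prod_list as) = ncpair (pshift q ?f * g) (prod_list (drop j as))"
      using Suc.IH j by (simp add: q_def)
    also have "\<dots> = ncpair (pshift (prod_list (take (Suc j) as)) ?f * g) (prod_list (drop (Suc j) as))"
      by (simp only: drop prod_list.Cons step take)
    finally show ?case .
  qed simp
  \<comment> \<open>With every factor absorbed, the product of the two constant coefficients is
    left, and that of \<open>g\<close> is 0.\<close>
  from this[of "length as"] show ?thesis
    using g by (simp add: nccoeff_mult[of _ g] starts_with_def)
qed

text \<open>Derive along the words of the first factor \<open>a\<close>. The scalars add up to the
  pairing of \<open>a\<close> with its own colour, which is 0. The error terms need all initial
  segments of the remaining product to pair to 0 with \<open>nest_series e {\<not> c}\<close>; these
  are shorter instances for another \<open>S\<close>, which is why the induction is on length and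
  keeps \<open>S\<close> arbitrary.\<close>

lemma nest_alternating:
  assumes "list_all2 (\<lambda>a r. colour_poly r a \<and> ncpair (nest_series e {r}) a = 0) as rs"
    and "distinct_adj rs" "as \<noteq> []" "hd rs \<in> S"
  shows "ncpair (nest_series e S) (prod_list as) = 0"
  using assms
proof (induction "length as" arbitrary: as rs S rule: less_induct)
  case less
  obtain a as' where as: "as = a # as'" using less.prems by (cases as) auto
  obtain c rs' where rs: "rs = c # rs'" using less.prems as by (cases rs) auto
  have c: "c \<in> S" using less.prems rs by simp
  have a: "colour_poly c a" "ncpair (nest_series e {c}) a = 0"
    and as': "list_all2 (\<lambda>a r. colour_poly r a \<and> ncpair (nest_series e {r}) a = 0) as' rs'"
    using less.prems by (auto simp: as rs)
  have hd: "hd rs' = (\<not> c)" if "as' \<noteq> []"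
    using less.prems(2) that as' by (cases as'; cases rs') (auto simp: rs)
  have "\<exists>g. starts_with c g \<and> lshift u (nest_series e S) =
      nccst (nest e {c} u) * nest_series e S + nest_series e {\<not> c} * g"
    if "u \<in> Poly_Mapping.keys a" for u
    using lshift_nest_monochrome[OF _ c] a that by (metis colour_poly_def)
  then obtain g where g: "\<And>u. u \<in> Poly_Mapping.keys a \<Longrightarrow> starts_with c (g u)"
    "\<And>u. u \<in> Poly_Mapping.keys a \<Longrightarrow> lshift u (nest_series e S) =
       nccst (nest e {c} u) * nest_series e S + nest_series e {\<not> c} * g u"
    by metis
  have zero: "ncpair (nest_series e {\<not> c} * g u) (prod_list as') = 0"
    if u: "u \<in> Poly_Mapping.keys a" for u
  proof (rule ncpair_nest_mult_starts_with)
    show "starts_with (\<not> \<not> c) (g u)" using g(1)[OF u] by simp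
    show "list_all2 (\<lambda>a r. colour_poly r a) as' rs'"
      using as' by (rule list_all2_mono) auto
    show "as' \<noteq> [] \<Longrightarrow> hd rs' = (\<not> c)" by (rule hd)
    fix j assume j: "0 < j" "j \<le> length as'"
    have "distinct_adj rs'" using less.prems(2) by (auto simp: rs distinct_adj_Cons)
    then have "distinct_adj (take j rs')"
      by (metis append_take_drop_id distinct_adj_append_iff)
    then show "ncpair (nest_series e {\<not> c}) (prod_list (take j as')) = 0"
      using j hd as' less.hyps[of "take j as'" "take j rs'" "{\<not> c}"]
      by (cases "as' = []") (auto simp: as hd_take list_all2_takeI)
  qed
  have "ncpair (nest_series e S) (prod_list as) =
     (\<Sum>u\<in>Poly_Mapping.keys a. Poly_Mapping.lookup a u *
        (nest e {c} u * ncpair (nest_series e S) (prod_list as')))"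
    using g(2) zero by (simp add: as ncpair_mult ncpair_add_series ncpair_nccst)
  \<comment> \<open>The common factor separates, and the scalars \<open>nest e {c} u\<close> are
    exactly the coefficients that pair with \<open>a\<close>.\<close>
  also have "\<dots> = ncpair (nest_series e {c}) a * ncpair (nest_series e S) (prod_list as')"
    by (simp add: ncpair_def[of _ a] sum_distrib_right mult.assoc)
  finally show ?case using a by simp
qed


section \<open>Uniqueness of free functionals\<close>

definition centred :: "('l list \<Rightarrow> complex) \<Rightarrow> 'l list \<Rightarrow> 'l ncpoly" where
  "centred m u = Poly_Mapping.single u 1 - Poly_Mapping.single [] (m u)"

text \<open>When the product is expanded, every term other than the full concatenation has replaced
  at least one nonempty word by a scalar.\<close>

lemma prod_list_centred:
  assumes "[] \<notin> set us"
  shows "Poly_Mapping.keys (prod_list (map (centred m) us) - Poly_Mapping.single (concat us) 1)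
    \<subseteq> {w. length w < length (concat us)}"
  using assms
proof (induction us)
  case Nil
  then show ?case by (simp add: single_Nil_1)
next
  case (Cons u us)
  define W where "W = Poly_Mapping.single (concat us) (1 :: complex)"
  define R where "R = prod_list (map (centred m) us) - W"
  have R: "length w < length (concat us)" if "w \<in> Poly_Mapping.keys R" for w
    using subsetD[OF Cons.IH] Cons.prems that unfolding R_def W_def by simp
  have WR: "prod_list (map (centred m) us) = W + R"
    by (simp add: R_def)
  have UW: "Poly_Mapping.single (concat (u # us)) 1 = Poly_Mapping.single u 1 * W"
    by (simp add: W_def mult_single plus_list_def)
  have eq: "prod_list (map (centred m) (u # us)) - Poly_Mapping.single (concat (u # us)) 1 =
      Poly_Mapping.single u 1 * R - Poly_Mapping.single [] (m u) * (W + R)"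
    unfolding UW list.map prod_list.Cons WR centred_def by (simp add: left_diff_distrib distrib_left)
  have "length w < length (concat (u # us))"
    if w: "w \<in> Poly_Mapping.keys (Poly_Mapping.single u 1 * R)" for w
  proof -
    obtain b where "b \<in> Poly_Mapping.keys R" "w = u @ b"
      using subsetD[OF Poly_Mapping.keys_mult w] by (auto simp: plus_list_def)
    then show ?thesis using R by auto
  qed
  moreover have "length w < length (concat (u # us))"
    if w: "w \<in> Poly_Mapping.keys (Poly_Mapping.single [] (m u) * (W + R))" for w
  proof -
    have "w \<in> Poly_Mapping.keys (W + R)"
      using subsetD[OF Poly_Mapping.keys_mult w] by (auto simp: plus_list_def split: if_splits)
    from subsetD[OF Poly_Mapping.keys_add this] have "length w \<le> length (concat us)"
      using R by (auto simp: W_def intro: less_imp_le)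
    moreover have "u \<noteq> []" using Cons.prems by auto
    ultimately show ?thesis by (simp add: le_less_trans)
  qed
  ultimately show ?case
    unfolding eq using subsetD[OF keys_diff[of "Poly_Mapping.single u 1 * R"]] by auto
qed

lemma monochrome_runs:
  obtains us rs where "concat us = w" "distinct_adj rs"
    "list_all2 (\<lambda>u r. u \<noteq> [] \<and> monochrome r u) us rs"
proof -
  have "\<exists>us rs. concat us = w \<and> distinct_adj rs \<and>
     list_all2 (\<lambda>u r. u \<noteq> [] \<and> monochrome r u) us rs"
  proof (induction w)
    case Nil
    show ?case by (intro exI[of _ "[]"]) simp
  next
    case (Cons l w)
    then obtain us rs where us: "concat us = w" "distinct_adj rs"
      "list_all2 (\<lambda>u r. u \<noteq> [] \<and> monochrome r u) us rs" by blast
    show ?case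
    proof (cases "rs \<noteq> [] \<and> hd rs = isl l")
      case True
      then obtain u us' rs' where "us = u # us'" "rs = isl l # rs'"
        using us(3) by (cases us; cases rs) auto
      then show ?thesis
        using us by (intro exI[of _ "(l # u) # us'"] exI[of _ rs]) (auto simp: monochrome_def)
    next
      case False
      then show ?thesis
        using us by (intro exI[of _ "[l] # us"] exI[of _ "isl l # rs"])
          (auto simp: monochrome_def distinct_adj_Cons)
    qed
  qed
  then show ?thesis using that by blast
qed

text \<open>Products of centred runs are unitriangular over the words with respect to length, so
  prescribing the values on them determines a series. The function \<open>m\<close> is arbitrary
  here; it becomes the common moment where the lemma is applied.\<close>

lemma free_series_unique:
  fixes f g :: "('k + 'k) ncfps"
  assumes "nccoeff f [] = nccoeff g []"
    and "\<And>us rs. us \<noteq> [] \<Longrightarrow> distinct_adj rs \<Longrightarrow>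
       list_all2 (\<lambda>u r. u \<noteq> [] \<and> monochrome r u) us rs \<Longrightarrow>
       ncpair f (prod_list (map (centred m) us)) = ncpair g (prod_list (map (centred m) us))"
  shows "f = g"
proof (rule ncfps_eqI)
  fix w
  show "nccoeff f w = nccoeff g w"
  proof (induction w rule: length_induct)
    case (1 w)
    show ?case
    proof (cases "w = []")
      case False
      obtain us rs where us: "concat us = w" "distinct_adj rs"
        "list_all2 (\<lambda>u r. u \<noteq> [] \<and> monochrome r u) us rs" by (rule monochrome_runs)
      let ?P = "prod_list (map (centred m) us)"
      have "[] \<notin> set us"
        using us(3) by (auto simp: list_all2_conv_all_nth in_set_conv_nth)
      then have "ncpair f (?P - Poly_Mapping.single w 1) = ncpair g (?P - Poly_Mapping.single w 1)"
        using prod_list_centred[of us m] 1 us(1) by (intro ncpair_cong) auto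
      moreover have "ncpair f ?P = ncpair g ?P"
        using False us by (intro assms(2)[of us rs]) auto
      ultimately show ?thesis by (simp add: ncpair_minus)
    qed (use assms in simp)
  qed
qed


section \<open>Moments and the eta-series\<close>

definition word_moment :: "('k ncpoly \<Rightarrow> complex) \<Rightarrow> 'k list \<Rightarrow> complex" where
  "word_moment \<mu> w = \<mu> (Poly_Mapping.single w 1)"

lemma nccoeff_moment_series: "nccoeff (moment_series \<mu>) w = (if w = [] then 0 else word_moment \<mu> w)"
  by (simp add: moment_series_def word_moment_def prod_list_ncX)

lemma nccoeff_eta_Nil [simp]: "nccoeff (eta_series \<mu>) [] = 0"
  using eta_series_in_ncfps0[of \<mu>] by (simp add: ncfps0_def)

lemma eta_series_mult: "eta_series \<mu> * (1 + moment_series \<mu>) = moment_series \<mu>"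
proof -
  have "nccoeff (1 + moment_series \<mu>) [] \<noteq> 0"
    by (simp add: nccoeff_one nccoeff_moment_series)
  then show ?thesis
    by (simp add: eta_series_def mult.assoc ncfps_inverse)
qed

lemma eta_series_unique:
  assumes "f * (1 + moment_series \<mu>) = moment_series \<mu>"
  shows "eta_series \<mu> = f"
proof -
  have "nccoeff (1 + moment_series \<mu>) [] \<noteq> 0"
    by (simp add: nccoeff_one nccoeff_moment_series)
  then have "f * (1 + moment_series \<mu>) * ncfps_inverse (1 + moment_series \<mu>) = f"
    by (simp add: mult.assoc ncfps_inverse)
  then show ?thesis
    by (simp add: assms eta_series_def)
qed

lemma nccoeff_one_plus_moment_series:
  assumes "\<mu> \<in> D_alg"
  shows "nccoeff (1 + moment_series \<mu>) w = word_moment \<mu> w"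
  using assms by (simp add: nccoeff_one nccoeff_moment_series word_moment_def single_Nil_1 D_alg_def)

lemma mult_moment_series:
  assumes "\<mu> \<in> D_alg" "nccoeff f [] = 0"
  shows "nccoeff (f * (1 + moment_series \<mu>)) w =
    (\<Sum>i\<in>{1..length w}. nccoeff f (take i w) * word_moment \<mu> (drop i w))"
  unfolding nccoeff_mult nccoeff_one_plus_moment_series[OF assms(1)]
  using assms(2) by (simp add: atMost_atLeast0 sum.atLeast_Suc_atMost)

text \<open>Here \<open>i\<close> is the length of the first block of an interval partition; the
  remaining blocks sum to a moment again.\<close>

lemma word_moment_eta:
  assumes "\<mu> \<in> D_alg" "w \<noteq> []"
  shows "word_moment \<mu> w =
    (\<Sum>i\<in>{1..length w}. nccoeff (eta_series \<mu>) (take i w) * word_moment \<mu> (drop i w))"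
  using mult_moment_series[OF assms(1), of "eta_series \<mu>" w] assms(2)
  by (simp add: eta_series_mult nccoeff_moment_series)

lemma eta_series_eqI:
  assumes "\<mu> \<in> D_alg" "nccoeff f [] = 0"
    and "\<And>w. w \<noteq> [] \<Longrightarrow> word_moment \<mu> w =
       (\<Sum>i\<in>{1..length w}. nccoeff f (take i w) * word_moment \<mu> (drop i w))"
  shows "eta_series \<mu> = f"
proof (rule eta_series_unique, rule ncfps_eqI)
  fix w
  show "nccoeff (f * (1 + moment_series \<mu>)) w = nccoeff (moment_series \<mu>) w"
    using assms(3)[of w] by (simp add: mult_moment_series[OF assms(1,2)] nccoeff_moment_series)
qed

text \<open>On one colour a chain is a single eta-coefficient, so \<open>nest\<close> obeys the
  first-block recursion of the moments.\<close>

lemma nest_eta_monochrome: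
  assumes "\<And>c. \<mu> c \<in> D_alg" "monochrome c u"
  shows "nest (\<lambda>c. nccoeff (eta_series (\<mu> c))) {c} u = word_moment (\<mu> c) (map letter_index u)"
  using assms(2)
proof (induction u rule: length_induct)
  case (1 u)
  show ?case
  proof (cases "u = []")
    case True
    then show ?thesis
      using assms(1)[of c] by (simp add: word_moment_def single_Nil_1 D_alg_def)
  next
    case False
    let ?e = "\<lambda>c. nccoeff (eta_series (\<mu> c))"
    have "chain ?e c [] (take i u) * nest ?e {c} (drop i u) =
        ?e c (take i (map letter_index u)) * word_moment (\<mu> c) (drop i (map letter_index u))"
      if i: "i \<in> {1..length u}" for i
    proof -
      have "monochrome c (take i u)" "monochrome c (drop i u)"
        using 1(2) by (auto simp: monochrome_def dest: in_set_takeD in_set_dropD)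
      then show ?thesis
        using 1(1) i False by (simp add: chain_monochrome take_map drop_map)
    qed
    then show ?thesis
      using False word_moment_eta[OF assms(1), of "map letter_index u" c]
      by (subst nest.simps) simp
  qed
qed

lemma D_alg_ncpair: "\<mu> \<in> D_alg \<Longrightarrow> \<mu> = ncpair (Abs_ncfps (word_moment \<mu>))"
proof
  fix p assume "\<mu> \<in> D_alg"
  then interpret Vector_Spaces.linear ncscale "(*)" \<mu> by (simp add: D_alg_def)
  have "\<mu> (Poly_Mapping.single w c) = c * word_moment \<mu> w" for w c
    using scale[of c "Poly_Mapping.single w 1"] by (simp add: ncscale_single word_moment_def)
  then have "\<mu> (\<Sum>w\<in>Poly_Mapping.keys p. Poly_Mapping.single w (Poly_Mapping.lookup p w)) =
     ncpair (Abs_ncfps (word_moment \<mu>)) p"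
    by (simp add: sum ncpair_def)
  then show "\<mu> p = ncpair (Abs_ncfps (word_moment \<mu>)) p"
    by (simp flip: ncpoly_sum_single)
qed

lemma D_alg_eqI:
  assumes "\<mu> \<in> D_alg" "\<nu> \<in> D_alg" "\<And>w. word_moment \<mu> w = word_moment \<nu> w"
  shows "\<mu> = \<nu>"
proof -
  have "word_moment \<mu> = word_moment \<nu>" using assms(3) by auto
  then show ?thesis using D_alg_ncpair[OF assms(1)] D_alg_ncpair[OF assms(2)] by simp
qed

lemma ncpair_in_D_alg: "nccoeff f [] = 1 \<Longrightarrow> ncpair f \<in> D_alg"
  by (simp add: D_alg_def linear_ncpair)

lemma word_moment_ncpair [simp]: "word_moment (ncpair f) w = nccoeff f w"
  by (simp add: word_moment_def)


section \<open>Realizing free multiplicative convolution\<close>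

definition alternating_word :: "'k list \<Rightarrow> ('k + 'k) list" where
  "alternating_word w = concat (map (\<lambda>i. [Inl i, Inr i]) w)"

definition boolean_cumulants ::
    "('k ncpoly \<Rightarrow> complex) \<Rightarrow> ('k ncpoly \<Rightarrow> complex) \<Rightarrow> bool \<Rightarrow> 'k list \<Rightarrow> complex" where
  "boolean_cumulants \<mu> \<nu> c = nccoeff (eta_series (if c then \<mu> else \<nu>))"

definition free_product_series ::
    "('k ncpoly \<Rightarrow> complex) \<Rightarrow> ('k ncpoly \<Rightarrow> complex) \<Rightarrow> ('k + 'k) ncfps" where
  "free_product_series \<mu> \<nu> = nest_series (boolean_cumulants \<mu> \<nu>) UNIV"

definition product_distribution ::
    "('k ncpoly \<Rightarrow> complex) \<Rightarrow> ('k ncpoly \<Rightarrow> complex) \<Rightarrow> 'k ncpoly \<Rightarrow> complex" where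
  "product_distribution \<mu> \<nu> =
     ncpair (Abs_ncfps (\<lambda>w. nccoeff (free_product_series \<mu> \<nu>) (alternating_word w)))"

lemma nest_boolean_cumulants:
  assumes "\<mu> \<in> D_alg" "\<nu> \<in> D_alg" "monochrome c u" "c \<in> S"
  shows "nest (boolean_cumulants \<mu> \<nu>) S u = word_moment (if c then \<mu> else \<nu>) (map letter_index u)"
  using nest_eta_monochrome[of "\<lambda>c. if c then \<mu> else \<nu>", OF _ assms(3)] assms(1,2)
  unfolding nest_monochrome[OF assms(3,4)] boolean_cumulants_def by simp

lemma product_distribution_in_D_alg: "product_distribution \<mu> \<nu> \<in> D_alg"
  unfolding product_distribution_def
  by (rule ncpair_in_D_alg) (simp add: alternating_word_def free_product_series_def)

lemma word_moment_product_distribution: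
  "word_moment (product_distribution \<mu> \<nu>) w =
     nest (boolean_cumulants \<mu> \<nu>) UNIV (alternating_word w)"
  by (simp add: product_distribution_def free_product_series_def)

section \<open>Existence and uniqueness of free realizations\<close>

lemma joint_distribution_iff:
  "joint_distribution \<phi> x \<mu> \<longleftrightarrow>
     \<mu> \<in> D_alg \<and> (\<forall>w. word_moment \<mu> w = \<phi> (prod_list (map x w)))"
  by (simp add: joint_distribution_def word_moment_def prod_list_ncX)

lemma prod_list_map_ncX: "prod_list (map (\<lambda>i. ncX (f i)) w) = Poly_Mapping.single (map f w) 1"
  using prod_list_ncX[of "map f w"] by (simp add: comp_def)

lemma prod_list_alternating_word:
  "prod_list (map (\<lambda>i. x i * y i) w) = prod_list (map (case_sum x y) (alternating_word w))"
  by (induction w) (simp_all add: alternating_word_def mult.assoc)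

lemma colour_poly_generated:
  fixes p :: "('k + 'k) ncpoly"
  assumes "p \<in> generated_algebra ncscale (range (\<lambda>i. ncX (if c then Inl i else Inr i)))"
  shows "colour_poly c p"
proof -
  let ?A = "{p :: ('k + 'k) ncpoly. colour_poly c p}"
  have "unital_subalgebra ncscale ?A"
    unfolding unital_subalgebra_def
  proof (intro conjI ballI allI)
    show "1 \<in> ?A" by (simp add: colour_poly_def monochrome_def zero_list_def)
  next
    fix a b assume ab: "a \<in> ?A" "b \<in> ?A"
    show "a + b \<in> ?A"
      using ab subsetD[OF Poly_Mapping.keys_add[of a b]] by (auto simp: colour_poly_def)
    show "a * b \<in> ?A"
      using ab subsetD[OF Poly_Mapping.keys_mult[of a b]]
      by (fastforce simp: colour_poly_def monochrome_def plus_list_def)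
  next
    fix k a assume "a \<in> ?A"
    then show "ncscale k a \<in> ?A" by (auto simp: colour_poly_def in_keys_iff)
  qed
  moreover have "range (\<lambda>i. ncX (if c then Inl i else Inr i)) \<subseteq> ?A"
    by (auto simp: colour_poly_def ncX_def monochrome_def split: if_splits)
  ultimately show ?thesis
    using assms hull_minimal unfolding generated_algebra_def by blast
qed

text \<open>The existence half for the \<open>THE\<close> in the definition of the convolution: the
  generators themselves are free under the functional given by
  \<open>free_product_series\<close>.\<close>

lemma realizes_product_distribution:
  fixes \<mu> \<nu> :: "'k ncpoly \<Rightarrow> complex"
  assumes "\<mu> \<in> D_alg" "\<nu> \<in> D_alg"
  shows "realizes_free_mult_conv ncscale (ncpair (free_product_series \<mu> \<nu>))
     (\<lambda>i. ncX (Inl i :: 'k + 'k)) (\<lambda>i. ncX (Inr i)) \<mu> \<nu> (product_distribution \<mu> \<nu>)"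
  unfolding realizes_free_mult_conv_def
proof (intro conjI)
  let ?e = "boolean_cumulants \<mu> \<nu>"
  show "nc_prob_space ncscale (ncpair (free_product_series \<mu> \<nu>))"
    by (intro nc_prob_space.intro nc_prob_space_axioms.intro ncpoly.complex_algebra_axioms
        linear_ncpair) (simp add: free_product_series_def)
  show "joint_distribution (ncpair (free_product_series \<mu> \<nu>)) (\<lambda>i. ncX (Inl i :: 'k + 'k)) \<mu>"
  proof -
    have "map letter_index (map Inl w :: ('k + 'k) list) = w" for w
      by (simp add: letter_index_def comp_def)
    then show ?thesis
      using assms nest_boolean_cumulants[OF assms, of True _ UNIV]
      by (simp add: joint_distribution_iff prod_list_map_ncX free_product_series_def monochrome_def)
  qed
  show "joint_distribution (ncpair (free_product_series \<mu> \<nu>)) (\<lambda>i. ncX (Inr i :: 'k + 'k)) \<nu>"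
  proof -
    have "map letter_index (map Inr w :: ('k + 'k) list) = w" for w
      by (simp add: letter_index_def comp_def)
    then show ?thesis
      using assms nest_boolean_cumulants[OF assms, of False _ UNIV]
      by (simp add: joint_distribution_iff prod_list_map_ncX free_product_series_def monochrome_def)
  qed
  show "joint_distribution (ncpair (free_product_series \<mu> \<nu>))
     (\<lambda>i. ncX (Inl i :: 'k + 'k) * ncX (Inr i)) (product_distribution \<mu> \<nu>)"
  proof -
    have "case_sum (\<lambda>i. ncX (Inl i)) (\<lambda>i. ncX (Inr i)) = (ncX :: 'k + 'k \<Rightarrow> _)"
      by (auto split: sum.split)
    then show ?thesis
      by (simp add: joint_distribution_iff product_distribution_in_D_alg
          word_moment_product_distribution prod_list_alternating_word prod_list_ncX
          free_product_series_def)
  qed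
  show "freely_independent ncscale (ncpair (free_product_series \<mu> \<nu>))
     (range (\<lambda>i. ncX (Inl i :: 'k + 'k))) (range (\<lambda>i. ncX (Inr i)))"
    unfolding freely_independent_def
  proof (intro allI impI, elim conjE)
    fix as :: "('k + 'k) ncpoly list" and rs
    assume as: "as \<noteq> []" "distinct_adj rs" "list_all2 (\<lambda>a r. a \<in> generated_algebra ncscale
         (if r then range (\<lambda>i. ncX (Inl i)) else range (\<lambda>i. ncX (Inr i))) \<and>
         ncpair (free_product_series \<mu> \<nu>) a = 0) as rs"
    \<comment> \<open>Freeness centres with the full functional, while
      \<open>nest_alternating\<close> asks for the series of one colour; on polynomials of that
      colour both agree.\<close>
    have "colour_poly r a \<and> ncpair (nest_series ?e {r}) a = 0"
      if "a \<in> generated_algebra ncscale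
         (if r then range (\<lambda>i. ncX (Inl i)) else range (\<lambda>i. ncX (Inr i)))"
        "ncpair (free_product_series \<mu> \<nu>) a = 0" for a and r
    proof
      show a: "colour_poly r a"
        using that(1) by (intro colour_poly_generated) (simp split: if_splits)
      have "ncpair (nest_series ?e {r}) a = ncpair (nest_series ?e UNIV) a"
        using a nest_monochrome[of r _ UNIV ?e] by (intro ncpair_cong) (auto simp: colour_poly_def)
      then show "ncpair (nest_series ?e {r}) a = 0"
        using that(2) by (simp add: free_product_series_def)
    qed
    then have "list_all2 (\<lambda>a r. colour_poly r a \<and> ncpair (nest_series ?e {r}) a = 0) as rs"
      using as(3) by (elim list_all2_mono) blast
    then show "ncpair (free_product_series \<mu> \<nu>) (prod_list as) = 0"
      unfolding free_product_series_def using as by (intro nest_alternating) auto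
  qed
qed

lemma unital_subalgebra_generated: "unital_subalgebra scale (generated_algebra scale S)"
  unfolding generated_algebra_def by (rule hull_in) (auto simp: unital_subalgebra_def)

lemma (in complex_algebra) prod_list_generated:
  "set zs \<subseteq> S \<Longrightarrow> prod_list zs \<in> generated_algebra scale S"
  using unital_subalgebra_generated[of scale S]
  by (induction zs) (auto simp: unital_subalgebra_def generated_algebra_def intro: hull_inc)

text \<open>The uniqueness half, for realizations in any algebra. The pulled-back functional
  \<open>f\<close> and the series \<open>g\<close> have the same moments \<open>m\<close> on words
  of one colour; centring with \<open>m\<close> therefore makes both vanish on alternating products,
  one by the assumed freeness and the other by \<open>nest_alternating\<close>.\<close>

lemma realized_distribution:
  fixes x y :: "'k \<Rightarrow> 'm::ring_1"
  assumes \<mu>: "\<mu> \<in> D_alg" and \<nu>: "\<nu> \<in> D_alg"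
    and real: "realizes_free_mult_conv scale \<phi> x y \<mu> \<nu> \<rho>"
  shows "\<rho> = product_distribution \<mu> \<nu>"
proof -
  interpret nc_prob_space scale \<phi>
    using real by (simp add: realizes_free_mult_conv_def)
  interpret phi: Vector_Spaces.linear scale "(*)" \<phi> by (rule linear_phi)
  let ?e = "boolean_cumulants \<mu> \<nu>"
  define z where "z = case_sum x y"
  define f where "f = Abs_ncfps (\<lambda>w. \<phi> (prod_list (map z w)))"
  define g where "g = nest_series ?e UNIV"
  define m where "m = nest ?e UNIV"
  have pair: "ncpair f p = \<phi> (nceval scale z p)" for p
    by (simp add: ncpair_def nceval_def f_def phi.sum phi.scale)
  have joint: "joint_distribution \<phi> x \<mu>" "joint_distribution \<phi> y \<nu>"
    "joint_distribution \<phi> (\<lambda>i. x i * y i) \<rho>"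
    and free: "freely_independent scale \<phi> (range x) (range y)"
    using real by (simp_all add: realizes_free_mult_conv_def)
  have z: "map z u = map (if c then x else y) (map letter_index u)" if "monochrome c u" for c u
    using that by (auto simp: monochrome_def z_def letter_index_def split: sum.split)
  have m: "\<phi> (prod_list (map z u)) = m u" if "monochrome c u" for c u
    unfolding z[OF that] using joint nest_boolean_cumulants[OF \<mu> \<nu> that, of UNIV]
    by (cases c) (simp_all add: joint_distribution_iff m_def del: map_map)
  have "f = g"
  proof (rule free_series_unique[where m = m])
    show "nccoeff f [] = nccoeff g []" by (simp add: f_def g_def phi_one)
  next
    fix us :: "('k + 'k) list list" and rs
    assume us: "us \<noteq> []" "distinct_adj rs"
      "list_all2 (\<lambda>u r. u \<noteq> [] \<and> monochrome r u) us rs"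
    let ?a = "\<lambda>u. nceval scale z (centred m u)"
    \<comment> \<open>Written as a sum because the closure conditions of
      \<open>unital_subalgebra\<close> speak of sums and scalar multiples.\<close>
    have eval: "?a u = prod_list (map z u) + scale (- m u) 1" for u
    proof -
      have "centred m u = Poly_Mapping.single u 1 + Poly_Mapping.single [] (- m u)"
        by (simp add: centred_def single_uminus)
      then show ?thesis by (simp add: nceval_add nceval_single)
    qed
    have "?a u \<in> generated_algebra scale (if r then range x else range y) \<and> \<phi> (?a u) = 0"
      if u: "monochrome r u" for u r
    proof
      have "prod_list (map z u) \<in> generated_algebra scale (if r then range x else range y)"
        unfolding z[OF u] by (intro prod_list_generated) auto
      then show "?a u \<in> generated_algebra scale (if r then range x else range y)"
        unfolding eval using unital_subalgebra_generated[of scale "if r then range x else range y"]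
        by (simp only: unital_subalgebra_def)
      show "\<phi> (?a u) = 0"
        unfolding eval by (simp only: phi.add phi.scale m[OF u] phi_one) simp
    qed
    then have "list_all2 (\<lambda>a r. a \<in> generated_algebra scale (if r then range x else range y) \<and>
        \<phi> a = 0) (map ?a us) rs"
      unfolding list.rel_map using us(3) by (elim list_all2_mono) blast
    then have "\<phi> (prod_list (map ?a us)) = 0"
      using free us(1,2) unfolding freely_independent_def by blast
    then have "ncpair f (prod_list (map (centred m) us)) = 0"
      by (simp add: pair nceval_prod_list comp_def)
    moreover have "ncpair g (prod_list (map (centred m) us)) = 0"
      unfolding g_def
    proof (rule nest_alternating)
      have "colour_poly r (centred m u) \<and> ncpair (nest_series ?e {r}) (centred m u) = 0"
        if u: "monochrome r u" for u r
      proof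
        show "colour_poly r (centred m u)"
          using u subsetD[OF keys_diff[of "Poly_Mapping.single u 1"]]
          by (fastforce simp: colour_poly_def centred_def monochrome_def split: if_splits)
        show "ncpair (nest_series ?e {r}) (centred m u) = 0"
          using nest_monochrome[OF u, of UNIV ?e] by (simp add: centred_def ncpair_minus m_def)
      qed
      then show "list_all2 (\<lambda>a r. colour_poly r a \<and> ncpair (nest_series ?e {r}) a = 0)
          (map (centred m) us) rs"
        unfolding list.rel_map using us(3) by (elim list_all2_mono) blast
    qed (use us in auto)
    ultimately show "ncpair f (prod_list (map (centred m) us)) =
      ncpair g (prod_list (map (centred m) us))" by simp
  qed
  have "word_moment \<rho> w = word_moment (product_distribution \<mu> \<nu>) w" for w
  proof -
    have "word_moment \<rho> w = nccoeff f (alternating_word w)"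
      using joint by (simp add: joint_distribution_iff f_def z_def prod_list_alternating_word)
    then show ?thesis
      using \<open>f = g\<close> by (simp add: g_def word_moment_product_distribution)
  qed
  then show ?thesis
    using joint by (intro D_alg_eqI product_distribution_in_D_alg) (auto simp: joint_distribution_def)
qed

lemma free_mult_conv_eq:
  fixes \<mu> \<nu> :: "'k ncpoly \<Rightarrow> complex"
  assumes "\<mu> \<in> D_alg" "\<nu> \<in> D_alg"
  shows "\<mu> \<boxtimes> \<nu> = product_distribution \<mu> \<nu>"
  unfolding free_mult_conv_def
proof (rule the_equality)
  show "\<exists>\<phi> x y. realizes_free_mult_conv (ncscale :: _ \<Rightarrow> ('k + 'k) ncpoly \<Rightarrow> _) \<phi> x y \<mu> \<nu> (product_distribution \<mu> \<nu>)"
    using realizes_product_distribution[OF assms] by blast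
qed (use realized_distribution[OF assms] in blast)


section \<open>Alternating words\<close>

text \<open>Letters keep their absolute positions, so the parities of \<open>m\<close> and
  \<open>n\<close> tell the colours at the two ends.\<close>

definition alternating_segment :: "'k list \<Rightarrow> nat \<Rightarrow> nat \<Rightarrow> ('k + 'k) list" where
  "alternating_segment w m n =
     map (\<lambda>i. if even i then Inl (w ! (i div 2)) else Inr (w ! (i div 2))) [m..<n]"

lemma alternating_segment_simps [simp]:
  "alternating_segment w m n = [] \<longleftrightarrow> n \<le> m"
  "length (alternating_segment w m n) = n - m"
  "m < n \<Longrightarrow> isl (hd (alternating_segment w m n)) = even m"
  "m < n \<Longrightarrow> isl (last (alternating_segment w m n)) = odd n"
  "m + i \<le> n \<Longrightarrow> take i (alternating_segment w m n) = alternating_segment w m (m + i)"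
  "drop i (alternating_segment w m n) = alternating_segment w (m + i) n"
  by (auto simp: alternating_segment_def hd_map last_map take_map drop_map)

lemma alternating_segment_empty [simp]: "n \<le> m \<Longrightarrow> alternating_segment w m n = []"
  by simp

lemma alternating_segment_Cons:
  "m < n \<Longrightarrow> alternating_segment w m n =
     (if even m then Inl (w ! (m div 2)) else Inr (w ! (m div 2))) # alternating_segment w (Suc m) n"
  by (simp add: alternating_segment_def upt_conv_Cons)

lemma alternating_word_eq_segment: "alternating_word w = alternating_segment w 0 (2 * length w)"
proof (induction w)
  case (Cons a w)
  have "[0..<2 * length (a # w)] = 0 # 1 # map (\<lambda>i. i + 2) [0..<2 * length w]"
    unfolding map_add_upt by (simp add: upt_conv_Cons eval_nat_numeral del: upt_Suc)
  then show ?case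
    using Cons by (simp add: alternating_word_def alternating_segment_def comp_def)
qed (simp add: alternating_word_def alternating_segment_def)

lemma alternating_segment_drop:
  "alternating_segment (drop i w) 0 (2 * (length w - i)) = alternating_segment w (2 * i) (2 * length w)"
proof (cases "i \<le> length w")
  case True
  have "[2 * i..<2 * length w] = map (\<lambda>k. k + 2 * i) [0..<2 * (length w - i)]"
    using True unfolding map_add_upt by (simp add: diff_mult_distrib2)
  then show ?thesis
    using True by (simp add: alternating_segment_def comp_def nth_drop add.commute)
qed simp

lemma alternating_segment_take:
  "n \<le> 2 * i \<Longrightarrow> alternating_segment (take i w) m n = alternating_segment w m n"
  by (auto simp: alternating_segment_def)

section \<open>Rigidity of nested blocks on alternating segments\<close>

lemma chain_alternating_eq_0:
  "even m \<noteq> c \<or> odd n \<noteq> c \<Longrightarrow> chain e c p (alternating_segment w m n) = 0"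
  using chain_hd_colour[of "alternating_segment w m n" c e p]
    chain_nest_last_colour(1)[of "alternating_segment w m n" c e p]
  by (cases "m < n") auto

lemma chain_alternating:
  assumes "m < n"
  shows "chain e (even m) p (alternating_segment w m n) =
    (if n = Suc m then e (even m) (p @ [w ! (m div 2)])
     else \<Sum>k\<in>{Suc m..<n}. nest e {odd m} (alternating_segment w (Suc m) k) *
            chain e (even m) (p @ [w ! (m div 2)]) (alternating_segment w k n))"
proof -
  have "(\<Sum>i<n - Suc m. nest e {odd m} (take i (alternating_segment w (Suc m) n)) *
            chain e (even m) (p @ [w ! (m div 2)]) (drop i (alternating_segment w (Suc m) n))) =
    (\<Sum>k\<in>{Suc m..<n}. nest e {odd m} (alternating_segment w (Suc m) k) *
            chain e (even m) (p @ [w ! (m div 2)]) (alternating_segment w k n))"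
    by (rule sum.reindex_bij_witness[where i = "\<lambda>k. k - Suc m" and j = "\<lambda>i. i + Suc m"])
      (auto simp: add.commute)
  moreover define l where "l = (if even m then Inl (w ! (m div 2)) else Inr (w ! (m div 2)))"
  have "alternating_segment w m n = l # alternating_segment w (Suc m) n"
    unfolding l_def by (rule alternating_segment_Cons[OF assms])
  moreover have "isl l = even m" "letter_index l = w ! (m div 2)"
    by (simp_all add: l_def letter_index_def)
  ultimately show ?thesis
    using assms by (auto simp: chain.simps(2))
qed

text \<open>If a block of colour \<open>even m\<close> ends before \<open>n\<close>, it ends with
  its own colour, so the next letter has the other colour and no further outer block can begin
  there. Hence a gap is filled by one block.\<close>

lemma nest_alternating_segment:
  assumes "m < n"
  shows "nest e {even m} (alternating_segment w m n) = chain e (even m) [] (alternating_segment w m n)"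
proof -
  have "(\<Sum>i\<in>{1..n - m}. chain e (even m) [] (take i (alternating_segment w m n)) *
       nest e {even m} (drop i (alternating_segment w m n))) =
     (\<Sum>i\<in>{n - m}. chain e (even m) [] (take i (alternating_segment w m n)) *
       nest e {even m} (drop i (alternating_segment w m n)))"
  proof (rule sum.mono_neutral_right)
    show "\<forall>i\<in>{1..n - m} - {n - m}. chain e (even m) [] (take i (alternating_segment w m n)) *
       nest e {even m} (drop i (alternating_segment w m n)) = 0"
    proof
      fix i assume "i \<in> {1..n - m} - {n - m}"
      then have i: "m + i < n" "m + i \<le> n" by auto
      then show "chain e (even m) [] (take i (alternating_segment w m n)) *
         nest e {even m} (drop i (alternating_segment w m n)) = 0"
        using chain_alternating_eq_0[of m "even m" "m + i" e "[]" w]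
          nest_hd_colour[of "alternating_segment w (m + i) n" "{even m}" e]
        by (cases "even (m + i) = even m") auto
    qed
  qed (use assms in auto)
  then show ?thesis
    using assms by (subst nest.simps) simp
qed

lemma sum_eq_sum_image_support:
  fixes f :: "nat \<Rightarrow> 'b::comm_monoid_add"
  assumes "finite A" "inj_on g B" "g ` B \<subseteq> A" "\<And>k. k \<in> A \<Longrightarrow> k \<notin> g ` B \<Longrightarrow> f k = 0"
  shows "sum f A = (\<Sum>c\<in>B. f (g c))"
proof -
  have "sum f A = sum f (g ` B)"
    using assms by (intro sum.mono_neutral_right) auto
  then show ?thesis
    using assms by (simp add: sum.reindex)
qed

text \<open>Position \<open>a \<ge> 1\<close> of \<open>w\<close> contributes the letters \<open>2 * a - 2\<close> and \<open>2 * a - 1\<close> of the alternating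
  word; \<open>outer_chain\<close> runs from an \<open>Inl\<close> to an \<open>Inl\<close>, \<open>inner_chain\<close> from an \<open>Inr\<close> to an \<open>Inr\<close>.\<close>

definition outer_chain :: "(bool \<Rightarrow> 'k list \<Rightarrow> complex) \<Rightarrow> 'k list \<Rightarrow> 'k list \<Rightarrow> nat \<Rightarrow> nat \<Rightarrow> complex" where
  "outer_chain e w p a b = chain e True p (alternating_segment w (2 * a - 2) (2 * b - 1))"

definition inner_chain :: "(bool \<Rightarrow> 'k list \<Rightarrow> complex) \<Rightarrow> 'k list \<Rightarrow> 'k list \<Rightarrow> nat \<Rightarrow> nat \<Rightarrow> complex" where
  "inner_chain e w p a b = chain e False p (alternating_segment w (2 * a - 1) (2 * b))"

text \<open>If \<open>c\<close> follows \<open>a\<close> in the block, the gap runs from the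
  \<open>Inr\<close> letter of \<open>a\<close> to the \<open>Inr\<close> letter of
  \<open>c - 1\<close>, and one block spans it.\<close>

lemma outer_chain_rec:
  assumes "1 \<le> a" "a \<le> b"
  shows "outer_chain e w p a b =
    (if a = b then e True (p @ [w ! (a - 1)])
     else \<Sum>c\<in>{a+1..b}. inner_chain e w [] a (c - 1) * outer_chain e w (p @ [w ! (a - 1)]) c b)"
proof (cases "a = b")
  case False
  \<comment> \<open>An even position \<open>k\<close> carries the \<open>Inl\<close> letter of
    \<open>k div 2 + 1\<close>; a chain of colour \<open>True\<close> cannot start at an odd
    one.\<close>
  have k: "k \<in> (\<lambda>c. 2 * c - 2) ` {a + 1..b}"
    if "k \<in> {Suc (2 * a - 2)..<2 * b - 1}" "even k" for k
    using that assms by (intro image_eqI[of _ _ "k div 2 + 1"]) auto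
  have zero: "x * chain e True q (alternating_segment w k n) = 0"
    if "k \<in> {Suc (2 * a - 2)..<2 * b - 1}" "k \<notin> (\<lambda>c. 2 * c - 2) ` {a + 1..b}" for k x q n
    using k[OF that(1)] that(2) chain_alternating_eq_0[of k True n e q w] by auto
  have "outer_chain e w p a b =
     (\<Sum>k\<in>{Suc (2 * a - 2)..<2 * b - 1}. nest e {False} (alternating_segment w (Suc (2 * a - 2)) k) *
            chain e True (p @ [w ! (a - 1)]) (alternating_segment w k (2 * b - 1)))"
  proof -
    have "2 * a - 2 < 2 * b - 1" "even (2 * a - 2) = True" "(2 * a - 2) div 2 = a - 1"
      "2 * b - 1 \<noteq> Suc (2 * a - 2)"
      using assms False by auto
    then show ?thesis
      using chain_alternating[of "2 * a - 2" "2 * b - 1" e p w] by (simp add: outer_chain_def)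
  qed
  also have "\<dots> = (\<Sum>c\<in>{a+1..b}. nest e {False} (alternating_segment w (Suc (2 * a - 2)) (2 * c - 2)) *
            chain e True (p @ [w ! (a - 1)]) (alternating_segment w (2 * c - 2) (2 * b - 1)))"
    using assms by (intro sum_eq_sum_image_support zero) (auto simp: inj_on_def)
  also have "\<dots> = (\<Sum>c\<in>{a+1..b}. inner_chain e w [] a (c - 1) * outer_chain e w (p @ [w ! (a - 1)]) c b)"
  proof (rule sum.cong)
    fix c assume c: "c \<in> {a+1..b}"
    have *: "Suc (2 * a - 2) = 2 * a - 1" "2 * c - 2 = 2 * (c - 1)" "odd (2 * a - 1)"
      using assms c by auto
    have "2 * a - 1 < 2 * (c - 1)" using assms c by auto
    then have "nest e {False} (alternating_segment w (2 * a - 1) (2 * (c - 1))) =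
        chain e False [] (alternating_segment w (2 * a - 1) (2 * (c - 1)))"
      using nest_alternating_segment[of "2 * a - 1" "2 * (c - 1)" e w] *(3) by simp
    then show "nest e {False} (alternating_segment w (Suc (2 * a - 2)) (2 * c - 2)) *
          chain e True (p @ [w ! (a - 1)]) (alternating_segment w (2 * c - 2) (2 * b - 1)) =
       inner_chain e w [] a (c - 1) * outer_chain e w (p @ [w ! (a - 1)]) c b"
      unfolding outer_chain_def inner_chain_def * by simp
  qed simp
  finally show ?thesis using False by simp
next
  case True
  have "even (2 * a - 2) = True" "(2 * a - 2) div 2 = a - 1" "2 * a - 1 = Suc (2 * a - 2)"
    using assms by auto
  then show ?thesis
    using chain_alternating[of "2 * a - 2" "2 * a - 1" e p w] True by (simp add: outer_chain_def)
qed

text \<open>The offsets differ from \<open>outer_chain_rec\<close>: between the \<open>Inr\<close>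
  letters of \<open>a\<close> and \<open>c\<close> the gap starts with the \<open>Inl\<close> letter
  of \<open>a + 1\<close> and ends with the \<open>Inl\<close> letter of \<open>c\<close>
  itself.\<close>

lemma inner_chain_rec:
  assumes "1 \<le> a" "a \<le> b"
  shows "inner_chain e w p a b =
    (if a = b then e False (p @ [w ! (a - 1)])
     else \<Sum>c\<in>{a+1..b}. outer_chain e w [] (a + 1) c * inner_chain e w (p @ [w ! (a - 1)]) c b)"
proof -
  have a: "even (2 * a - 1) = False" "(2 * a - 1) div 2 = a - 1" "Suc (2 * a - 1) = 2 * a"
    using assms by auto
  show ?thesis
  proof (cases "a = b")
    case False
    have k: "k \<in> (\<lambda>c. 2 * c - 1) ` {a + 1..b}"
      if "k \<in> {2 * a..<2 * b}" "odd k" for k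
      using that assms by (intro image_eqI[of _ _ "k div 2 + 1"]) (auto elim!: oddE)
    have zero: "x * chain e False q (alternating_segment w k n) = 0"
      if "k \<in> {2 * a..<2 * b}" "k \<notin> (\<lambda>c. 2 * c - 1) ` {a + 1..b}" for k x q n
      using k[OF that(1)] that(2) chain_alternating_eq_0[of k False n e q w] by auto
    have "inner_chain e w p a b =
       (\<Sum>k\<in>{2 * a..<2 * b}. nest e {True} (alternating_segment w (2 * a) k) *
              chain e False (p @ [w ! (a - 1)]) (alternating_segment w k (2 * b)))"
      using chain_alternating[of "2 * a - 1" "2 * b" e p w] assms False
      unfolding a by (auto simp: inner_chain_def)
    also have "\<dots> = (\<Sum>c\<in>{a+1..b}. nest e {True} (alternating_segment w (2 * a) (2 * c - 1)) *
              chain e False (p @ [w ! (a - 1)]) (alternating_segment w (2 * c - 1) (2 * b)))"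
      using assms by (intro sum_eq_sum_image_support zero) (auto simp: inj_on_def)
    also have "\<dots> = (\<Sum>c\<in>{a+1..b}. outer_chain e w [] (a + 1) c * inner_chain e w (p @ [w ! (a - 1)]) c b)"
    proof (rule sum.cong)
      fix c assume c: "c \<in> {a+1..b}"
      have *: "2 * (a + 1) - 2 = 2 * a" by simp
      have "2 * a < 2 * c - 1" using c by auto
      then have "nest e {True} (alternating_segment w (2 * a) (2 * c - 1)) =
          chain e True [] (alternating_segment w (2 * a) (2 * c - 1))"
        using nest_alternating_segment[of "2 * a" "2 * c - 1" e w] by simp
      then show "nest e {True} (alternating_segment w (2 * a) (2 * c - 1)) *
            chain e False (p @ [w ! (a - 1)]) (alternating_segment w (2 * c - 1) (2 * b)) =
         outer_chain e w [] (a + 1) c * inner_chain e w (p @ [w ! (a - 1)]) c b"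
        unfolding outer_chain_def inner_chain_def * by simp
    qed simp
    finally show ?thesis using False by simp
  next
    case True
    then show ?thesis
      using chain_alternating[of "2 * a - 1" "2 * b" e p w] assms
      unfolding a by (auto simp: inner_chain_def)
  qed
qed

text \<open>The Boolean cumulant of the products: an outer \<open>Inl\<close> block holding the
  first letter, then an outer \<open>Inr\<close> block holding the last one; they meet between the
  two letters of \<open>j\<close>.\<close>

definition chain_product :: "(bool \<Rightarrow> 'k list \<Rightarrow> complex) \<Rightarrow> 'k list \<Rightarrow> complex" where
  "chain_product e w = (\<Sum>j\<in>{1..length w}. outer_chain e w [] 1 j * inner_chain e w [] j (length w))"

lemma nest_UNIV_alternating:
  assumes "m < n"
  shows "nest e UNIV (alternating_segment w m n) =
    (\<Sum>k\<in>{m+1..n}. chain e (even m) [] (alternating_segment w m k) *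
        nest e UNIV (alternating_segment w k n))"
proof -
  have "(\<Sum>c\<in>UNIV. chain e c [] (alternating_segment w m k)) =
      chain e (even m) [] (alternating_segment w m k)" for k
    by (cases "even m") (simp_all add: UNIV_bool chain_alternating_eq_0)
  moreover have "(\<Sum>i\<in>{1..n - m}. (\<Sum>c\<in>UNIV. chain e c [] (take i (alternating_segment w m n))) *
       nest e UNIV (drop i (alternating_segment w m n))) =
    (\<Sum>k\<in>{m+1..n}. (\<Sum>c\<in>UNIV. chain e c [] (alternating_segment w m k)) *
        nest e UNIV (alternating_segment w k n))"
    by (rule sum.reindex_bij_witness[where i = "\<lambda>k. k - m" and j = "\<lambda>i. i + m"])
      (auto simp: add.commute)
  ultimately show ?thesis
    using assms by (subst nest.simps) simp
qed

text \<open>Outer blocks alternate in colour, and every second one ends at the end of a pair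
  \<open>x y\<close>. Grouping them by twos yields the first-block recursion with
  \<open>chain_product\<close> in place of the eta-coefficients.\<close>

lemma nest_alternating_word:
  assumes "w \<noteq> []"
  shows "nest e UNIV (alternating_word w) =
    (\<Sum>i\<in>{1..length w}. chain_product e (take i w) * nest e UNIV (alternating_word (drop i w)))"
proof -
  let ?n = "length w"
  let ?N = "\<lambda>k. nest e UNIV (alternating_segment w k (2 * ?n))"
  have inner: "?N (2 * j - 1) = (\<Sum>i\<in>{j..?n}. inner_chain e w [] j i * ?N (2 * i))"
    if j: "j \<in> {1..?n}" for j
  proof -
    have odd: "even (2 * j - 1) = False" using j by auto
    have k: "k \<in> (\<lambda>i. 2 * i) ` {j..?n}" if "k \<in> {2 * j - 1 + 1..2 * ?n}" "even k" for k
      using that j by auto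
    have zero: "chain e False q (alternating_segment w m k) * x = 0"
      if "k \<in> {2 * j - 1 + 1..2 * ?n}" "k \<notin> (\<lambda>i. 2 * i) ` {j..?n}" for k x q m
      using k[OF that(1)] that(2) chain_alternating_eq_0[of m False k e q w] by auto
    have "?N (2 * j - 1) = (\<Sum>k\<in>{2 * j - 1 + 1..2 * ?n}.
        chain e False [] (alternating_segment w (2 * j - 1) k) * ?N k)"
      using nest_UNIV_alternating[of "2 * j - 1" "2 * ?n" e w] j unfolding odd by force
    also have "\<dots> = (\<Sum>i\<in>{j..?n}. chain e False [] (alternating_segment w (2 * j - 1) (2 * i)) * ?N (2 * i))"
      using j by (intro sum_eq_sum_image_support zero) (auto simp: inj_on_def)
    finally show ?thesis by (simp add: inner_chain_def)
  qed
  have k: "k \<in> (\<lambda>i. 2 * i - 1) ` {1..?n}" if "k \<in> {0 + 1..2 * ?n}" "odd k" for k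
    using that by (intro image_eqI[of _ _ "k div 2 + 1"]) (auto elim!: oddE)
  have zero: "chain e True q (alternating_segment w m k) * x = 0"
    if "k \<in> {0 + 1..2 * ?n}" "k \<notin> (\<lambda>i. 2 * i - 1) ` {1..?n}" for k x q m
    using k[OF that(1)] that(2) chain_alternating_eq_0[of m True k e q w] by auto
  have "?N 0 = (\<Sum>k\<in>{0 + 1..2 * ?n}. chain e True [] (alternating_segment w 0 k) * ?N k)"
    using nest_UNIV_alternating[of 0 "2 * ?n" e w] assms by simp
  also have "\<dots> = (\<Sum>j\<in>{1..?n}. chain e True [] (alternating_segment w 0 (2 * j - 1)) * ?N (2 * j - 1))"
    by (intro sum_eq_sum_image_support zero) (auto simp: inj_on_def)
  also have "\<dots> = (\<Sum>j\<in>{1..?n}. \<Sum>i\<in>{j..?n}.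
       outer_chain e w [] 1 j * inner_chain e w [] j i * ?N (2 * i))"
    by (intro sum.cong refl) (simp only: inner outer_chain_def, simp add: sum_distrib_left mult.assoc)
  also have "\<dots> = (\<Sum>i\<in>{1..?n}. \<Sum>j\<in>{1..i}.
       outer_chain e w [] 1 j * inner_chain e w [] j i * ?N (2 * i))"
    unfolding sum.Sigma[OF finite_atLeastAtMost ballI[OF finite_atLeastAtMost]]
    by (rule sum.reindex_bij_witness[where i = prod.swap and j = prod.swap]) auto
  also have "\<dots> = (\<Sum>i\<in>{1..?n}. chain_product e (take i w) * nest e UNIV (alternating_word (drop i w)))"
  proof (rule sum.cong)
    fix i assume i: "i \<in> {1..?n}"
    \<comment> \<open>Both segments lie before position \<open>2 * i\<close>, so truncating
      \<open>w\<close> does not change them.\<close>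
    have "outer_chain e (take i w) [] 1 j * inner_chain e (take i w) [] j i =
      outer_chain e w [] 1 j * inner_chain e w [] j i" if "j \<in> {1..i}" for j
    proof -
      have "2 * j - 1 \<le> 2 * i" "2 * i \<le> 2 * i" using that by auto
      then show ?thesis
        by (simp only: outer_chain_def inner_chain_def alternating_segment_take)
    qed
    moreover have "length (take i w) = i" using i by simp
    ultimately have "chain_product e (take i w) =
        (\<Sum>j\<in>{1..i}. outer_chain e w [] 1 j * inner_chain e w [] j i)"
      unfolding chain_product_def by simp
    moreover have "nest e UNIV (alternating_word (drop i w)) = ?N (2 * i)"
      by (simp add: alternating_word_eq_segment alternating_segment_drop)
    ultimately show "(\<Sum>j\<in>{1..i}. outer_chain e w [] 1 j * inner_chain e w [] j i * ?N (2 * i)) =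
        chain_product e (take i w) * nest e UNIV (alternating_word (drop i w))"
      by (simp add: sum_distrib_right)
  qed simp
  finally show ?thesis by (simp add: alternating_word_eq_segment)
qed

lemma eta_product_distribution:
  "eta_series (product_distribution \<mu> \<nu>) = Abs_ncfps (chain_product (boolean_cumulants \<mu> \<nu>))"
  by (rule eta_series_eqI[OF product_distribution_in_D_alg])
    (simp_all add: word_moment_product_distribution nest_alternating_word, simp add: chain_product_def)


section \<open>The Kreweras complement\<close>

text \<open>The blocks of the Kreweras complement are the classes of the relation \<open>saturated \<pi>\<close>.\<close>

definition left_open_interval :: "nat \<Rightarrow> nat \<Rightarrow> nat set" where
  "left_open_interval c d = {min c d<..max c d}"

definition saturated :: "nat set set \<Rightarrow> nat \<Rightarrow> nat \<Rightarrow> bool" where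
  "saturated \<pi> c d \<longleftrightarrow>
     (\<forall>B\<in>\<pi>. B \<subseteq> left_open_interval c d \<or> B \<inter> left_open_interval c d = {})"

definition saturation_classes :: "nat set set \<Rightarrow> nat set \<Rightarrow> nat set set" where
  "saturation_classes \<pi> S = (\<lambda>c. {d\<in>S. saturated \<pi> c d}) ` S"

lemma saturated_refl [simp]: "saturated \<pi> c c"
  by (simp add: saturated_def left_open_interval_def)

lemma saturated_sym: "saturated \<pi> c d \<Longrightarrow> saturated \<pi> d c"
  by (simp add: saturated_def left_open_interval_def min.commute max.commute)

lemma saturated_commute: "saturated \<pi> c d \<longleftrightarrow> saturated \<pi> d c"
  using saturated_sym by blast

text \<open>In every order of the three points, the interval between \<open>c\<close> and
  \<open>e\<close> is the symmetric difference of the other two, and unions of blocks are closed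
  under symmetric difference.\<close>

lemma saturated_trans:
  assumes "saturated \<pi> c d" "saturated \<pi> d e"
  shows "saturated \<pi> c e"
proof -
  have "left_open_interval c e =
    (left_open_interval c d - left_open_interval d e) \<union>
    (left_open_interval d e - left_open_interval c d)"
    by (auto simp: left_open_interval_def min_def max_def)
  moreover have "B \<subseteq> left_open_interval c d \<or> B \<inter> left_open_interval c d = {}"
    "B \<subseteq> left_open_interval d e \<or> B \<inter> left_open_interval d e = {}" if "B \<in> \<pi>" for B
    using assms that by (auto simp: saturated_def)
  ultimately show ?thesis
    unfolding saturated_def by (simp only:) blast
qed

lemma saturation_classes_subset: "A \<in> saturation_classes \<pi> S \<Longrightarrow> A \<subseteq> S"
  and saturation_classes_nonempty: "A \<in> saturation_classes \<pi> S \<Longrightarrow> A \<noteq> {}"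
  by (auto simp: saturation_classes_def)

lemma saturation_classes_saturated:
  "A \<in> saturation_classes \<pi> S \<Longrightarrow> x \<in> A \<Longrightarrow> y \<in> A \<Longrightarrow> saturated \<pi> x y"
  by (auto simp: saturation_classes_def) (meson saturated_sym saturated_trans)

lemma saturation_classes_eqI:
  assumes "A \<in> saturation_classes \<pi> S" "B \<in> saturation_classes \<pi> S"
    "x \<in> A" "y \<in> B" "saturated \<pi> x y"
  shows "A = B"
  using assms by (auto simp: saturation_classes_def) (meson saturated_sym saturated_trans)+

lemma partition_on_saturation_classes: "partition_on S (saturation_classes \<pi> S)"
proof (rule partition_onI)
  show "\<Union>(saturation_classes \<pi> S) = S"
    by (auto simp: saturation_classes_def)
  show "disjnt A B" if "A \<in> saturation_classes \<pi> S" "B \<in> saturation_classes \<pi> S" "A \<noteq> B" for A B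
    using saturation_classes_eqI[OF that(1,2)] that(3) saturated_refl unfolding disjnt_iff by metis
qed (use saturation_classes_nonempty in blast)

text \<open>For \<open>a < b < c < d\<close> the interval from \<open>a\<close> to \<open>b\<close>
  is the difference of the intervals from \<open>a\<close> to \<open>c\<close> and from
  \<open>b\<close> to \<open>d\<close>, so \<open>a\<close> and \<open>b\<close> are already
  equivalent.\<close>

lemma noncrossing_saturation_classes: "noncrossing (saturation_classes \<pi> S)"
  unfolding noncrossing_def
proof (intro ballI allI impI, elim conjE)
  fix A B a b c d
  assume AB: "A \<in> saturation_classes \<pi> S" "B \<in> saturation_classes \<pi> S"
    and *: "a < b" "b < c" "c < d" "a \<in> A" "c \<in> A" "b \<in> B" "d \<in> B"
  have ac: "saturated \<pi> a c" and bd: "saturated \<pi> b d"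
    using AB * saturation_classes_saturated by blast+
  have "left_open_interval a b = left_open_interval a c - left_open_interval b d"
    using * by (auto simp: left_open_interval_def)
  then have "saturated \<pi> a b"
    using ac bd unfolding saturated_def by blast
  then show "A = B"
    using saturation_classes_eqI AB * by blast
qed

lemma noncrossingD:
  "noncrossing \<pi> \<Longrightarrow> A \<in> \<pi> \<Longrightarrow> B \<in> \<pi> \<Longrightarrow> a \<in> A \<Longrightarrow> b \<in> B \<Longrightarrow> c \<in> A \<Longrightarrow> d \<in> B \<Longrightarrow>
     a < b \<Longrightarrow> b < c \<Longrightarrow> c < d \<Longrightarrow> A = B"
  unfolding noncrossing_def by blast

section \<open>Interleaving a partition with a candidate for its complement\<close>

lemma odd_even_union_cases:
  assumes "p \<in> odd_even_union \<pi> \<rho>" "q \<in> odd_even_union \<pi> \<rho>"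
  obtains (oo) A B where "A \<in> \<pi>" "B \<in> \<pi>" "p = (\<lambda>a. 2 * a - 1) ` A" "q = (\<lambda>a. 2 * a - 1) ` B"
    | (ee) A B where "A \<in> \<rho>" "B \<in> \<rho>" "p = (\<lambda>a. 2 * a) ` A" "q = (\<lambda>a. 2 * a) ` B"
    | (oe) A B where "A \<in> \<pi>" "B \<in> \<rho>" "p = (\<lambda>a. 2 * a - 1) ` A" "q = (\<lambda>a. 2 * a) ` B"
    | (eo) A B where "A \<in> \<rho>" "B \<in> \<pi>" "p = (\<lambda>a. 2 * a) ` A" "q = (\<lambda>a. 2 * a - 1) ` B"
  using assms unfolding odd_even_union_def by (elim UnE imageE) (rule that; assumption)+

lemma partition_on_odd_even_union:
  assumes "partition_on {1..n} \<pi>" "partition_on {1..n} \<rho>"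
  shows "partition_on {1..2 * n} (odd_even_union \<pi> \<rho>)"
proof -
  have U: "\<Union>\<pi> = {1..n}" "\<Union>\<rho> = {1..n}"
    by (simp_all only: assms[THEN partition_onD1, symmetric])
  have ne: "{} \<notin> \<pi>" "{} \<notin> \<rho>"
    using assms by (simp_all add: partition_onD3)
  have pos: "x \<ge> 1" if "A \<in> \<pi>" "x \<in> A" for A x
    using that U(1) by (metis UnionI atLeastAtMost_iff)
  have "\<Union>(odd_even_union \<pi> \<rho>) = (\<lambda>a. 2 * a - 1) ` \<Union>\<pi> \<union> (\<lambda>b. 2 * b) ` \<Union>\<rho>"
    unfolding odd_even_union_def by blast
  also have "\<dots> = (\<lambda>a. 2 * a - 1) ` {1..n} \<union> (\<lambda>b. 2 * b) ` {1..n}"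
    by (simp only: U)
  also have "\<dots> = {1..2 * n}"
  proof (intro set_eqI iffI)
    fix m assume m: "m \<in> {1..2 * n}"
    show "m \<in> (\<lambda>a. 2 * a - 1) ` {1..n} \<union> (\<lambda>b. 2 * b) ` {1..n}"
    proof (cases "even m")
      case True
      then obtain k where "m = 2 * k" by (elim evenE)
      then show ?thesis using m by (intro UnI2 image_eqI[of _ _ k]) auto
    next
      case False
      then show ?thesis using m
        by (intro UnI1 image_eqI[of _ _ "m div 2 + 1"]) (auto elim!: oddE)
    qed
  qed auto
  finally have "\<Union>(odd_even_union \<pi> \<rho>) = {1..2 * n}" .
  moreover have "p = q"
    if pq: "p \<in> odd_even_union \<pi> \<rho>" "q \<in> odd_even_union \<pi> \<rho>" "z \<in> p" "z \<in> q" for p q z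
  proof -
    have odd_even: "2 * x - 1 \<noteq> 2 * y" if "A \<in> \<pi>" "x \<in> A" for A x y
      using pos[OF that] by presburger
    have eq: "A = B" if "A \<in> \<pi> \<and> B \<in> \<pi> \<or> A \<in> \<rho> \<and> B \<in> \<rho>" "x \<in> A" "x \<in> B" for A B x
      using that disjointD[OF partition_onD2[OF assms(1)]] disjointD[OF partition_onD2[OF assms(2)]]
      by (metis disjoint_iff)
    show ?thesis
      using pq(1,2)
    proof (cases rule: odd_even_union_cases)
      case (oo A B)
      obtain x y where xy: "x \<in> A" "z = 2 * x - 1" "y \<in> B" "z = 2 * y - 1"
        using pq(3,4) unfolding oo(3,4) by blast
      then have "x = y" using pos[OF oo(1) xy(1)] pos[OF oo(2) xy(3)] by linarith
      then show ?thesis using eq oo xy by blast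
    next
      case (ee A B)
      obtain x y where xy: "x \<in> A" "z = 2 * x" "y \<in> B" "z = 2 * y"
        using pq(3,4) unfolding ee(3,4) by blast
      then have "x = y" by linarith
      then show ?thesis using eq ee xy by blast
    next
      case (oe A B)
      obtain x y where "x \<in> A" "z = 2 * x - 1" "z = 2 * y"
        using pq(3,4) unfolding oe(3,4) by blast
      then show ?thesis using odd_even[OF oe(1)] by blast
    next
      case (eo A B)
      obtain x y where "y \<in> B" "z = 2 * x" "z = 2 * y - 1"
        using pq(3,4) unfolding eo(3,4) by blast
      then show ?thesis using odd_even[OF eo(2)] by metis
    qed
  qed
  moreover have "{} \<notin> odd_even_union \<pi> \<rho>"
    using ne by (auto simp: odd_even_union_def)
  ultimately show ?thesis by (intro partition_onI) (unfold disjnt_iff, metis+)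
qed

text \<open>A crossing of equal parity comes from \<pi> or \<rho>. A crossing of mixed parity gives
  a block of \<pi> with one point inside and one point outside the interval between two points of a
  block of \<rho>, against saturation.\<close>

lemma noncrossing_odd_even_union:
  assumes "partition_on {1..n} \<pi>" "noncrossing \<pi>" "noncrossing \<rho>"
    and sat: "\<And>C x y. C \<in> \<rho> \<Longrightarrow> x \<in> C \<Longrightarrow> y \<in> C \<Longrightarrow> saturated \<pi> x y"
  shows "noncrossing (odd_even_union \<pi> \<rho>)"
  unfolding noncrossing_def
proof (intro ballI allI impI, elim conjE)
  fix A B a b c d
  assume AB: "A \<in> odd_even_union \<pi> \<rho>" "B \<in> odd_even_union \<pi> \<rho>"
    and *: "a < b" "b < c" "c < d" "a \<in> A" "c \<in> A" "b \<in> B" "d \<in> B"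
  have pos: "x \<ge> 1" if "A \<in> \<pi>" "x \<in> A" for A x
    using that assms(1) by (metis UnionI atLeastAtMost_iff partition_onD1)
  show "A = B"
    using AB
  proof (cases rule: odd_even_union_cases)
    case (oo A' B')
    then obtain a' b' c' d' where p: "a' \<in> A'" "b' \<in> B'" "c' \<in> A'" "d' \<in> B'"
      "a = 2 * a' - 1" "b = 2 * b' - 1" "c = 2 * c' - 1" "d = 2 * d' - 1" using * by blast
    then have "a' < b'" "b' < c'" "c' < d'" using * by linarith+
    then have "A' = B'" using oo p by (intro noncrossingD[OF assms(2), of A' B' a' b' c' d'])
    then show ?thesis using oo by simp
  next
    case (ee A' B')
    then obtain a' b' c' d' where "a' \<in> A'" "b' \<in> B'" "c' \<in> A'" "d' \<in> B'"
      "a = 2 * a'" "b = 2 * b'" "c = 2 * c'" "d = 2 * d'" using * by blast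
    then have "A' = B'" using ee * by (intro noncrossingD[OF assms(3), of A' B' a' b' c' d']) auto
    then show ?thesis using ee by simp
  next
    case (oe A' B')
    then obtain a' b' c' d' where p: "a' \<in> A'" "b' \<in> B'" "c' \<in> A'" "d' \<in> B'"
      "a = 2 * a' - 1" "b = 2 * b'" "c = 2 * c' - 1" "d = 2 * d'" using * by blast
    have "saturated \<pi> b' d'" using sat oe p by blast
    \<comment> \<open>From \<open>2 * b' < 2 * c' - 1 < 2 * d'\<close> follows
      \<open>b' < c'\<close> and \<open>c' \<le> d'\<close>. An odd point precedes its even partner,
      which is why the intervals are open on the left and closed on the right.\<close>
    moreover have "c' \<in> left_open_interval b' d'" "a' \<notin> left_open_interval b' d'"
      using p * by (auto simp: left_open_interval_def)
    ultimately show ?thesis using oe p unfolding saturated_def by blast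
  next
    case (eo A' B')
    then obtain a' b' c' d' where p: "a' \<in> A'" "b' \<in> B'" "c' \<in> A'" "d' \<in> B'"
      "a = 2 * a'" "b = 2 * b' - 1" "c = 2 * c'" "d = 2 * d' - 1" using * by blast
    have "saturated \<pi> a' c'" using sat eo p by blast
    moreover have "b' \<in> left_open_interval a' c'" "d' \<notin> left_open_interval a' c'"
      using p * by (auto simp: left_open_interval_def)
    ultimately show ?thesis using eo p unfolding saturated_def by blast
  qed
qed

text \<open>The converse: a block of \<pi> split by the interval has a point \<open>p\<close> inside
  and a point \<open>q\<close> to the left or right of it, and in doubled positions this crosses
  \<open>C\<close>.\<close>

lemma noncrossing_imp_saturated:
  assumes "noncrossing (odd_even_union \<pi> \<rho>)" "C \<in> \<rho>" "x \<in> C" "y \<in> C"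
    and pos: "\<And>A z. A \<in> \<pi> \<Longrightarrow> z \<in> A \<Longrightarrow> z \<ge> 1"
  shows "saturated \<pi> x y"
  using assms(3,4)
proof (induction x y rule: linorder_wlog)
  case (le x y)
  show ?case
    unfolding saturated_def
  proof (intro ballI, rule ccontr)
    fix A assume A: "A \<in> \<pi>"
      "\<not> (A \<subseteq> left_open_interval x y \<or> A \<inter> left_open_interval x y = {})"
    then obtain p q where "p \<in> A" "q \<in> A" "p \<in> left_open_interval x y" "q \<notin> left_open_interval x y"
      by blast
    then have pq: "p \<in> A" "q \<in> A" "x < p" "p \<le> y" "q \<le> x \<or> y < q"
      using le by (auto simp: left_open_interval_def)
    let ?A = "(\<lambda>a. 2 * a - 1) ` A" and ?C = "(\<lambda>b. 2 * b) ` C"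
    have mem: "?A \<in> odd_even_union \<pi> \<rho>" "?C \<in> odd_even_union \<pi> \<rho>"
      using A(1) assms(2) by (auto simp: odd_even_union_def)
    have el: "2 * p - 1 \<in> ?A" "2 * q - 1 \<in> ?A" "2 * x \<in> ?C" "2 * y \<in> ?C"
      using pq le by auto
    \<comment> \<open>Excludes the truncated value \<open>2 * 0 - 1 = 0\<close>, which would be
      even.\<close>
    have q1: "q \<ge> 1" using pos A pq by auto
    have "?A = ?C"
      using pq(5)
    proof
      assume "q \<le> x"
      then show ?thesis
        using q1 pq el mem by (intro noncrossingD[OF assms(1), of _ _ "2 * q - 1" "2 * x" "2 * p - 1" "2 * y"]) auto
    next
      assume "y < q"
      then show ?thesis
        using q1 pq el mem
        by (intro noncrossingD[OF assms(1), of ?C ?A "2 * x" "2 * p - 1" "2 * y" "2 * q - 1", symmetric]) auto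
    qed
    then have "2 * q - 1 \<in> ?C" using el by simp
    then obtain z where "2 * q - 1 = 2 * z" by blast
    then show False using q1 by presburger
  qed
next
  case (sym x y)
  then show ?case using saturated_sym by blast
qed

text \<open>The interleaving of \<pi> with a non-crossing \<rho> is non-crossing exactly if the
  points of each block of \<rho> are pairwise saturated, and the classes form the largest partition
  of this kind.\<close>

theorem kreweras_eq_saturation_classes:
  assumes \<pi>: "\<pi> \<in> NC n"
  shows "kreweras n \<pi> = saturation_classes \<pi> {1..n}"
proof -
  let ?K = "saturation_classes \<pi> {1..n}"
  have part: "partition_on {1..n} \<pi>" "noncrossing \<pi>" using \<pi> by (auto simp: NC_def)
  have pos: "z \<ge> 1" if "A \<in> \<pi>" "z \<in> A" for A z
    using that part(1) by (metis UnionI atLeastAtMost_iff partition_onD1)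
  have K: "?K \<in> NC n"
    by (simp add: NC_def partition_on_saturation_classes noncrossing_saturation_classes)
  have KK: "odd_even_union \<pi> ?K \<in> NC (2 * n)"
  proof -
    have "noncrossing (odd_even_union \<pi> ?K)"
      by (rule noncrossing_odd_even_union[OF part noncrossing_saturation_classes])
        (rule saturation_classes_saturated)
    then show ?thesis
      using partition_on_odd_even_union[OF part(1) partition_on_saturation_classes]
      by (simp add: NC_def)
  qed
  have max: "part_le \<sigma> ?K" if \<sigma>: "\<sigma> \<in> NC n" "odd_even_union \<pi> \<sigma> \<in> NC (2 * n)" for \<sigma>
  proof -
    have \<sigma>p: "partition_on {1..n} \<sigma>" and nc: "noncrossing (odd_even_union \<pi> \<sigma>)"
      using \<sigma> by (auto simp: NC_def)
    have "\<exists>B\<in>?K. C \<subseteq> B" if C: "C \<in> \<sigma>" for C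
    proof -
      have sub: "C \<subseteq> {1..n}" "C \<noteq> {}"
        using C partition_onD1[OF \<sigma>p] partition_onD3[OF \<sigma>p] by auto
      then obtain x where x: "x \<in> C" by blast
      have "saturated \<pi> x y" if "y \<in> C" for y
        by (rule noncrossing_imp_saturated[OF nc C x that]) (rule pos)
      then have "C \<subseteq> {d\<in>{1..n}. saturated \<pi> x d}"
        using sub(1) by blast
      moreover have "{d\<in>{1..n}. saturated \<pi> x d} \<in> ?K"
        using x sub(1) unfolding saturation_classes_def by blast
      ultimately show ?thesis by blast
    qed
    then have "refines {1..n} \<sigma> ?K"
      using \<sigma>p partition_on_saturation_classes by (auto simp: refines_def)
    then show ?thesis
      using part_le_iff_refines[OF \<sigma>p partition_on_saturation_classes] by simp
  qed
  show ?thesis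
    unfolding kreweras_def
  proof (rule the_equality)
    fix \<rho> assume \<rho>: "\<rho> \<in> NC n \<and> odd_even_union \<pi> \<rho> \<in> NC (2 * n) \<and>
      (\<forall>\<sigma>\<in>NC n. odd_even_union \<pi> \<sigma> \<in> NC (2 * n) \<longrightarrow> part_le \<sigma> \<rho>)"
    then have p: "partition_on {1..n} \<rho>" by (simp add: NC_def)
    have "part_le \<rho> ?K" "part_le ?K \<rho>"
      using \<rho> max K KK by simp_all
    then have "refines {1..n} \<rho> ?K" "refines {1..n} ?K \<rho>"
      using part_le_iff_refines[OF p partition_on_saturation_classes]
        part_le_iff_refines[OF partition_on_saturation_classes p] by simp_all
    then show "\<rho> = ?K" by (rule refines_asym)
  qed (use K KK max in blast)
qed


section \<open>Decomposing non-crossing partitions\<close>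

definition interval_NC :: "nat \<Rightarrow> nat \<Rightarrow> nat set set set" where
  "interval_NC a b = {\<pi>. partition_on {a..b} \<pi> \<and> noncrossing \<pi>}"

definition closed_NC :: "nat \<Rightarrow> nat \<Rightarrow> nat set set set" where
  "closed_NC a b = {\<pi>\<in>interval_NC a b. \<exists>B\<in>\<pi>. a \<in> B \<and> b \<in> B}"

definition block :: "nat set set \<Rightarrow> nat \<Rightarrow> nat set" where
  "block \<pi> x = \<Union>{B\<in>\<pi>. x \<in> B}"

definition blocks_within :: "nat set set \<Rightarrow> nat set \<Rightarrow> nat set set" where
  "blocks_within \<pi> J = {B\<in>\<pi>. B \<subseteq> J}"

definition blocks_without :: "nat set set \<Rightarrow> nat set \<Rightarrow> nat \<Rightarrow> nat set set" where
  "blocks_without \<pi> J a = (\<lambda>B. B - {a}) ` {B\<in>\<pi>. \<not> B \<subseteq> J}"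

text \<open>Used with \<open>c\<close> the next element above \<open>a\<close> in its block; it
  undoes the removal of \<open>a\<close> in \<open>blocks_without\<close>.\<close>

definition insert_next :: "nat \<Rightarrow> nat \<Rightarrow> nat set \<Rightarrow> nat set" where
  "insert_next a c B = (if c \<in> B then insert a B else B)"

lemma NC_eq_interval_NC: "NC n = interval_NC 1 n"
  by (simp add: NC_def interval_NC_def)

lemma interval_NC_D:
  assumes "\<pi> \<in> interval_NC a b"
  shows "\<And>B x. B \<in> \<pi> \<Longrightarrow> x \<in> B \<Longrightarrow> a \<le> x \<and> x \<le> b"
    and "\<And>B. B \<in> \<pi> \<Longrightarrow> B \<noteq> {}"
    and "\<And>A B x. A \<in> \<pi> \<Longrightarrow> B \<in> \<pi> \<Longrightarrow> x \<in> A \<Longrightarrow> x \<in> B \<Longrightarrow> A = B"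
    and "\<And>x. a \<le> x \<Longrightarrow> x \<le> b \<Longrightarrow> \<exists>B\<in>\<pi>. x \<in> B"
    and "noncrossing \<pi>"
    and "finite \<pi>"
    and "\<And>B. B \<in> \<pi> \<Longrightarrow> finite B"
    and "\<And>B x. B \<in> \<pi> \<Longrightarrow> x \<in> B \<Longrightarrow> block \<pi> x = B"
proof -
  have p: "partition_on {a..b} \<pi>" and nc: "noncrossing \<pi>"
    using assms by (simp_all add: interval_NC_def)
  have U: "{a..b} = \<Union>\<pi>" by (rule partition_onD1[OF p])
  show 1: "a \<le> x \<and> x \<le> b" if "B \<in> \<pi>" "x \<in> B" for B x
  proof -
    have "x \<in> {a..b}" unfolding U using that by blast
    then show ?thesis by simp
  qed
  show "B \<noteq> {}" if "B \<in> \<pi>" for B using that partition_onD3[OF p] by blast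
  show 3: "A = B" if "A \<in> \<pi>" "B \<in> \<pi>" "x \<in> A" "x \<in> B" for A B x
    using disjointD[OF partition_onD2[OF p] that(1,2)] that(3,4) by blast
  show "\<exists>B\<in>\<pi>. x \<in> B" if "a \<le> x" "x \<le> b" for x
  proof -
    have "x \<in> {a..b}" using that by simp
    then show ?thesis unfolding U by blast
  qed
  show "noncrossing \<pi>" by (rule nc)
  show "finite \<pi>" using finite_elements[OF _ p] by simp
  show "finite B" if "B \<in> \<pi>" for B
    using 1[OF that] by (intro finite_subset[of B "{a..b}"]) auto
  show "block \<pi> x = B" if "B \<in> \<pi>" "x \<in> B" for B x
    using 3[OF that(1) _ that(2)] that unfolding block_def by blast
qed

lemma interval_NC_I:
  assumes "\<And>B x. B \<in> \<pi> \<Longrightarrow> x \<in> B \<Longrightarrow> a \<le> x \<and> x \<le> b"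
    and "\<And>B. B \<in> \<pi> \<Longrightarrow> B \<noteq> {}"
    and "\<And>A B x. A \<in> \<pi> \<Longrightarrow> B \<in> \<pi> \<Longrightarrow> x \<in> A \<Longrightarrow> x \<in> B \<Longrightarrow> A = B"
    and "\<And>x. a \<le> x \<Longrightarrow> x \<le> b \<Longrightarrow> \<exists>B\<in>\<pi>. x \<in> B"
    and "\<And>A B p q r s. A \<in> \<pi> \<Longrightarrow> B \<in> \<pi> \<Longrightarrow> p \<in> A \<Longrightarrow> q \<in> B \<Longrightarrow> r \<in> A \<Longrightarrow> s \<in> B \<Longrightarrow>
       p < q \<Longrightarrow> q < r \<Longrightarrow> r < s \<Longrightarrow> A = B"
  shows "\<pi> \<in> interval_NC a b"
proof -
  have "partition_on {a..b} \<pi>"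
  proof (rule partition_onI)
    show "\<Union>\<pi> = {a..b}"
    proof (intro set_eqI iffI)
      fix x assume "x \<in> \<Union>\<pi>" then show "x \<in> {a..b}" using assms(1) by auto
    next
      fix x assume "x \<in> {a..b}" then show "x \<in> \<Union>\<pi>" using assms(4)[of x] by auto
    qed
    show "disjnt A B" if "A \<in> \<pi>" "B \<in> \<pi>" "A \<noteq> B" for A B
      using assms(3)[OF that(1,2)] that(3) unfolding disjnt_iff by blast
    show "{} \<notin> \<pi>" using assms(2) by blast
  qed
  moreover have "noncrossing \<pi>"
    unfolding noncrossing_def
  proof (intro ballI allI impI, elim conjE)
    fix A B p q r s
    assume "A \<in> \<pi>" "B \<in> \<pi>" "p < q" "q < r" "r < s" "p \<in> A" "r \<in> A" "q \<in> B" "s \<in> B"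
    then show "A = B" using assms(5)[of A B p q r s] by simp
  qed
  ultimately show ?thesis by (simp add: interval_NC_def)
qed

lemma finite_interval_NC: "finite (interval_NC a b)"
  by (rule finite_subset[OF _ finitely_many_partition_on[of "{a..b}"]]) (auto simp: interval_NC_def)

lemma finite_closed_NC: "finite (closed_NC a b)"
  by (rule finite_subset[OF _ finite_interval_NC[of a b]]) (auto simp: closed_NC_def)

lemma closed_NC_D:
  assumes "\<pi> \<in> closed_NC a b"
  shows "\<pi> \<in> interval_NC a b" "\<exists>B\<in>\<pi>. a \<in> B \<and> b \<in> B" "block \<pi> a \<in> \<pi>" "a \<in> block \<pi> a" "b \<in> block \<pi> a"
proof -
  show 1: "\<pi> \<in> interval_NC a b" and 2: "\<exists>B\<in>\<pi>. a \<in> B \<and> b \<in> B"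
    using assms by (simp_all add: closed_NC_def)
  then obtain B where "B \<in> \<pi>" "a \<in> B" "b \<in> B" by blast
  moreover from this have "block \<pi> a = B" using interval_NC_D(8)[OF 1] by blast
  ultimately show "block \<pi> a \<in> \<pi>" "a \<in> block \<pi> a" "b \<in> block \<pi> a" by simp_all
qed

text \<open>Besides membership, the conclusions recover \<open>c\<close>, \<open>\<pi>1\<close> and
  \<open>\<pi>2\<close> from the union, as the reindexing of the sum requires; \<open>c\<close> is
  the maximum because \<open>\<pi>1\<close> joins \<open>a\<close> to \<open>c\<close>.\<close>

lemma interval_NC_union:
  assumes 1: "\<pi>1 \<in> closed_NC a c" and 2: "\<pi>2 \<in> interval_NC (c + 1) b" and ac: "a \<le> c" "c \<le> b"
  shows "\<pi>1 \<union> \<pi>2 \<in> interval_NC a b"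
    and "Max (block (\<pi>1 \<union> \<pi>2) a) = c"
    and "blocks_within (\<pi>1 \<union> \<pi>2) {a..c} = \<pi>1"
    and "blocks_within (\<pi>1 \<union> \<pi>2) {c+1..b} = \<pi>2"
proof -
  note I1 = closed_NC_D(1)[OF 1]
  have r1: "a \<le> x \<and> x \<le> c" if "B \<in> \<pi>1" "x \<in> B" for B x
    using interval_NC_D(1)[OF I1] that by blast
  have r2: "c + 1 \<le> x \<and> x \<le> b" if "B \<in> \<pi>2" "x \<in> B" for B x
    using interval_NC_D(1)[OF 2] that by blast
  show U: "\<pi>1 \<union> \<pi>2 \<in> interval_NC a b"
  proof (rule interval_NC_I)
    show "a \<le> x \<and> x \<le> b" if "B \<in> \<pi>1 \<union> \<pi>2" "x \<in> B" for B x
      using that r1[of B x] r2[of B x] ac by auto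
    show "B \<noteq> {}" if "B \<in> \<pi>1 \<union> \<pi>2" for B
      using that interval_NC_D(2)[OF I1] interval_NC_D(2)[OF 2] by blast
    show "A = B" if "A \<in> \<pi>1 \<union> \<pi>2" "B \<in> \<pi>1 \<union> \<pi>2" "x \<in> A" "x \<in> B" for A B x
      using that(1,2)
    proof (elim UnE)
      assume "A \<in> \<pi>1" "B \<in> \<pi>1"
      then show ?thesis by (rule interval_NC_D(3)[OF I1 _ _ that(3,4)])
    next
      assume "A \<in> \<pi>2" "B \<in> \<pi>2"
      then show ?thesis by (rule interval_NC_D(3)[OF 2 _ _ that(3,4)])
    next
      assume "A \<in> \<pi>1" "B \<in> \<pi>2"
      then show ?thesis using r1[of A x] r2[of B x] that by linarith
    next
      assume "A \<in> \<pi>2" "B \<in> \<pi>1"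
      then show ?thesis using r2[of A x] r1[of B x] that by linarith
    qed
    show "\<exists>B\<in>\<pi>1 \<union> \<pi>2. x \<in> B" if "a \<le> x" "x \<le> b" for x
      using that interval_NC_D(4)[OF I1, of x] interval_NC_D(4)[OF 2, of x] by (cases "x \<le> c") auto
    show "A = B" if "A \<in> \<pi>1 \<union> \<pi>2" "B \<in> \<pi>1 \<union> \<pi>2" "p \<in> A" "q \<in> B" "r \<in> A" "s \<in> B"
      "p < q" "q < r" "r < s" for A B p q r s
    proof -
      consider "A \<in> \<pi>1" "B \<in> \<pi>1" | "A \<in> \<pi>2" "B \<in> \<pi>2" | "A \<in> \<pi>1" "B \<in> \<pi>2" | "A \<in> \<pi>2" "B \<in> \<pi>1"
        using \<open>A \<in> \<pi>1 \<union> \<pi>2\<close> \<open>B \<in> \<pi>1 \<union> \<pi>2\<close> by (elim UnE) (rule that; assumption)+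
      then show ?thesis
      proof cases
        case 1
        show ?thesis by (rule noncrossingD[OF interval_NC_D(5)[OF I1] 1 that(3,4,5,6,7,8,9)])
      next
        case 2
        show ?thesis by (rule noncrossingD[OF interval_NC_D(5)[OF assms(2)] 2 that(3,4,5,6,7,8,9)])
      next
        case 3
        then show ?thesis using r1[of A r] r2[of B q] that by linarith
      next
        case 4
        then show ?thesis using r2[of A p] r1[of B q] that by linarith
      qed
    qed
  qed
  have B: "block \<pi>1 a \<in> \<pi>1" "a \<in> block \<pi>1 a" "c \<in> block \<pi>1 a"
    using closed_NC_D[OF 1] by simp_all
  have "block (\<pi>1 \<union> \<pi>2) a = block \<pi>1 a"
    using interval_NC_D(8)[OF U, of "block \<pi>1 a"] B by simp
  moreover have "Max (block \<pi>1 a) = c"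
    using B r1 interval_NC_D(7)[OF I1 B(1)] by (intro Max_eqI) auto
  ultimately show "Max (block (\<pi>1 \<union> \<pi>2) a) = c" by simp
  have "\<not> B \<subseteq> {a..c}" if B: "B \<in> \<pi>2" for B
  proof -
    obtain x where "x \<in> B" using interval_NC_D(2)[OF 2 B] by blast
    then show ?thesis using r2[OF B] by force
  qed
  then show "blocks_within (\<pi>1 \<union> \<pi>2) {a..c} = \<pi>1"
    using r1 unfolding blocks_within_def by force
  have "\<not> B \<subseteq> {c+1..b}" if B: "B \<in> \<pi>1" for B
  proof -
    obtain x where "x \<in> B" using interval_NC_D(2)[OF I1 B] by blast
    then show ?thesis using r1[OF B] by force
  qed
  then show "blocks_within (\<pi>1 \<union> \<pi>2) {c+1..b} = \<pi>2"
    using r2 unfolding blocks_within_def by force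
qed

lemma interval_NC_subset:
  assumes "\<pi> \<in> interval_NC a b"
    and "\<And>B x. B \<in> \<sigma> \<Longrightarrow> x \<in> B \<Longrightarrow> c \<le> x \<and> x \<le> d"
    and "\<sigma> \<subseteq> \<pi>" "\<And>x. c \<le> x \<Longrightarrow> x \<le> d \<Longrightarrow> \<exists>B\<in>\<sigma>. x \<in> B"
  shows "\<sigma> \<in> interval_NC c d"
proof (rule interval_NC_I)
  show "B \<noteq> {}" if "B \<in> \<sigma>" for B using that assms(3) interval_NC_D(2)[OF assms(1)] by blast
  show "A = B" if "A \<in> \<sigma>" "B \<in> \<sigma>" "x \<in> A" "x \<in> B" for A B x
    using that assms(3) interval_NC_D(3)[OF assms(1)] by blast
  show "A = B" if "A \<in> \<sigma>" "B \<in> \<sigma>" "p \<in> A" "q \<in> B" "r \<in> A" "s \<in> B"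
      "p < q" "q < r" "r < s" for A B p q r s
    using noncrossingD[OF interval_NC_D(5)[OF assms(1)], of A B p q r s] that assms(3) by blast
qed (use assms in blast)+

lemma interval_NC_split:
  assumes \<pi>: "\<pi> \<in> interval_NC a b" and ab: "a \<le> b"
  defines "c \<equiv> Max (block \<pi> a)"
  shows "c \<in> {a..b}"
    and "blocks_within \<pi> {a..c} \<in> closed_NC a c"
    and "blocks_within \<pi> {c+1..b} \<in> interval_NC (c + 1) b"
    and "blocks_within \<pi> {a..c} \<union> blocks_within \<pi> {c+1..b} = \<pi>"
proof -
  note D = interval_NC_D[OF \<pi>]
  obtain B0 where B0: "B0 \<in> \<pi>" "a \<in> B0" using D(4)[of a] ab by blast
  have c: "c = Max B0" unfolding c_def using D(8)[OF B0] by simp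
  have cB: "c \<in> B0" unfolding c using B0 D(7) by (intro Max_in) auto
  have le: "x \<le> c" if "x \<in> B0" for x unfolding c using that B0 D(7) by simp
  show "c \<in> {a..b}" using D(1)[OF B0(1) cB] by simp
  have dich: "B \<subseteq> {a..c} \<or> B \<subseteq> {c+1..b}" if B: "B \<in> \<pi>" for B
  proof (cases "B = B0")
    case True
    then show ?thesis using le D(1)[OF B0(1)] by auto
  next
    case False
    \<comment> \<open>Otherwise \<open>a < x < c < y\<close> with \<open>a\<close>, \<open>c\<close>
      in \<open>B0\<close> and \<open>x\<close>, \<open>y\<close> in \<open>B\<close> would be a
      crossing.\<close>
    have *: "y \<le> c" if xy: "x \<in> B" "y \<in> B" "x \<le> c" for x y
    proof (rule ccontr)
      assume y: "\<not> y \<le> c"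
      have "x \<notin> B0" using D(3)[OF B B0(1)] xy False by blast
      then have "a < x" "x < c"
        using D(1)[OF B xy(1)] xy(3) B0 cB by (auto simp: order.order_iff_strict)
      then have "B0 = B" using noncrossingD[OF D(5) B0(1) B B0(2) xy(1) cB xy(2)] y by simp
      then show False using False by simp
    qed
    show ?thesis
    proof (cases "\<exists>x\<in>B. x \<le> c")
      case True
      then obtain x where "x \<in> B" "x \<le> c" by blast
      then have "B \<subseteq> {..c}" using *[of x] by blast
      then show ?thesis using D(1)[OF B] by force
    next
      case False
      then have "B \<subseteq> {c+1..}" by force
      then show ?thesis using D(1)[OF B] by force
    qed
  qed
  then show "blocks_within \<pi> {a..c} \<union> blocks_within \<pi> {c+1..b} = \<pi>"
    unfolding blocks_within_def by blast
  show "blocks_within \<pi> {c+1..b} \<in> interval_NC (c + 1) b"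
  proof (rule interval_NC_subset[OF \<pi>])
    fix x assume x: "c + 1 \<le> x" "x \<le> b"
    then obtain B where B: "B \<in> \<pi>" "x \<in> B" using D(4)[of x] \<open>c \<in> {a..b}\<close> by auto
    then have "B \<subseteq> {c+1..b}" using dich[OF B(1)] x by auto
    then show "\<exists>B\<in>blocks_within \<pi> {c+1..b}. x \<in> B" using B by (auto simp: blocks_within_def)
  qed (auto simp: blocks_within_def)
  have "blocks_within \<pi> {a..c} \<in> interval_NC a c"
  proof (rule interval_NC_subset[OF \<pi>])
    fix x assume x: "a \<le> x" "x \<le> c"
    then obtain B where B: "B \<in> \<pi>" "x \<in> B" using D(4)[of x] \<open>c \<in> {a..b}\<close> by auto
    then have "B \<subseteq> {a..c}" using dich[OF B(1)] x by auto
    then show "\<exists>B\<in>blocks_within \<pi> {a..c}. x \<in> B" using B by (auto simp: blocks_within_def)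
  qed (auto simp: blocks_within_def)
  moreover have "B0 \<subseteq> {a..c}" using le D(1)[OF B0(1)] by auto
  then have "B0 \<in> blocks_within \<pi> {a..c}" using B0(1) by (simp add: blocks_within_def)
  ultimately show "blocks_within \<pi> {a..c} \<in> closed_NC a c"
    unfolding closed_NC_def mem_Collect_eq by (intro conjI bexI[of _ B0] B0(2) cB)
qed

text \<open>Cut after the last element \<open>c\<close> of the block of \<open>a\<close>.\<close>

lemma sum_interval_NC:
  fixes f :: "nat set set \<Rightarrow> 'b::comm_monoid_add"
  assumes "a \<le> b"
  shows "(\<Sum>\<pi>\<in>interval_NC a b. f \<pi>) =
    (\<Sum>c\<in>{a..b}. \<Sum>\<pi>1\<in>closed_NC a c. \<Sum>\<pi>2\<in>interval_NC (c + 1) b. f (\<pi>1 \<union> \<pi>2))"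
proof -
  have "(\<Sum>\<pi>\<in>interval_NC a b. f \<pi>) =
     (\<Sum>(c, \<pi>1, \<pi>2)\<in>(SIGMA c:{a..b}. closed_NC a c \<times> interval_NC (c + 1) b). f (\<pi>1 \<union> \<pi>2))"
    by (rule sum.reindex_bij_witness[where i = "\<lambda>(c, \<pi>1, \<pi>2). \<pi>1 \<union> \<pi>2" and
        j = "\<lambda>\<pi>. let c = Max (block \<pi> a) in (c, blocks_within \<pi> {a..c}, blocks_within \<pi> {c+1..b})"])
      (use interval_NC_split[OF _ assms] interval_NC_union in \<open>auto simp: Let_def\<close>)
  also have "\<dots> = (\<Sum>c\<in>{a..b}. \<Sum>(\<pi>1, \<pi>2)\<in>closed_NC a c \<times> interval_NC (c + 1) b. f (\<pi>1 \<union> \<pi>2))"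
    by (rule sum.Sigma[symmetric]) (auto simp: finite_closed_NC finite_interval_NC)
  finally show ?thesis by (simp only: sum.cartesian_product)
qed

text \<open>Adding \<open>a\<close> creates no crossing, since only blocks of \<open>\<pi>1\<close>
  lie between \<open>a\<close> and \<open>c\<close> and they stay inside that gap. The other
  conclusions again recover the data of the decomposition.\<close>

lemma closed_NC_insert:
  assumes 1: "\<pi>1 \<in> interval_NC (a + 1) (c - 1)" and 2: "\<pi>2 \<in> closed_NC c b"
    and ac: "a < c" "c \<le> b"
  defines "\<pi> \<equiv> \<pi>1 \<union> insert_next a c ` \<pi>2"
  shows "\<pi> \<in> closed_NC a b"
    and "Min (block \<pi> a - {a}) = c"
    and "blocks_within \<pi> {a+1..c-1} = \<pi>1"
    and "blocks_without \<pi> {a+1..c-1} a = \<pi>2"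
proof -
  note I2 = closed_NC_D(1)[OF 2]
  have r1: "a < x \<and> x < c" if "B \<in> \<pi>1" "x \<in> B" for B x
    using interval_NC_D(1)[OF 1 that] ac by auto
  have r2: "c \<le> x \<and> x \<le> b" if "B \<in> \<pi>2" "x \<in> B" for B x
    using interval_NC_D(1)[OF I2] that by blast
  have a2: "a \<notin> B" if "B \<in> \<pi>2" for B using r2[OF that, of a] ac by auto
  have mem: "x \<in> insert_next a c B \<longleftrightarrow> x \<in> B \<or> x = a \<and> c \<in> B" for x B
    by (auto simp: insert_next_def)
  have r2': "x = a \<or> c \<le> x" if "B \<in> \<pi>2" "x \<in> insert_next a c B" for B x
    using that r2[of B x] by (auto simp: mem)
  have I: "\<pi> \<in> interval_NC a b"
  proof (rule interval_NC_I)
    show "a \<le> x \<and> x \<le> b" if "B \<in> \<pi>" "x \<in> B" for B x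
      using that unfolding \<pi>_def
    proof (elim UnE imageE)
      assume "B \<in> \<pi>1" then show ?thesis using r1[of B x] that ac by simp
    next
      fix B' assume "B = insert_next a c B'" "B' \<in> \<pi>2"
      then show ?thesis using r2[of B' x] that ac by (auto simp: mem)
    qed
    show "B \<noteq> {}" if "B \<in> \<pi>" for B
      using that interval_NC_D(2)[OF 1] interval_NC_D(2)[OF I2]
      by (auto simp: \<pi>_def insert_next_def)
    \<comment> \<open>Covers disjointness, with all four points equal, together with the crossing
      condition, so that the case analysis is done once.\<close>
    have cross: "A = B" if "A \<in> \<pi>" "B \<in> \<pi>" "p \<in> A" "q \<in> B" "r \<in> A" "s \<in> B"
      "p \<le> q" "q \<le> r" "r \<le> s" "p = q \<or> p < q \<and> q < r \<and> r < s" for A B p q r s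
    proof -
      consider "A \<in> \<pi>1" "B \<in> \<pi>1"
        | A' B' where "A = insert_next a c A'" "B = insert_next a c B'" "A' \<in> \<pi>2" "B' \<in> \<pi>2"
        | B' where "A \<in> \<pi>1" "B = insert_next a c B'" "B' \<in> \<pi>2"
        | A' where "A = insert_next a c A'" "A' \<in> \<pi>2" "B \<in> \<pi>1"
        using \<open>A \<in> \<pi>\<close> \<open>B \<in> \<pi>\<close> unfolding \<pi>_def
        by (elim UnE imageE) (rule that; assumption)+
      then show ?thesis
      proof cases
        case AB: 1
        show ?thesis
          using that(10) noncrossingD[OF interval_NC_D(5)[OF 1] AB that(3-6)]
            interval_NC_D(3)[OF 1 AB that(3)] that(4) by auto
      next
        case AB: 2
        have pa: "a \<le> p" using r2'[of A' p] AB that ac by auto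
        show ?thesis
          using that(10)
        proof
          assume pq: "p = q"
          show ?thesis
          proof (cases "p = a")
            case True
            then have "c \<in> A'" "c \<in> B'" using that(3,4) pq a2 AB by (auto simp: mem)
            then show ?thesis using interval_NC_D(3)[OF I2 AB(3,4)] AB by blast
          next
            case False
            then have "p \<in> A'" "p \<in> B'" using that(3,4) pq AB by (auto simp: mem)
            then show ?thesis using interval_NC_D(3)[OF I2 AB(3,4)] AB by blast
          qed
        next
          assume lt: "p < q \<and> q < r \<and> r < s"
          then have el: "q \<in> B'" "r \<in> A'" "s \<in> B'" using that(4-6) AB pa by (auto simp: mem)
          have "A' = B'"
          proof (cases "p = a")
            case True
            \<comment> \<open>In a crossing that starts at the added point \<open>a\<close>, the
              point \<open>c\<close> of the original block takes its place.\<close>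
            then have c: "c \<in> A'" using that(3) a2 AB by (auto simp: mem)
            show ?thesis
            proof (cases "q = c")
              case True
              then show ?thesis using c el interval_NC_D(3)[OF I2 AB(3,4)] by blast
            next
              case False
              then have "c < q" using r2[OF AB(4) el(1)] by simp
              then show ?thesis
                using noncrossingD[OF interval_NC_D(5)[OF I2] AB(3,4) c el(1,2,3)] lt by blast
            qed
          next
            case False
            then have "p \<in> A'" using that(3) AB by (auto simp: mem)
            then show ?thesis
              using noncrossingD[OF interval_NC_D(5)[OF I2] AB(3,4) _ el(1,2,3)] lt by blast
          qed
          then show ?thesis using AB by simp
        qed
      next
        case AB: 3
        then show ?thesis using r1[of A p] r1[of A r] r2'[of B' q] that by auto
      next
        case AB: 4
        then show ?thesis using r1[of B q] r1[of B s] r2'[of A' p] r2'[of A' r] that by auto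
      qed
    qed
    show "A = B" if "A \<in> \<pi>" "B \<in> \<pi>" "x \<in> A" "x \<in> B" for A B x
      by (rule cross[OF that(1,2) that(3) that(4) that(3) that(4)]) auto
    show "A = B" if "A \<in> \<pi>" "B \<in> \<pi>" "p \<in> A" "q \<in> B" "r \<in> A" "s \<in> B"
      "p < q" "q < r" "r < s" for A B p q r s
      by (rule cross[OF that(1-6)]) (use that in auto)
    show "\<exists>B\<in>\<pi>. x \<in> B" if x: "a \<le> x" "x \<le> b" for x
    proof -
      consider "a < x" "x < c" | "c \<le> x" | "x = a" using \<open>a \<le> x\<close> by linarith
      then show ?thesis
      proof cases
        case 1
        then have "a + 1 \<le> x" "x \<le> c - 1" by simp_all
        then show ?thesis using interval_NC_D(4)[OF assms(1), of x] unfolding \<pi>_def by blast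
      next
        case 2
        then obtain B where "B \<in> \<pi>2" "x \<in> B" using interval_NC_D(4)[OF I2, of x] x by blast
        then show ?thesis unfolding \<pi>_def by (intro bexI[of _ "insert_next a c B"]) (auto simp: mem)
      next
        case 3
        then show ?thesis using closed_NC_D(3,4)[OF 2] unfolding \<pi>_def
          by (intro bexI[of _ "insert_next a c (block \<pi>2 c)"]) (auto simp: mem)
      qed
    qed
  qed
  let ?B = "block \<pi>2 c"
  have B: "?B \<in> \<pi>2" "c \<in> ?B" "b \<in> ?B" using closed_NC_D[OF 2] by simp_all
  have Ba: "insert a ?B \<in> \<pi>" using B by (auto simp: \<pi>_def insert_next_def)
  show "\<pi> \<in> closed_NC a b"
    unfolding closed_NC_def using I Ba B by blast
  have "block \<pi> a = insert a ?B" using interval_NC_D(8)[OF I Ba] by simp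
  then have "block \<pi> a - {a} = ?B" using a2[OF B(1)] by simp
  then show "Min (block \<pi> a - {a}) = c"
    using B r2[OF B(1)] interval_NC_D(7)[OF I2 B(1)] by (auto intro: Min_eqI)
  have not_sub: "\<not> insert_next a c B \<subseteq> {a+1..c-1}" if B: "B \<in> \<pi>2" for B
  proof -
    obtain x where "x \<in> B" using interval_NC_D(2)[OF I2 B] by blast
    then have "x \<in> insert_next a c B" "c \<le> x" using r2[OF B] by (auto simp: mem)
    then show ?thesis using ac by force
  qed
  have sub: "B \<subseteq> {a+1..c-1}" if "B \<in> \<pi>1" for B
    using r1[OF that] by force
  show "blocks_within \<pi> {a+1..c-1} = \<pi>1"
    unfolding \<pi>_def blocks_within_def using not_sub sub by blast
  have "{B\<in>\<pi>. \<not> B \<subseteq> {a+1..c-1}} = insert_next a c ` \<pi>2"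
    unfolding \<pi>_def using not_sub sub by blast
  moreover have "insert_next a c B - {a} = B" if "B \<in> \<pi>2" for B
    using a2[OF that] by (auto simp: insert_next_def)
  ultimately show "blocks_without \<pi> {a+1..c-1} a = \<pi>2"
    by (simp add: image_image blocks_without_def)
qed

text \<open>A block that is neither inside the gap nor the block of \<open>a\<close> has a point
  beyond \<open>c\<close>; a point below \<open>c\<close> would then make it cross the block of
  \<open>a\<close> and \<open>c\<close>.\<close>

lemma closed_NC_split:
  assumes \<pi>: "\<pi> \<in> closed_NC a b" and ab: "a < b"
  defines "c \<equiv> Min (block \<pi> a - {a})"
  shows "c \<in> {a+1..b}"
    and "blocks_within \<pi> {a+1..c-1} \<in> interval_NC (a + 1) (c - 1)"
    and "blocks_without \<pi> {a+1..c-1} a \<in> closed_NC c b"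
    and "blocks_within \<pi> {a+1..c-1} \<union>
      insert_next a c ` blocks_without \<pi> {a+1..c-1} a = \<pi>"
proof -
  note I = closed_NC_D(1)[OF \<pi>]
  note D = interval_NC_D[OF I]
  define B0 where "B0 = block \<pi> a"
  have B0: "B0 \<in> \<pi>" "a \<in> B0" "b \<in> B0" using closed_NC_D[OF \<pi>] by (simp_all add: B0_def)
  have c: "c = Min (B0 - {a})" by (simp add: c_def B0_def)
  have fin: "finite (B0 - {a})" using D(7)[OF B0(1)] by simp
  have "c \<in> B0 - {a}" unfolding c using fin B0 ab by (intro Min_in) auto
  then have cB: "c \<in> B0" "c \<noteq> a" by auto
  have ge: "c \<le> x" if "x \<in> B0" "x \<noteq> a" for x unfolding c using that fin by simp
  have ac: "a < c" using D(1)[OF B0(1) cB(1)] cB(2) by simp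
  show c_range: "c \<in> {a+1..b}" using D(1)[OF B0(1) cB(1)] ac by simp
  let ?P = "\<lambda>B. B \<subseteq> {a+1..c-1}"
  let ?Q = "(\<lambda>B. B - {a}) ` {B\<in>\<pi>. \<not> ?P B}"
  have Q: "blocks_without \<pi> {a+1..c-1} a = ?Q" by (simp only: blocks_without_def)
  have P0: "\<not> ?P B0" using B0(2) by auto
  have other: "c < x" if B: "B \<in> \<pi>" "\<not> ?P B" "B \<noteq> B0" "x \<in> B" for B x
  proof -
    have aB: "a \<notin> B" "c \<notin> B" using D(3)[OF B(1) B0(1)] B(3) B0(2) cB(1) by blast+
    obtain y where y: "y \<in> B" "y \<notin> {a+1..c-1}" using B(2) by blast
    have "a \<le> y" using D(1)[OF B(1) y(1)] by simp
    moreover have "y \<noteq> a" "y \<noteq> c" using aB y by auto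
    ultimately have "c < y" using y(2) by auto
    show ?thesis
    proof (rule ccontr)
      assume "\<not> c < x"
      moreover have "a \<le> x" using D(1)[OF B(1,4)] by simp
      moreover have "x \<noteq> a" "x \<noteq> c" using aB B(4) by auto
      ultimately have "a < x" "x < c" by auto
      then have "B0 = B" using noncrossingD[OF D(5) B0(1) B(1) B0(2) B(4) cB(1) y(1)] \<open>c < y\<close> by simp
      then show False using B(3) by simp
    qed
  qed
  have ins: "insert_next a c (B - {a}) = B" if B: "B \<in> \<pi>" "\<not> ?P B" for B
  proof (cases "B = B0")
    case True
    then show ?thesis using cB B0 by (auto simp: insert_next_def)
  next
    case False
    then have "a \<notin> B" "c \<notin> B" using other[OF B False, of c] other[OF B False, of a] ac by auto
    then show ?thesis by (auto simp: insert_next_def)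
  qed
  have "insert_next a c ` ?Q = {B\<in>\<pi>. \<not> ?P B}"
    unfolding image_image using ins by simp
  then show "blocks_within \<pi> {a+1..c-1} \<union> insert_next a c ` blocks_without \<pi> {a+1..c-1} a = \<pi>"
    unfolding Q
    by (simp only: blocks_within_def) blast
  show "blocks_within \<pi> {a+1..c-1} \<in> interval_NC (a + 1) (c - 1)"
  proof (rule interval_NC_subset[OF I])
    fix x assume x: "a + 1 \<le> x" "x \<le> c - 1"
    then have "a \<le> x" "x \<le> b" using c_range by auto
    then obtain B where B: "B \<in> \<pi>" "x \<in> B" using D(4)[of x] by blast
    have "?P B"
    proof (rule ccontr)
      assume P: "\<not> ?P B"
      have "B \<noteq> B0" using ge[of x] x B(2) ac by auto
      then show False using other[OF B(1) P _ B(2)] x by simp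
    qed
    then show "\<exists>B\<in>blocks_within \<pi> {a+1..c-1}. x \<in> B" using B by (auto simp: blocks_within_def)
  qed (auto simp: blocks_within_def)
  have range: "c \<le> x" if "B \<in> \<pi>" "\<not> ?P B" "x \<in> B" "x \<noteq> a" for B x
    using other[OF that(1,2) _ that(3)] ge[of x] that by (cases "B = B0") auto
  have "?Q \<in> interval_NC c b"
  proof (rule interval_NC_I)
    show "c \<le> x \<and> x \<le> b" if "B \<in> ?Q" "x \<in> B" for B x
      using that range D(1) by blast
    show "B \<noteq> {}" if B: "B \<in> ?Q" for B
    proof -
      obtain A where A: "A \<in> \<pi>" "\<not> ?P A" "B = A - {a}" using B by blast
      show ?thesis
      proof (cases "A = B0")
        case True
        then show ?thesis using A cB by blast
      next
        case False
        obtain x where "x \<in> A" using D(2)[OF A(1)] by blast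
        moreover have "x \<noteq> a" using other[OF A(1,2) False \<open>x \<in> A\<close>] ac by simp
        ultimately show ?thesis using A by blast
      qed
    qed
    show "A = B" if AB: "A \<in> ?Q" "B \<in> ?Q"
      "x \<in> A" "x \<in> B" for A B x
    proof -
      obtain A' B' where "A' \<in> \<pi>" "B' \<in> \<pi>" "A = A' - {a}" "B = B' - {a}" using AB(1,2) by blast
      then show ?thesis using D(3)[of A' B' x] AB by simp
    qed
    show "A = B" if AB: "A \<in> ?Q" "B \<in> ?Q"
      "p \<in> A" "q \<in> B" "r \<in> A" "s \<in> B" "p < q" "q < r" "r < s" for A B p q r s
    proof -
      obtain A' B' where "A' \<in> \<pi>" "B' \<in> \<pi>" "A = A' - {a}" "B = B' - {a}" using AB(1,2) by blast
      then show ?thesis using noncrossingD[OF D(5), of A' B' p q r s] AB by simp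
    qed
    show "\<exists>B\<in>?Q. x \<in> B" if x: "c \<le> x" "x \<le> b" for x
    proof -
      obtain B where B: "B \<in> \<pi>" "x \<in> B" using D(4)[of x] x ac by auto
      have "\<not> ?P B" using B(2) x ac by force
      then show ?thesis using B x ac by (intro bexI[of _ "B - {a}"]) auto
    qed
  qed
  then show "blocks_without \<pi> {a+1..c-1} a \<in> closed_NC c b"
    unfolding closed_NC_def Q mem_Collect_eq
  proof (intro conjI bexI[of _ "B0 - {a}"])
    show "c \<in> B0 - {a}" "b \<in> B0 - {a}" "B0 - {a} \<in> ?Q" using B0 cB P0 ab by auto
  qed
qed

text \<open>Cut at the second element \<open>c\<close> of the block of \<open>a\<close>, and remove \<open>a\<close> from that block.\<close>

lemma sum_closed_NC:
  fixes f :: "nat set set \<Rightarrow> 'b::comm_monoid_add"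
  assumes "a < b"
  shows "(\<Sum>\<pi>\<in>closed_NC a b. f \<pi>) =
    (\<Sum>c\<in>{a+1..b}. \<Sum>\<pi>1\<in>interval_NC (a + 1) (c - 1). \<Sum>\<pi>2\<in>closed_NC c b.
       f (\<pi>1 \<union> insert_next a c ` \<pi>2))"
proof -
  have "(\<Sum>\<pi>\<in>closed_NC a b. f \<pi>) =
     (\<Sum>(c, \<pi>1, \<pi>2)\<in>(SIGMA c:{a+1..b}. interval_NC (a + 1) (c - 1) \<times> closed_NC c b).
       f (\<pi>1 \<union> insert_next a c ` \<pi>2))"
    by (rule sum.reindex_bij_witness[where i = "\<lambda>(c, \<pi>1, \<pi>2). \<pi>1 \<union> insert_next a c ` \<pi>2" and
        j = "\<lambda>\<pi>. let c = Min (block \<pi> a - {a}) in (c, blocks_within \<pi> {a+1..c-1},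
               blocks_without \<pi> {a+1..c-1} a)"])
      (use closed_NC_split[OF _ assms] closed_NC_insert in \<open>auto simp: Let_def\<close>)
  also have "\<dots> = (\<Sum>c\<in>{a+1..b}. \<Sum>(\<pi>1, \<pi>2)\<in>interval_NC (a + 1) (c - 1) \<times> closed_NC c b.
       f (\<pi>1 \<union> insert_next a c ` \<pi>2))"
    by (rule sum.Sigma[symmetric]) (auto simp: finite_closed_NC finite_interval_NC)
  finally show ?thesis by (simp only: sum.cartesian_product)
qed


section \<open>Saturation classes of a decomposition\<close>

lemma saturation_classes_cong:
  "(\<And>d e. d \<in> S \<Longrightarrow> e \<in> S \<Longrightarrow> saturated \<pi> d e = saturated \<sigma> d e) \<Longrightarrow>
     saturation_classes \<pi> S = saturation_classes \<sigma> S"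
  unfolding saturation_classes_def by (intro image_cong refl) auto

lemma saturation_classes_Un:
  assumes "\<And>d e. d \<in> S \<Longrightarrow> e \<in> T \<Longrightarrow> \<not> saturated \<pi> d e"
  shows "saturation_classes \<pi> (S \<union> T) = saturation_classes \<pi> S \<union> saturation_classes \<pi> T"
proof -
  have "{e\<in>S \<union> T. saturated \<pi> d e} = {e\<in>S. saturated \<pi> d e}" if "d \<in> S" for d
    using assms[OF that] by blast
  moreover have "{e\<in>S \<union> T. saturated \<pi> d e} = {e\<in>T. saturated \<pi> d e}" if "d \<in> T" for d
    using assms[OF _ that] saturated_sym by blast
  ultimately show ?thesis
    unfolding saturation_classes_def image_Un by (intro arg_cong2[of _ _ _ _ "(\<union>)"] image_cong refl)
qed

lemma saturation_classes_insert:
  assumes "c \<in> T" "a \<notin> T"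
    and eq: "\<And>d e. d \<in> T \<Longrightarrow> e \<in> T \<Longrightarrow> saturated \<pi> d e = saturated \<sigma> d e"
    and a: "\<And>e. e \<in> T \<Longrightarrow> saturated \<pi> a e = saturated \<sigma> c e"
  shows "saturation_classes \<pi> (insert a T) = insert_next a c ` saturation_classes \<sigma> T"
proof -
  have d: "{e\<in>insert a T. saturated \<pi> d e} = insert_next a c {e\<in>T. saturated \<sigma> d e}"
    if "d \<in> T" for d
    using that assms(1) eq[OF that] a[OF that] saturated_commute[of \<pi> a d]
      saturated_commute[of \<sigma> c d] by (auto simp: insert_next_def)
  have "{e\<in>insert a T. saturated \<pi> a e} = insert_next a c {e\<in>T. saturated \<sigma> c e}"
    using assms(1) a by (auto simp: insert_next_def)
  then show ?thesis
    using assms(1) d unfolding saturation_classes_def image_image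
    by (simp add: insert_absorb image_iff cong: image_cong) blast
qed

lemma saturated_Un:
  "saturated (\<pi> \<union> \<sigma>) d e \<longleftrightarrow> saturated \<pi> d e \<and> saturated \<sigma> d e"
  by (auto simp: saturated_def)

lemma saturated_disjoint:
  "(\<And>B x. B \<in> \<pi> \<Longrightarrow> x \<in> B \<Longrightarrow> x \<notin> left_open_interval d e) \<Longrightarrow> saturated \<pi> d e"
  by (auto simp: saturated_def)

lemma not_saturated:
  "B \<in> \<pi> \<Longrightarrow> x \<in> B \<Longrightarrow> y \<in> B \<Longrightarrow> x \<in> left_open_interval d e \<Longrightarrow> y \<notin> left_open_interval d e \<Longrightarrow>
     \<not> saturated \<pi> d e"
  by (auto simp: saturated_def)

lemma mem_left_open_interval:
  "d \<le> e \<Longrightarrow> x \<in> left_open_interval d e \<longleftrightarrow> d < x \<and> x \<le> e"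
  "e \<le> d \<Longrightarrow> x \<in> left_open_interval d e \<longleftrightarrow> e < x \<and> x \<le> d"
  by (auto simp: left_open_interval_def)

text \<open>Some block of \<open>\<pi>1\<close> contains both \<open>l\<close> and \<open>c\<close>,
  and an interval separating these two points splits it; so nothing below \<open>c\<close> in the
  range is equivalent to anything from \<open>c\<close> on. The interval from
  \<open>a = l - 1\<close> to a point \<open>e \<ge> c\<close> contains all of
  \<open>\<pi>1\<close>, hence \<open>a\<close> behaves like \<open>c\<close>.\<close>

lemma saturation_classes_union_aux:
  assumes 1: "\<pi>1 \<in> closed_NC l c" and 2: "\<pi>2 \<in> interval_NC (c + 1) b" and c: "l \<le> c" "c \<le> b"
  shows "d \<in> {l..<c} \<Longrightarrow> e \<in> {l..<c} \<Longrightarrow> saturated (\<pi>1 \<union> \<pi>2) d e = saturated \<pi>1 d e"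
    and "d \<in> {c..b} \<Longrightarrow> e \<in> {c..b} \<Longrightarrow> saturated (\<pi>1 \<union> \<pi>2) d e = saturated \<pi>2 d e"
    and "d \<in> {l..<c} \<Longrightarrow> e \<in> {c..b} \<Longrightarrow> \<not> saturated (\<pi>1 \<union> \<pi>2) d e"
    and "a + 1 = l \<Longrightarrow> e \<in> {c..b} \<Longrightarrow> saturated (\<pi>1 \<union> \<pi>2) a e = saturated \<pi>2 c e"
    and "a + 1 = l \<Longrightarrow> e \<in> {l..<c} \<Longrightarrow> \<not> saturated (\<pi>1 \<union> \<pi>2) e a"
proof -
  have r1: "l \<le> x \<and> x \<le> c" if "B \<in> \<pi>1" "x \<in> B" for B x
    using interval_NC_D(1)[OF closed_NC_D(1)[OF 1]] that by blast
  have r2: "c < x \<and> x \<le> b" if "B \<in> \<pi>2" "x \<in> B" for B x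
    using interval_NC_D(1)[OF 2 that] by simp
  obtain B0 where B0: "B0 \<in> \<pi>1" "l \<in> B0" "c \<in> B0" using closed_NC_D(2)[OF 1] by blast
  show "saturated (\<pi>1 \<union> \<pi>2) d e = saturated \<pi>1 d e" if "d \<in> {l..<c}" "e \<in> {l..<c}"
  proof -
    have "saturated \<pi>2 d e"
    proof (rule saturated_disjoint)
      fix B x assume "B \<in> \<pi>2" "x \<in> B"
      then show "x \<notin> left_open_interval d e"
        using r2[of B x] that by (auto simp: left_open_interval_def)
    qed
    then show ?thesis by (simp add: saturated_Un)
  qed
  show "saturated (\<pi>1 \<union> \<pi>2) d e = saturated \<pi>2 d e" if "d \<in> {c..b}" "e \<in> {c..b}"
  proof -
    have "saturated \<pi>1 d e"
    proof (rule saturated_disjoint)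
      fix B x assume "B \<in> \<pi>1" "x \<in> B"
      then show "x \<notin> left_open_interval d e"
        using r1[of B x] that by (auto simp: left_open_interval_def)
    qed
    then show ?thesis by (simp add: saturated_Un)
  qed
  show "\<not> saturated (\<pi>1 \<union> \<pi>2) d e" if "d \<in> {l..<c}" "e \<in> {c..b}"
    by (rule not_saturated[of B0 _ c l]) (use B0 that in \<open>auto simp: mem_left_open_interval\<close>)
  show "saturated (\<pi>1 \<union> \<pi>2) a e = saturated \<pi>2 c e" if "a + 1 = l" "e \<in> {c..b}"
  proof -
    have "B \<subseteq> left_open_interval a e" if "B \<in> \<pi>1" for B
      using r1[OF that] \<open>a + 1 = l\<close> \<open>e \<in> _\<close> c by (fastforce simp: mem_left_open_interval)
    then have "saturated \<pi>1 a e" by (simp add: saturated_def)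
    moreover have "x \<in> left_open_interval a e \<longleftrightarrow> x \<in> left_open_interval c e"
      if "B \<in> \<pi>2" "x \<in> B" for B x
      using r2[OF that] \<open>a + 1 = l\<close> \<open>e \<in> _\<close> c by (auto simp: mem_left_open_interval)
    then have "saturated \<pi>2 a e = saturated \<pi>2 c e"
      unfolding saturated_def by (intro ball_cong refl) blast
    ultimately show ?thesis by (simp add: saturated_Un)
  qed
  show "\<not> saturated (\<pi>1 \<union> \<pi>2) e a" if "a + 1 = l" "e \<in> {l..<c}"
    by (rule not_saturated[of B0 _ l c]) (use B0 that in \<open>auto simp: mem_left_open_interval\<close>)
qed

text \<open>The first equation serves the full range of points; the second serves
  \<open>inner_sum\<close>, whose complement has the additional point \<open>a\<close> in
  front.\<close>

lemma saturation_classes_union: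
  assumes 1: "\<pi>1 \<in> closed_NC l c" and 2: "\<pi>2 \<in> interval_NC (c + 1) b" and c: "l \<le> c" "c \<le> b"
  shows "saturation_classes (\<pi>1 \<union> \<pi>2) {l..b} =
      saturation_classes \<pi>1 {l..<c} \<union> saturation_classes \<pi>2 {c..b}"
    and "a + 1 = l \<Longrightarrow> saturation_classes (\<pi>1 \<union> \<pi>2) {a..b} =
      saturation_classes \<pi>1 {l..<c} \<union> insert_next a c ` saturation_classes \<pi>2 {c..b}"
proof -
  note aux = saturation_classes_union_aux[OF 1 2 c]
  have left: "saturation_classes (\<pi>1 \<union> \<pi>2) {l..<c} = saturation_classes \<pi>1 {l..<c}"
    by (rule saturation_classes_cong) (rule aux(1))
  have "{l..b} = {l..<c} \<union> {c..b}" using c by auto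
  then show "saturation_classes (\<pi>1 \<union> \<pi>2) {l..b} =
      saturation_classes \<pi>1 {l..<c} \<union> saturation_classes \<pi>2 {c..b}"
    using saturation_classes_Un[of "{l..<c}" "{c..b}", OF aux(3)] left
      saturation_classes_cong[of "{c..b}", OF aux(2)] by simp
  assume a: "a + 1 = l"
  have "{a..b} = {l..<c} \<union> insert a {c..b}" using c a by auto
  moreover have "saturation_classes (\<pi>1 \<union> \<pi>2) ({l..<c} \<union> insert a {c..b}) =
    saturation_classes (\<pi>1 \<union> \<pi>2) {l..<c} \<union> saturation_classes (\<pi>1 \<union> \<pi>2) (insert a {c..b})"
    using aux(3) aux(5)[OF a] by (intro saturation_classes_Un) auto
  moreover have "saturation_classes (\<pi>1 \<union> \<pi>2) (insert a {c..b}) =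
    insert_next a c ` saturation_classes \<pi>2 {c..b}"
    using aux(2) aux(4)[OF a] a c by (intro saturation_classes_insert) auto
  ultimately show "saturation_classes (\<pi>1 \<union> \<pi>2) {a..b} =
      saturation_classes \<pi>1 {l..<c} \<union> insert_next a c ` saturation_classes \<pi>2 {c..b}"
    using left by simp
qed

text \<open>The complement separates at \<open>c\<close>: an interval from below \<open>c\<close> to
  a point in \<open>{c..<b}\<close> contains \<open>c\<close> but not \<open>b\<close>, so it splits
  the block through \<open>a\<close>, \<open>c\<close> and \<open>b\<close>.\<close>

lemma saturation_classes_insert_next:
  assumes 1: "\<pi>1 \<in> interval_NC (a + 1) (c - 1)" and 2: "\<pi>2 \<in> closed_NC c b" and c: "a < c" "c \<le> b"
  shows "saturation_classes (\<pi>1 \<union> insert_next a c ` \<pi>2) {a..<b} =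
      saturation_classes \<pi>1 {a..<c} \<union> saturation_classes \<pi>2 {c..<b}"
proof -
  let ?\<pi> = "\<pi>1 \<union> insert_next a c ` \<pi>2"
  have r1: "a < x \<and> x < c" if "B \<in> \<pi>1" "x \<in> B" for B x
    using interval_NC_D(1)[OF 1 that] c by auto
  have r2: "c \<le> x \<and> x \<le> b" if "B \<in> \<pi>2" "x \<in> B" for B x
    using interval_NC_D(1)[OF closed_NC_D(1)[OF 2]] that by blast
  obtain B0 where B0: "B0 \<in> \<pi>2" "c \<in> B0" "b \<in> B0" using closed_NC_D(2)[OF 2] by blast
  have ins: "insert a B0 \<in> insert_next a c ` \<pi>2" using B0 by (auto simp: insert_next_def)
  have left: "saturated ?\<pi> d e = saturated \<pi>1 d e" if "d \<in> {a..<c}" "e \<in> {a..<c}" for d e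
  proof -
    have "saturated (insert_next a c ` \<pi>2) d e"
    proof (rule saturated_disjoint, elim imageE)
      fix B x A assume "x \<in> B" "B = insert_next a c A" "A \<in> \<pi>2"
      then show "x \<notin> left_open_interval d e"
        using r2[of A x] that by (auto simp: left_open_interval_def insert_next_def split: if_splits)
    qed
    then show ?thesis by (simp add: saturated_Un)
  qed
  have right: "saturated ?\<pi> d e = saturated \<pi>2 d e" if "d \<in> {c..<b}" "e \<in> {c..<b}" for d e
  proof -
    have "saturated \<pi>1 d e"
    proof (rule saturated_disjoint)
      fix B x assume "B \<in> \<pi>1" "x \<in> B"
      then show "x \<notin> left_open_interval d e"
        using r1[of B x] that by (auto simp: left_open_interval_def)
    qed
    \<comment> \<open>The only block changed by the insertion contains \<open>c\<close>, which is
      outside the interval as well, so neither the old nor the new block is contained in it.\<close>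
    moreover have "a \<notin> left_open_interval d e" "c \<notin> left_open_interval d e"
      using that c by (auto simp: left_open_interval_def)
    then have "saturated (insert_next a c ` \<pi>2) d e = saturated \<pi>2 d e"
      unfolding saturated_def ball_simps by (intro ball_cong refl) (auto simp: insert_next_def)
    ultimately show ?thesis by (simp add: saturated_Un)
  qed
  have cross: "\<not> saturated ?\<pi> d e" if "d \<in> {a..<c}" "e \<in> {c..<b}" for d e
    by (rule not_saturated[of "insert a B0" _ c b])
      (use B0 ins that in \<open>auto simp: mem_left_open_interval\<close>)
  have "{a..<b} = {a..<c} \<union> {c..<b}" using c by auto
  then show ?thesis
    using saturation_classes_Un[of "{a..<c}" "{c..<b}", OF cross]
      saturation_classes_cong[of "{a..<c}", OF left] saturation_classes_cong[of "{c..<b}", OF right]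
    by simp
qed


section \<open>Boxed convolution as a sum over chains\<close>

text \<open>The block containing \<open>s\<close> is read with the prefix \<open>p\<close> prepended; this is what allows blocks
  to be built up one element at a time.\<close>

definition block_product ::
    "('k list \<Rightarrow> complex) \<Rightarrow> 'k list \<Rightarrow> 'k list \<Rightarrow> nat \<Rightarrow> nat set set \<Rightarrow> complex" where
  "block_product h w p s \<pi> = (\<Prod>B\<in>\<pi>. h ((if s \<in> B then p else []) @ subword w B))"

lemma block_product_Un:
  assumes "finite \<pi>" "finite \<sigma>" "\<And>B. B \<in> \<pi> \<Longrightarrow> B \<subseteq> S" "\<And>B. B \<in> \<sigma> \<Longrightarrow> B \<subseteq> T"
    "{} \<notin> \<pi>" "S \<inter> T = {}"
  shows "block_product h w p s (\<pi> \<union> \<sigma>) = block_product h w p s \<pi> * block_product h w p s \<sigma>"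
proof -
  have "\<pi> \<inter> \<sigma> = {}"
  proof (rule ccontr)
    assume "\<pi> \<inter> \<sigma> \<noteq> {}"
    then obtain B where B: "B \<in> \<pi>" "B \<in> \<sigma>" by blast
    then have "B \<subseteq> S \<inter> T" using assms(3,4) by blast
    then show False using B assms(5,6) by auto
  qed
  then show ?thesis
    unfolding block_product_def using assms by (intro prod.union_disjoint)
qed

lemma block_product_no_prefix: "block_product h w [] s \<pi> = block_product h w [] t \<pi>"
  by (simp add: block_product_def)

lemma block_product_not_mem:
  "(\<And>B. B \<in> \<pi> \<Longrightarrow> s \<notin> B) \<Longrightarrow> block_product h w p s \<pi> = block_product h w [] t \<pi>"
  unfolding block_product_def by (intro prod.cong refl) auto

lemma subword_insert:
  assumes "finite B" "\<And>x. x \<in> B \<Longrightarrow> a < x"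
  shows "subword w (insert a B) = w ! (a - 1) # subword w B"
proof -
  have "sorted_list_of_set (insert a B) = insort a (sorted_list_of_set B)"
    using assms by (intro sorted_list_of_set_insert) auto
  also have "\<dots> = a # sorted_list_of_set B"
    using assms by (intro insort_is_Cons) (auto intro: less_imp_le)
  finally show ?thesis by (simp add: subword_def)
qed

text \<open>As the smallest element of its block, \<open>a\<close> is read first; its letter can be
  moved to the end of the prefix while the marked point passes from \<open>a\<close> to
  \<open>c\<close>.\<close>

lemma block_product_insert_next:
  assumes "\<And>B. B \<in> \<pi> \<Longrightarrow> finite B" "\<And>B x. B \<in> \<pi> \<Longrightarrow> x \<in> B \<Longrightarrow> a < x"
  shows "block_product h w p a (insert_next a c ` \<pi>) = block_product h w (p @ [w ! (a - 1)]) c \<pi>"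
proof -
  have a: "a \<notin> B" if "B \<in> \<pi>" for B using assms(2)[OF that, of a] by auto
  have inj: "inj_on (insert_next a c) \<pi>"
  proof (rule inj_onI)
    fix A B assume AB: "A \<in> \<pi>" "B \<in> \<pi>" "insert_next a c A = insert_next a c B"
    have "insert_next a c A - {a} = A" "insert_next a c B - {a} = B"
      using a AB(1,2) by (auto simp: insert_next_def)
    then show "A = B" using AB(3) by metis
  qed
  have eq: "(if a \<in> insert_next a c B then p else []) @ subword w (insert_next a c B) =
      (if c \<in> B then p @ [w ! (a - 1)] else []) @ subword w B" if "B \<in> \<pi>" for B
    using a[OF that] subword_insert[OF assms(1)[OF that] assms(2)[OF that], of w]
    by (simp add: insert_next_def)
  show ?thesis
    unfolding block_product_def prod.reindex[OF inj] comp_def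
    by (intro prod.cong refl arg_cong[of _ _ h] eq)
qed

lemma finite_saturation_classes: "finite S \<Longrightarrow> finite (saturation_classes \<pi> S)"
  by (simp add: saturation_classes_def)

lemma saturation_classes_finite_block:
  "finite S \<Longrightarrow> B \<in> saturation_classes \<pi> S \<Longrightarrow> finite B"
  by (rule finite_subset[OF saturation_classes_subset])

text \<open>Between the \<open>Inl\<close> letters of \<open>a\<close> and \<open>b\<close> lie the
  \<open>Inr\<close> letters of \<open>{a..<b}\<close>, which is why the complement omits
  \<open>b\<close>. The mark 0 has no effect with an empty prefix.\<close>

definition outer_sum ::
    "(bool \<Rightarrow> 'k list \<Rightarrow> complex) \<Rightarrow> 'k list \<Rightarrow> 'k list \<Rightarrow> nat \<Rightarrow> nat \<Rightarrow> complex" where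
  "outer_sum e w p a b = (\<Sum>\<pi>\<in>closed_NC a b. block_product (e True) w p a \<pi> *
     block_product (e False) w [] 0 (saturation_classes \<pi> {a..<b}))"

text \<open>Between the \<open>Inr\<close> letters of \<open>a\<close> and \<open>b\<close> lie the
  \<open>Inl\<close> letters of \<open>{a+1..b}\<close>; here the prefix belongs to the complement
  class of \<open>a\<close>.\<close>

definition inner_sum ::
    "(bool \<Rightarrow> 'k list \<Rightarrow> complex) \<Rightarrow> 'k list \<Rightarrow> 'k list \<Rightarrow> nat \<Rightarrow> nat \<Rightarrow> complex" where
  "inner_sum e w p a b = (\<Sum>\<pi>\<in>interval_NC (a + 1) b. block_product (e True) w [] 0 \<pi> *
     block_product (e False) w p a (saturation_classes \<pi> {a..b}))"

section \<open>Recursions for the sums over partitions\<close>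

lemma block_product_interval_union:
  assumes 1: "\<pi>1 \<in> closed_NC l c" and 2: "\<pi>2 \<in> interval_NC (c + 1) b"
  shows "block_product h w [] t (\<pi>1 \<union> \<pi>2) = block_product h w [] l \<pi>1 * block_product h w [] t \<pi>2"
proof -
  note D1 = interval_NC_D[OF closed_NC_D(1)[OF 1]] and D2 = interval_NC_D[OF 2]
  have "block_product h w [] t (\<pi>1 \<union> \<pi>2) = block_product h w [] t \<pi>1 * block_product h w [] t \<pi>2"
  proof (rule block_product_Un[where S = "{l..c}" and T = "{c+1..b}"])
    show "B \<subseteq> {l..c}" if "B \<in> \<pi>1" for B using D1(1)[OF that] by auto
    show "B \<subseteq> {c+1..b}" if "B \<in> \<pi>2" for B using D2(1)[OF that] by auto
    show "{} \<notin> \<pi>1" using D1(2) by blast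
  qed (use D1(6) D2(6) in auto)
  then show ?thesis using block_product_no_prefix by metis
qed

text \<open>The last element \<open>c\<close> of the block of \<open>a + 1\<close> is at the same
  time the element following \<open>a\<close> in its complement class, so cutting the partition
  there also shortens that class by \<open>a\<close>.\<close>

lemma inner_sum_rec:
  assumes "a < b"
  shows "inner_sum e w p a b =
    (\<Sum>c\<in>{a+1..b}. outer_sum e w [] (a + 1) c * inner_sum e w (p @ [w ! (a - 1)]) c b)"
proof -
  have "block_product (e True) w [] 0 (\<pi>1 \<union> \<pi>2) *
       block_product (e False) w p a (saturation_classes (\<pi>1 \<union> \<pi>2) {a..b}) =
     (block_product (e True) w [] (a + 1) \<pi>1 *
       block_product (e False) w [] 0 (saturation_classes \<pi>1 {a+1..<c})) *
     (block_product (e True) w [] 0 \<pi>2 *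
       block_product (e False) w (p @ [w ! (a - 1)]) c (saturation_classes \<pi>2 {c..b}))"
    if c: "c \<in> {a+1..b}" and 1: "\<pi>1 \<in> closed_NC (a + 1) c" and 2: "\<pi>2 \<in> interval_NC (c + 1) b"
    for c \<pi>1 \<pi>2
  proof -
    let ?K1 = "saturation_classes \<pi>1 {a+1..<c}" and ?K2 = "saturation_classes \<pi>2 {c..b}"
    have ins: "insert_next a c B \<subseteq> insert a {c..b}" if "B \<in> ?K2" for B
      using saturation_classes_subset[OF that] by (auto simp: insert_next_def split: if_splits)
    have "block_product (e False) w p a (?K1 \<union> insert_next a c ` ?K2) =
      block_product (e False) w p a ?K1 * block_product (e False) w p a (insert_next a c ` ?K2)"
    proof (rule block_product_Un[where S = "{a+1..<c}" and T = "insert a {c..b}"])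
      show "B \<subseteq> {a+1..<c}" if "B \<in> ?K1" for B using saturation_classes_subset[OF that] .
      show "B \<subseteq> insert a {c..b}" if "B \<in> insert_next a c ` ?K2" for B using that ins by blast
      show "{} \<notin> ?K1" using saturation_classes_nonempty by blast
    qed (auto simp: finite_saturation_classes)
    also have "block_product (e False) w p a ?K1 = block_product (e False) w [] 0 ?K1"
    proof (rule block_product_not_mem)
      show "a \<notin> B" if "B \<in> ?K1" for B using saturation_classes_subset[OF that] by auto
    qed
    also have "block_product (e False) w p a (insert_next a c ` ?K2) =
      block_product (e False) w (p @ [w ! (a - 1)]) c ?K2"
    proof (rule block_product_insert_next)
      show "finite B" if "B \<in> ?K2" for B using saturation_classes_finite_block[OF _ that] by simp
      show "a < x" if "B \<in> ?K2" "x \<in> B" for B x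
        using saturation_classes_subset[OF that(1)] that(2) c by auto
    qed
    finally show ?thesis
      using saturation_classes_union(2)[OF 1 2 _ _ refl] c block_product_interval_union[OF 1 2, of "e True" w 0]
      by (simp add: mult_ac)
  qed
  then show ?thesis
    using assms unfolding inner_sum_def outer_sum_def
    by (subst sum_interval_NC) (simp_all add: sum_product)
qed

text \<open>Here \<open>c\<close> is the second element of the block of \<open>a\<close>. The
  partition inside the gap and the complement points \<open>{a..c-1}\<close> form an inner sum; the
  rest is an outer sum whose prefix has absorbed the letter of \<open>a\<close>.\<close>

lemma outer_sum_rec:
  assumes "a < b"
  shows "outer_sum e w p a b =
    (\<Sum>c\<in>{a+1..b}. inner_sum e w [] a (c - 1) * outer_sum e w (p @ [w ! (a - 1)]) c b)"
proof -
  have "block_product (e True) w p a (\<pi>1 \<union> insert_next a c ` \<pi>2) *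
       block_product (e False) w [] 0 (saturation_classes (\<pi>1 \<union> insert_next a c ` \<pi>2) {a..<b}) =
     (block_product (e True) w [] 0 \<pi>1 *
       block_product (e False) w [] a (saturation_classes \<pi>1 {a..c-1})) *
     (block_product (e True) w (p @ [w ! (a - 1)]) c \<pi>2 *
       block_product (e False) w [] 0 (saturation_classes \<pi>2 {c..<b}))"
    if c: "c \<in> {a+1..b}" and 1: "\<pi>1 \<in> interval_NC (a + 1) (c - 1)" and 2: "\<pi>2 \<in> closed_NC c b"
    for c \<pi>1 \<pi>2
  proof -
    note D1 = interval_NC_D[OF 1] and D2 = interval_NC_D[OF closed_NC_D(1)[OF 2]]
    let ?K1 = "saturation_classes \<pi>1 {a..<c}" and ?K2 = "saturation_classes \<pi>2 {c..<b}"
    have "block_product (e False) w [] 0 (?K1 \<union> ?K2) =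
      block_product (e False) w [] 0 ?K1 * block_product (e False) w [] 0 ?K2"
    proof (rule block_product_Un[where S = "{a..<c}" and T = "{c..<b}"])
      show "B \<subseteq> {a..<c}" if "B \<in> ?K1" for B using saturation_classes_subset[OF that] .
      show "B \<subseteq> {c..<b}" if "B \<in> ?K2" for B using saturation_classes_subset[OF that] .
      show "{} \<notin> ?K1" using saturation_classes_nonempty by blast
    qed (auto simp: finite_saturation_classes)
    moreover have "block_product (e False) w [] 0 ?K1 = block_product (e False) w [] a ?K1"
      by (rule block_product_no_prefix)
    moreover have "{a..<c} = {a..c-1}" using c by auto
    moreover have "block_product (e True) w p a (\<pi>1 \<union> insert_next a c ` \<pi>2) =
      block_product (e True) w p a \<pi>1 * block_product (e True) w p a (insert_next a c ` \<pi>2)"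
    proof (rule block_product_Un[where S = "{a+1..c-1}" and T = "insert a {c..b}"])
      show "B \<subseteq> {a+1..c-1}" if "B \<in> \<pi>1" for B using D1(1)[OF that] by auto
      show "B \<subseteq> insert a {c..b}" if "B \<in> insert_next a c ` \<pi>2" for B
        using that D2(1) by (fastforce simp: insert_next_def split: if_splits)
      show "{} \<notin> \<pi>1" using D1(2) by blast
    qed (use D1(6) D2(6) c in auto)
    moreover have "block_product (e True) w p a \<pi>1 = block_product (e True) w [] 0 \<pi>1"
    proof (rule block_product_not_mem)
      show "a \<notin> B" if "B \<in> \<pi>1" for B using D1(1)[OF that, of a] by auto
    qed
    moreover have "block_product (e True) w p a (insert_next a c ` \<pi>2) =
      block_product (e True) w (p @ [w ! (a - 1)]) c \<pi>2"
    proof (rule block_product_insert_next)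
      show "finite B" if "B \<in> \<pi>2" for B by (rule D2(7)[OF that])
      show "a < x" if "B \<in> \<pi>2" "x \<in> B" for B x using D2(1)[OF that] c by auto
    qed
    ultimately show ?thesis
      using saturation_classes_insert_next[OF 1 2] c by (simp add: mult_ac)
  qed
  moreover have "a + 1 \<le> c \<Longrightarrow> Suc (c - 1) = c" for c by simp
  ultimately show ?thesis
    using assms unfolding inner_sum_def outer_sum_def
    by (subst sum_closed_NC) (simp_all add: sum_product)
qed

lemma outer_sum_refl: "outer_sum e w p a a = e True (p @ [w ! (a - 1)])"
proof -
  have "closed_NC a a = {{{a}}}"
  proof (intro set_eqI iffI)
    fix \<pi> assume "\<pi> \<in> closed_NC a a"
    then have "partition_on {a} \<pi>" by (simp add: closed_NC_def interval_NC_def)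
    then have U: "\<Union>\<pi> = {a}" "{} \<notin> \<pi>" by (simp_all add: partition_on_def)
    then have "B = {a}" if "B \<in> \<pi>" for B
      using that by (metis Union_upper subset_singletonD)
    moreover have "\<pi> \<noteq> {}" using U(1) by auto
    ultimately show "\<pi> \<in> {{{a}}}" by auto
  next
    fix \<pi> assume "\<pi> \<in> {{{a}}}"
    then show "\<pi> \<in> closed_NC a a"
      by (auto simp: closed_NC_def interval_NC_def partition_on_def noncrossing_def)
  qed
  then show ?thesis
    by (simp add: outer_sum_def block_product_def saturation_classes_def subword_def)
qed

lemma inner_sum_refl: "inner_sum e w p a a = e False (p @ [w ! (a - 1)])"
proof -
  have "interval_NC (a + 1) a = {{}}"
    by (auto simp: interval_NC_def partition_on_empty noncrossing_def)
  moreover have "{d. d = a \<and> saturated {} a d} = {a}" by auto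
  ultimately show ?thesis
    by (simp add: inner_sum_def block_product_def saturation_classes_def subword_def)
qed

text \<open>Both sides have the same initial values and the same recursions. Outer and inner case
  call each other on shorter ranges with other prefixes, hence the joint induction on
  \<open>b - a\<close>.\<close>

lemma chain_eq_sum:
  assumes "1 \<le> a" "a \<le> b"
  shows "outer_chain e w p a b = outer_sum e w p a b"
    and "inner_chain e w p a b = inner_sum e w p a b"
proof -
  have "outer_chain e w p a b = outer_sum e w p a b \<and> inner_chain e w p a b = inner_sum e w p a b"
    using assms
  proof (induction "b - a" arbitrary: a b p rule: less_induct)
    case less
    show ?case
    proof (cases "a = b")
      case True
      then show ?thesis
        using less.prems
        by (simp add: outer_chain_rec inner_chain_rec outer_sum_refl inner_sum_refl)
    next
      case False
      then have "a < b" using less.prems by simp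
      then have "outer_chain e w p a b = outer_sum e w p a b"
        using less False by (subst outer_chain_rec) (auto simp: outer_sum_rec intro!: sum.cong)
      moreover have "inner_chain e w p a b = inner_sum e w p a b"
        using \<open>a < b\<close> less False by (subst inner_chain_rec) (auto simp: inner_sum_rec intro!: sum.cong)
      ultimately show ?thesis by simp
    qed
  qed
  then show "outer_chain e w p a b = outer_sum e w p a b"
    "inner_chain e w p a b = inner_sum e w p a b" by simp_all
qed

lemma nccoeff_part_eq_block_product: "nccoeff_part f w \<pi> = block_product (nccoeff f) w [] 0 \<pi>"
  by (simp add: nccoeff_part_def block_product_def)

text \<open>The last element of the block of 1 is also the first element of the complement class of
  \<open>length w\<close>; it is the meeting point \<open>j\<close> in
  \<open>chain_product\<close>.\<close>

lemma sum_NC_eq_chain_product: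
  assumes "w \<noteq> []"
  shows "(\<Sum>\<pi>\<in>NC (length w). block_product (e True) w [] 0 \<pi> *
      block_product (e False) w [] 0 (kreweras (length w) \<pi>)) = chain_product e w"
proof -
  let ?n = "length w"
  have n: "1 \<le> ?n" using assms by (cases w) auto
  have "block_product (e True) w [] 0 (\<pi>1 \<union> \<pi>2) *
       block_product (e False) w [] 0 (saturation_classes (\<pi>1 \<union> \<pi>2) {1..?n}) =
     (block_product (e True) w [] 1 \<pi>1 *
       block_product (e False) w [] 0 (saturation_classes \<pi>1 {1..<c})) *
     (block_product (e True) w [] 0 \<pi>2 *
       block_product (e False) w [] c (saturation_classes \<pi>2 {c..?n}))"
    if c: "c \<in> {1..?n}" and 1: "\<pi>1 \<in> closed_NC 1 c" and 2: "\<pi>2 \<in> interval_NC (c + 1) ?n"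
    for c \<pi>1 \<pi>2
  proof -
    let ?K1 = "saturation_classes \<pi>1 {1..<c}" and ?K2 = "saturation_classes \<pi>2 {c..?n}"
    have "block_product (e False) w [] 0 (?K1 \<union> ?K2) =
      block_product (e False) w [] 0 ?K1 * block_product (e False) w [] 0 ?K2"
    proof (rule block_product_Un[where S = "{1..<c}" and T = "{c..?n}"])
      show "B \<subseteq> {1..<c}" if "B \<in> ?K1" for B using saturation_classes_subset[OF that] .
      show "B \<subseteq> {c..?n}" if "B \<in> ?K2" for B using saturation_classes_subset[OF that] .
      show "{} \<notin> ?K1" using saturation_classes_nonempty by blast
    qed (auto simp: finite_saturation_classes)
    moreover have "block_product (e False) w [] 0 ?K2 = block_product (e False) w [] c ?K2"
      by (rule block_product_no_prefix)
    ultimately show ?thesis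
      using saturation_classes_union(1)[OF 1 2] c block_product_interval_union[OF 1 2, of "e True" w 0]
      by (simp add: mult_ac)
  qed
  then have "(\<Sum>\<pi>\<in>interval_NC 1 ?n. block_product (e True) w [] 0 \<pi> *
      block_product (e False) w [] 0 (saturation_classes \<pi> {1..?n})) =
    (\<Sum>c\<in>{1..?n}. outer_sum e w [] 1 c * inner_sum e w [] c ?n)"
    using n unfolding inner_sum_def outer_sum_def
    by (subst sum_interval_NC) (simp_all add: sum_product)
  also have "\<dots> = chain_product e w"
    unfolding chain_product_def by (intro sum.cong refl) (simp add: chain_eq_sum)
  finally have sum: "(\<Sum>\<pi>\<in>NC ?n. block_product (e True) w [] 0 \<pi> *
      block_product (e False) w [] 0 (saturation_classes \<pi> {1..?n})) = chain_product e w"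
    unfolding NC_eq_interval_NC .
  show ?thesis
    unfolding sum[symmetric] by (intro sum.cong refl) (simp only: kreweras_eq_saturation_classes)
qed

theorem theorem2:
  fixes \<mu> \<nu> :: "'k::finite ncpoly \<Rightarrow> complex"
  assumes "\<mu> \<in> D_alg" and "\<nu> \<in> D_alg"
  shows "eta_series (\<mu> \<boxtimes> \<nu>) = boxed_conv (eta_series \<mu>) (eta_series \<nu>)"
proof (rule ncfps_eqI)
  fix w
  let ?e = "boolean_cumulants \<mu> \<nu>"
  have "nccoeff (eta_series (\<mu> \<boxtimes> \<nu>)) w = chain_product ?e w"
    by (simp add: free_mult_conv_eq[OF assms] eta_product_distribution)
  also have "\<dots> = nccoeff (boxed_conv (eta_series \<mu>) (eta_series \<nu>)) w"
    using sum_NC_eq_chain_product[of w ?e]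
    \<comment> \<open>At the empty word the left side is an empty sum and the right side is 0 by
      definition.\<close>
    by (cases "w = []") (simp_all add: chain_product_def boxed_conv_def
        nccoeff_part_eq_block_product boolean_cumulants_def)
  finally show "nccoeff (eta_series (\<mu> \<boxtimes> \<nu>)) w =
      nccoeff (boxed_conv (eta_series \<mu>) (eta_series \<nu>)) w" .
qed

end
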